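(* Assume A1 and A2 (see context). Then there exists $\varepsilon_0>0$ such that for each $\varepsilon\in(0,\varepsilon_0]$ the processes $\Gamma=\{\Gamma_t\}_{t\in\mathbb Z}$ (the controlled process driven by $\zeta$) and $\Gamma^\bullet=\{\Gamma^\bullet_t\}_{t\in\mathbb Z}$ (the stationary Markov chain with transition matrix $P_0$) can be constructed on a common probability space so that $(\Gamma,\Gamma^\bullet,\zeta)$ is jointly stationary on the two-sided time interval $\mathbb Z$, $\Gamma_t^\bullet$ is independent of $\zeta$, and moreover $$\Gamma_t=\Gamma_t^\bullet+\widetilde O(\varepsilon),\qquad \mathsf E[\Gamma_t\zeta_t]=O(\varepsilon^2).$$ Consequently, for the stationary process, $$B_t=B_t^\bullet+\widetilde O(\varepsilon),\qquad V_t=V_t^\bullet+\widetilde O(\varepsilon),\qquad \Delta_t=\Delta_t^\bullet+\widetilde O(\varepsilon).$$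
   Context: Setting. For each $\zeta\in\mathbb R$, $P_\zeta$ is a $d\times d$ transition (row-stochastic) matrix. A1: $P_0$ is irreducible and aperiodic; $\zeta\mapsto P_\zeta$ is twice continuously differentiable in a neighborhood of $\zeta=0$, with Lipschitz continuous second derivative. A2: $\zeta_t=\varepsilon\zeta^1_t$, where $\zeta^1=\{\zeta^1_t:t\in\mathbb Z\}$ is a real-valued stationary process with zero mean, $|\zeta^1_t|\le 1$ for all $t$ almost surely, and $\sum_{t\ge 0}|R_{\zeta^1}(t)|<\infty$ where $R_{\zeta^1}(t)=\mathsf E[\zeta^1_t\zeta^1_0]$. Processes. Let $e^1,\dots,e^d$ be the standard basis of $\mathbb R^d$, viewed as row vectors. $\Gamma$ takes values in $\{e^1,\dots,e^d\}$ and satisfies $\Gamma_{t+1}=\Gamma_tG_{t+1}$, $G_{t+1}=\mathcal G(\zeta_t,N_{t+1})$, where $\{N_t\}$ is i.i.d. and independent of $\zeta$, $N_{t+1}$ is independent of $(\zeta,(N_s,\Gamma_s)_{s\le t})$, $\mathcal G$ is a $d\times d$ matrix-valued function with entries in $\{0,1\}$ and each row summing to one, and $\mathsf E[\mathcal G(\zeta_t,N_{t+1})\mid\zeta]=P_{\zeta_t}$ (conditioning on the whole sequence $\zeta$). Thus, given the whole input $\zeta$ and the past of $\Gamma$ up to time $t$ with $\Gamma_t=e^j$, the probability that $\Gamma_{t+1}=e^k$ is $P_{\zeta_t}(j,k)$. $\Gamma^\bullet$ is the stationary Markov chain on $\{e^1,\dots,e^d\}$ with transition matrix $P_0$ (the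 case $\zeta\equiv0$). Notation. $\mathcal E=\frac{d}{d\zeta}P_\zeta|_{\zeta=0}$, $\mathcal W=\frac{d^2}{d\zeta^2}P_\zeta|_{\zeta=0}$; $B_t^{T}=\Gamma_t\mathcal E$, $V_t^{T}=\frac12\Gamma_t\mathcal W$, $\Delta_{t+1}=\Gamma_t(G_{t+1}-P_{\zeta_t})=\Gamma_{t+1}-\Gamma_tP_{\zeta_t}$; and $(B_t^\bullet)^{T}=\Gamma^\bullet_t\mathcal E$, $(V_t^\bullet)^{T}=\frac12\Gamma^\bullet_t\mathcal W$, $\Delta^\bullet_{t+1}=\Gamma^\bullet_{t+1}-\Gamma^\bullet_tP_0$. For random vectors $Y=Y(\varepsilon),Z=Z(\varepsilon)$, $Y=Z+\widetilde O(\varepsilon)$ means $\mathsf E\|Y-Z\|=O(\varepsilon)$. All $O(\cdot)$ bounds are with constants independent of $\varepsilon\in(0,\varepsilon_0]$. *)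

theory Defs
  imports "HOL-Probability.Probability"
begin

definition row_stochastic :: "real^'d^'d \<Rightarrow> bool" where
  "row_stochastic A \<longleftrightarrow> (\<forall>i j. 0 \<le> A $ i $ j) \<and> (\<forall>i. (\<Sum>j\<in>UNIV. A $ i $ j) = 1)"

text \<open>The overloaded power on \<open>real^'d^'d\<close> is componentwise, hence a separate matrix power.\<close>

definition mat_pow :: "real^'d^'d \<Rightarrow> nat \<Rightarrow> real^'d^'d" where
  "mat_pow A n = (((**) A) ^^ n) (mat 1)"

definition irreducible_matrix :: "real^'d^'d \<Rightarrow> bool" where
  "irreducible_matrix A \<longleftrightarrow> (\<forall>i j. \<exists>n. 0 < mat_pow A n $ i $ j)"

definition aperiodic_matrix :: "real^'d^'d \<Rightarrow> bool" where
  "aperiodic_matrix A \<longleftrightarrow> (\<forall>i. Gcd {n. 0 < n \<and> 0 < mat_pow A n $ i $ i} = 1)"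

definition deriv1 :: "(real \<Rightarrow> real^'d^'d) \<Rightarrow> real \<Rightarrow> real^'d^'d" where
  "deriv1 P z = vector_derivative P (at z)"

definition deriv2 :: "(real \<Rightarrow> real^'d^'d) \<Rightarrow> real \<Rightarrow> real^'d^'d" where
  "deriv2 P z = vector_derivative (deriv1 P) (at z)"

definition assumption_A1 :: "(real \<Rightarrow> real^'d^'d) \<Rightarrow> bool" where
  "assumption_A1 P \<longleftrightarrow>
     irreducible_matrix (P 0) \<and> aperiodic_matrix (P 0) \<and>
     (\<exists>\<delta>>0. (\<forall>z\<in>ball 0 \<delta>. P differentiable (at z) \<and> deriv1 P differentiable (at z)) \<and>
            continuous_on (ball 0 \<delta>) (deriv2 P) \<and>
            (\<exists>L. L-lipschitz_on (ball 0 \<delta>) (deriv2 P)))"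

definition path_law :: "'a measure \<Rightarrow> 'b measure \<Rightarrow> (int \<Rightarrow> 'a \<Rightarrow> 'b) \<Rightarrow> (int \<Rightarrow> 'b) measure" where
  "path_law M S X = distr M (PiM UNIV (\<lambda>_. S)) (\<lambda>\<omega> t. X t \<omega>)"

definition stationary :: "'a measure \<Rightarrow> 'b measure \<Rightarrow> (int \<Rightarrow> 'a \<Rightarrow> 'b) \<Rightarrow> bool" where
  "stationary M S X \<longleftrightarrow>
     (\<forall>t. X t \<in> M \<rightarrow>\<^sub>M S) \<and>
     (\<forall>k. path_law M S (\<lambda>t. X (t + k)) = path_law M S X)"

definition iid :: "'a measure \<Rightarrow> 'b measure \<Rightarrow> (int \<Rightarrow> 'a \<Rightarrow> 'b) \<Rightarrow> bool" where
  "iid M S X \<longleftrightarrow>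
     prob_space.indep_vars M (\<lambda>_. S) X UNIV \<and>
     (\<forall>s t. distr M S (X s) = distr M S (X t))"

text \<open>
  The library's \<open>indep_var\<close> needs both variables to have values in the same type; this is its
  heterogeneous version.
\<close>

definition indep_rv ::
    "'a measure \<Rightarrow> 'b measure \<Rightarrow> ('a \<Rightarrow> 'b) \<Rightarrow> 'c measure \<Rightarrow> ('a \<Rightarrow> 'c) \<Rightarrow> bool" where
  "indep_rv M S X T Y \<longleftrightarrow>
     X \<in> M \<rightarrow>\<^sub>M S \<and> Y \<in> M \<rightarrow>\<^sub>M T \<and>
     prob_space.indep_set M (sets (vimage_algebra (space M) X S)) (sets (vimage_algebra (space M) Y T))"

definition indep_processes ::
    "'a measure \<Rightarrow> 'b measure \<Rightarrow> (int \<Rightarrow> 'a \<Rightarrow> 'b) \<Rightarrow> 'c measure \<Rightarrow> (int \<Rightarrow> 'a \<Rightarrow> 'c) \<Rightarrow> bool" where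
  "indep_processes M S X T Y \<longleftrightarrow>
     indep_rv M (PiM UNIV (\<lambda>_. S)) (\<lambda>\<omega> t. X t \<omega>) (PiM UNIV (\<lambda>_. T)) (\<lambda>\<omega> t. Y t \<omega>)"

text \<open>The sigma-algebra generated by the family \<open>X t\<close>, \<open>t \<in> I\<close>.\<close>

definition sigma_of :: "'a measure \<Rightarrow> 'b measure \<Rightarrow> int set \<Rightarrow> (int \<Rightarrow> 'a \<Rightarrow> 'b) \<Rightarrow> 'a measure" where
  "sigma_of M S I X =
     vimage_algebra (space M) (\<lambda>\<omega>. restrict (\<lambda>t. X t \<omega>) I) (PiM I (\<lambda>_. S))"

definition assumption_A2 :: "'a measure \<Rightarrow> (int \<Rightarrow> 'a \<Rightarrow> real) \<Rightarrow> bool" where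
  "assumption_A2 M \<zeta>1 \<longleftrightarrow>
     stationary M borel \<zeta>1 \<and>
     (\<forall>t. (LINT \<omega>|M. \<zeta>1 t \<omega>) = 0) \<and>
     (AE \<omega> in M. \<forall>t. \<bar>\<zeta>1 t \<omega>\<bar> \<le> 1) \<and>
     summable (\<lambda>t::nat. \<bar>LINT \<omega>|M. \<zeta>1 (int t) \<omega> * \<zeta>1 0 \<omega>\<bar>)"

text \<open>
  The states are the standard basis vectors \<open>axis j 1\<close> of \<open>real^'d\<close>; a row vector times a
  matrix is written \<open>x v* A\<close>.
\<close>

definition basis_process :: "'a measure \<Rightarrow> (int \<Rightarrow> 'a \<Rightarrow> real^'d) \<Rightarrow> bool" where
  "basis_process M X \<longleftrightarrow>
     (\<forall>t. X t \<in> borel_measurable M \<and> (\<forall>\<omega>\<in>space M. \<exists>j. X t \<omega> = axis j 1))"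

definition selection_map :: "'n measure \<Rightarrow> (real \<Rightarrow> 'n \<Rightarrow> real^'d^'d) \<Rightarrow> bool" where
  "selection_map S \<G> \<longleftrightarrow>
     (\<lambda>(z, n). \<G> z n) \<in> borel \<Otimes>\<^sub>M S \<rightarrow>\<^sub>M borel \<and>
     (\<forall>z. \<forall>n\<in>space S. (\<forall>i j. \<G> z n $ i $ j \<in> {0, 1}) \<and>
                       (\<forall>i. (\<Sum>j\<in>UNIV. \<G> z n $ i $ j) = 1))"

text \<open>
  The input \<open>\<zeta>\<close> and the noise \<open>N\<close>; the last clause is \<open>E[\<G>(\<zeta>\<^sub>t, N\<^sub>t\<^sub>+\<^sub>1) | \<zeta>] = P(\<zeta>\<^sub>t)\<close>, entrywise,
  with conditioning on the whole two-sided sequence \<open>\<zeta>\<close>.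
\<close>

definition input_and_noise ::
    "'a measure \<Rightarrow> 'n measure \<Rightarrow> (real \<Rightarrow> real^'d^'d) \<Rightarrow> (real \<Rightarrow> 'n \<Rightarrow> real^'d^'d) \<Rightarrow>
     (int \<Rightarrow> 'a \<Rightarrow> real) \<Rightarrow> (int \<Rightarrow> 'a \<Rightarrow> 'n) \<Rightarrow> bool" where
  "input_and_noise M S P \<G> \<zeta> N \<longleftrightarrow>
     (\<forall>t. \<zeta> t \<in> borel_measurable M) \<and>
     iid M S N \<and>
     indep_processes M S N borel \<zeta> \<and>
     (\<forall>t i j. AE \<omega> in M.
        real_cond_exp M (sigma_of M borel UNIV \<zeta>) (\<lambda>\<omega>. \<G> (\<zeta> t \<omega>) (N (t + 1) \<omega>) $ i $ j) \<omega>
          = P (\<zeta> t \<omega>) $ i $ j)"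

definition controlled_process ::
    "'a measure \<Rightarrow> 'n measure \<Rightarrow> (real \<Rightarrow> real^'d^'d) \<Rightarrow> (real \<Rightarrow> 'n \<Rightarrow> real^'d^'d) \<Rightarrow>
     (int \<Rightarrow> 'a \<Rightarrow> real) \<Rightarrow> (int \<Rightarrow> 'a \<Rightarrow> 'n) \<Rightarrow> (int \<Rightarrow> 'a \<Rightarrow> real^'d) \<Rightarrow> bool" where
  "controlled_process M S P \<G> \<zeta> N \<Gamma> \<longleftrightarrow>
     input_and_noise M S P \<G> \<zeta> N \<and>
     basis_process M \<Gamma> \<and>
     (\<forall>t. AE \<omega> in M. \<Gamma> (t + 1) \<omega> = \<Gamma> t \<omega> v* \<G> (\<zeta> t \<omega>) (N (t + 1) \<omega>)) \<and>
     (\<forall>t. indep_rv M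
            S (N (t + 1))
            (PiM UNIV (\<lambda>_. borel) \<Otimes>\<^sub>M PiM {..t} (\<lambda>_. S \<Otimes>\<^sub>M borel))
            (\<lambda>\<omega>. (\<lambda>s. \<zeta> s \<omega>, restrict (\<lambda>s. (N s \<omega>, \<Gamma> s \<omega>)) {..t})))"

definition markov_chain :: "'a measure \<Rightarrow> real^'d^'d \<Rightarrow> (int \<Rightarrow> 'a \<Rightarrow> real^'d) \<Rightarrow> bool" where
  "markov_chain M A X \<longleftrightarrow>
     basis_process M X \<and>
     (\<forall>t k. AE \<omega> in M.
        real_cond_exp M (sigma_of M borel {..t} X) (\<lambda>\<omega>. of_bool (X (t + 1) \<omega> = axis k 1)) \<omega>
          = (X t \<omega> v* A) $ k)"

definition B_process ::
    "(real \<Rightarrow> real^'d^'d) \<Rightarrow> (int \<Rightarrow> 'a \<Rightarrow> real^'d) \<Rightarrow> int \<Rightarrow> 'a \<Rightarrow> real^'d" where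
  "B_process P \<Gamma> t \<omega> = \<Gamma> t \<omega> v* deriv1 P 0"

definition V_process ::
    "(real \<Rightarrow> real^'d^'d) \<Rightarrow> (int \<Rightarrow> 'a \<Rightarrow> real^'d) \<Rightarrow> int \<Rightarrow> 'a \<Rightarrow> real^'d" where
  "V_process P \<Gamma> t \<omega> = (1/2) *\<^sub>R (\<Gamma> t \<omega> v* deriv2 P 0)"

definition Delta_process ::
    "(real \<Rightarrow> real^'d^'d) \<Rightarrow> (int \<Rightarrow> 'a \<Rightarrow> real) \<Rightarrow> (int \<Rightarrow> 'a \<Rightarrow> real^'d) \<Rightarrow> int \<Rightarrow> 'a \<Rightarrow> real^'d" where
  "Delta_process P \<zeta> \<Gamma> t \<omega> = \<Gamma> t \<omega> - \<Gamma> (t - 1) \<omega> v* P (\<zeta> (t - 1) \<omega>)"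

text \<open>
  \<open>E\<parallel>Y - Z\<parallel> \<le> b\<close>. Integrability is required explicitly because the Bochner integral of a
  non-integrable function is 0.
\<close>

definition L1_close ::
    "'a measure \<Rightarrow> ('a \<Rightarrow> real^'d) \<Rightarrow> ('a \<Rightarrow> real^'d) \<Rightarrow> real \<Rightarrow> bool" where
  "L1_close M Y Z b \<longleftrightarrow>
     integrable M (\<lambda>\<omega>. Y \<omega> - Z \<omega>) \<and> (LINT \<omega>|M. norm (Y \<omega> - Z \<omega>)) \<le> b"

text \<open>
  A common probability space may be taken on a space of paths: the joint law of any realisation
  \<open>(\<zeta>, N, \<Gamma>, \<Gamma>\<^sup>\<bullet>)\<close> is a measure on this type.
\<close>

type_synonym ('n, 'd) paths = "int \<Rightarrow> real \<times> 'n \<times> (real^'d) \<times> (real^'d)"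

end

theory Submission
  imports Defs
begin

text \<open>
  Let \<open>\<delta>\<close> be of order \<open>\<epsilon>\<close> with \<open>P z \<ge> (1 - \<delta>) P 0\<close> entrywise for \<open>\<bar>z\<bar> \<le> \<epsilon>\<close>. At each time draw an i.i.d. seed, independent
  of the input: a random self-map of the states whose value at \<open>i\<close> has law \<open>P 0 i\<close>, and a coin of
  probability \<open>\<delta>\<close>. The chain \<open>\<Gamma>'\<close> always follows the map. The process \<open>\<Gamma>\<close> follows the same map unless the
  coin asks for a perturbed step, in which case it moves according to the residual part of \<open>P z\<close>.
  Since \<open>P 0\<close> is primitive, some finite word of maps with positive probability sends all states to
  one, so both chains can be started at time \<open>-\<infinity>\<close> (coupling from the past); this makes them
  shift-equivariant functions of input and seeds, hence jointly stationary. If \<open>m\<close> is the length of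
  the word and \<open>c\<close> its probability, then \<open>a = Pr(\<Gamma> t \<noteq> \<Gamma>' t)\<close> does not depend on \<open>t\<close> and satisfies
  \<open>a \<le> m \<delta> + (1 - c) a\<close>, so it is of order \<open>\<epsilon>\<close>.

  The noise is only constructed afterwards, by rejection sampling from i.i.d. candidates: given the
  input and the transition of \<open>\<Gamma>\<close>, one takes the first candidate that produces this transition. The
  law of the accepted noise, averaged over the seed, is the given noise law for every input and state.
\<close>

section \<open>Primitive matrices and coupling from the past\<close>

text \<open>The noise space is arbitrary, so a regular conditional law of the noise given a
  transition need not exist; rejection sampling realizes this law without any disintegration. The
  obstacle is that the noise must be independent of the whole input, its future included, and of the
  past states, although \<Gamma>' is to be driven by seeds that do not see the input. The residual
  decomposition resolves this: the coin has the same bias for every input value and state, and can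
  therefore belong to a seed. As \<Gamma>' reads only the seeds, it is independent of the input, and
  since the input is centred, E[\<zeta> \<Gamma>] = E[\<zeta> (\<Gamma> - \<Gamma>')]. One factor
  \<epsilon> comes from the size of the input, the other from the coupling. For uniformity in
  \<epsilon>, the word has to occur with all coins off; this costs a factor (1 - \<delta>)^m, which
  is at least 2^-m once \<delta> \<le> 1/2.\<close>

lemma add_closed_Gcd_1_cofinite:
  fixes A :: "nat set"
  assumes add: "\<And>a b. a \<in> A \<Longrightarrow> b \<in> A \<Longrightarrow> a + b \<in> A" and gcd: "Gcd A = 1"
  shows "\<exists>n0. \<forall>n\<ge>n0. n \<in> A"
proof -
  \<comment> \<open>With 0 adjoined, every element of \<open>A\<close> is a difference of two
    elements and zeroth multiples are available.\<close>
  define A0 where "A0 = insert 0 A"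
  have add0: "a + b \<in> A0" if "a \<in> A0" "b \<in> A0" for a b
    using that add by (auto simp: A0_def)
  have mult0: "k * a \<in> A0" if "a \<in> A0" for k a
    using that by (induction k) (auto intro: add0, simp add: A0_def)
  define D where "D d \<longleftrightarrow> 0 < d \<and> (\<exists>b. b \<in> A0 \<and> b + d \<in> A0)" for d
  obtain a where a: "a \<in> A" "a \<noteq> 0"
  proof (cases "A \<subseteq> {0}")
    case True
    then have "A = {} \<or> A = {0}" by auto
    with gcd show ?thesis by auto
  qed (use that in auto)
  then have "D a" by (auto simp: D_def A0_def)
  \<comment> \<open>The least positive difference divides all of \<open>A\<close>, hence equals 1;
    this yields two consecutive elements \<open>b\<close> and \<open>b + 1\<close>.\<close>
  define d where "d = (LEAST d. D d)"
  have Dd: "D d" and least: "\<And>e. D e \<Longrightarrow> d \<le> e"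
    unfolding d_def using \<open>D a\<close> by (auto intro: LeastI Least_le)
  obtain b where b: "b \<in> A0" "b + d \<in> A0" and d0: "0 < d" using Dd by (auto simp: D_def)
  have "d dvd x" if x: "x \<in> A" for x
  proof (rule ccontr)
    assume "\<not> d dvd x"
    then have r: "0 < x mod d" "x mod d < d" using d0 by (auto simp: dvd_eq_mod_eq_0)
    \<comment> \<open>The remainder is itself the difference of \<open>x + k * b\<close> and
      \<open>k * (b + d)\<close>, against minimality.\<close>
    define k where "k = x div d"
    have xk: "x = k * d + x mod d" by (simp add: k_def)
    have "k * (b + d) \<in> A0" by (rule mult0) (rule b)
    moreover have "x + k * b \<in> A0" using b(1) x by (intro mult0 add0) (simp add: A0_def)
    moreover have "k * (b + d) + x mod d = x + k * b" by (subst (2) xk) (simp add: algebra_simps)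
    ultimately have "D (x mod d)" using r by (auto simp: D_def)
    with least r show False by force
  qed
  then have "d dvd Gcd A" by (rule Gcd_greatest)
  with gcd have [simp]: "d = 1" by simp
  \<comment> \<open>From \<open>b * b\<close> on, the quotient by \<open>b\<close> is at least the
    remainder \<open>r\<close>, so \<open>r\<close> copies of \<open>b\<close> can be traded for
    \<open>b + 1\<close>. The further 1 excludes n = 0, which lies in \<open>A0\<close> but perhaps
    not in \<open>A\<close>.\<close>
  show ?thesis
  proof (intro exI[of _ "b * b + 1"] allI impI)
    fix n assume n: "b * b + 1 \<le> n"
    show "n \<in> A"
    proof (cases "b = 0")
      case True
      with b have "1 \<in> A0" by simp
      then show ?thesis using mult0[of 1 n] n by (auto simp: A0_def)
    next
      case False
      define q r where "q = n div b" and "r = n mod b"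
      have qr: "n = q * b + r" and "r < b" using False by (auto simp: q_def r_def)
      have "b \<le> q" using n False by (simp add: q_def less_eq_div_iff_mult_less_eq)
      then have "n = (q - r) * b + r * (b + d)"
        using \<open>r < b\<close> qr by (simp add: algebra_simps diff_mult_distrib2)
      moreover have "(q - r) * b + r * (b + d) \<in> A0" using b by (intro add0[OF mult0 mult0])
      ultimately have "n \<in> A0" by simp
      with n show ?thesis by (auto simp: A0_def)
    qed
  qed
qed

lemma mat_pow_Suc: "mat_pow A (Suc n) = A ** mat_pow A n"
  by (simp add: mat_pow_def)

lemma mat_pow_add: "mat_pow A (m + n) = mat_pow A m ** mat_pow A n"
proof (induction m)
  case 0
  then show ?case by (simp add: mat_pow_def)
next
  case (Suc m)
  then show ?case by (simp add: mat_pow_Suc matrix_mul_assoc)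
qed

context
  fixes A :: "real^'d^'d"
  assumes nonneg: "\<And>i j. 0 \<le> A $ i $ j"
begin

lemma mat_pow_nonneg: "0 \<le> mat_pow A n $ i $ j"
proof (induction n arbitrary: i j)
  case 0
  then show ?case by (simp add: mat_pow_def mat_def)
next
  case (Suc n)
  then show ?case by (simp add: mat_pow_Suc matrix_matrix_mult_def sum_nonneg nonneg)
qed

lemma mat_pow_add_pos:
  assumes "0 < mat_pow A m $ i $ j" "0 < mat_pow A n $ j $ k"
  shows "0 < mat_pow A (m + n) $ i $ k"
proof -
  have "0 < mat_pow A m $ i $ j * mat_pow A n $ j $ k" using assms by simp
  also have "\<dots> \<le> (\<Sum>l\<in>UNIV. mat_pow A m $ i $ l * mat_pow A n $ l $ k)"
    by (rule member_le_sum) (auto intro!: mat_pow_nonneg mult_nonneg_nonneg)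
  finally show ?thesis by (simp add: mat_pow_add matrix_matrix_mult_def)
qed

text \<open>The return times to \<open>j\<close> are closed under addition and have gcd 1, so loops
  of every large length exist at \<open>j\<close>; a path from \<open>i\<close> to \<open>j\<close>
  is prolonged by such a loop. Finitely many pairs admit a common exponent.\<close>

lemma primitive_matrix:
  assumes "irreducible_matrix A" "aperiodic_matrix A"
  shows "\<exists>m. \<forall>i j. 0 < mat_pow A m $ i $ j"
proof -
  have "\<exists>n0. \<forall>n\<ge>n0. 0 < mat_pow A n $ i $ j" for i j
  proof -
    obtain r where r: "0 < mat_pow A r $ i $ j"
      using assms(1) by (auto simp: irreducible_matrix_def)
    have "\<exists>n0. \<forall>n\<ge>n0. n \<in> {n. 0 < n \<and> 0 < mat_pow A n $ j $ j}"
      by (rule add_closed_Gcd_1_cofinite)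
         (use assms(2) in \<open>auto simp: aperiodic_matrix_def intro: mat_pow_add_pos\<close>)
    then obtain n0 where n0: "\<And>n. n0 \<le> n \<Longrightarrow> 0 < mat_pow A n $ j $ j" by auto
    have "0 < mat_pow A n $ i $ j" if "r + n0 \<le> n" for n
      using mat_pow_add_pos[OF r n0[of "n - r"]] that by simp
    then show ?thesis by blast
  qed
  then obtain n0 where n0: "\<And>i j n. n0 i j \<le> n \<Longrightarrow> 0 < mat_pow A n $ i $ j" by metis
  have "0 < mat_pow A (Max (range (\<lambda>(i, j). n0 i j))) $ i $ j" for i j
    by (rule n0, rule Max_ge) (auto intro: image_eqI[where x = "(i, j)"])
  then show ?thesis by blast
qed

end

section \<open>Backward compositions of self-maps and their coalescence\<close>

text \<open>\<open>h s\<close> moves a state from time \<open>s\<close> to \<open>s + 1\<close>, so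
  this is the flow from time \<open>t - n\<close> to time \<open>t\<close>. Going further back
  composes on the inside; hence a composition that has become constant stays the same
  constant.\<close>

primrec bcomp :: "(int \<Rightarrow> 's \<Rightarrow> 's) \<Rightarrow> int \<Rightarrow> nat \<Rightarrow> 's \<Rightarrow> 's" where
  "bcomp h t 0 = id"
| "bcomp h t (Suc n) = bcomp h t n \<circ> h (t - int n - 1)"

definition coal :: "(int \<Rightarrow> 's \<Rightarrow> 's) \<Rightarrow> int \<Rightarrow> bool" where
  "coal h t \<longleftrightarrow> (\<exists>n j. \<forall>i. bcomp h t n i = j)"

text \<open>Arbitrary but fixed if the past never coalesces.\<close>

definition cval :: "(int \<Rightarrow> 's \<Rightarrow> 's) \<Rightarrow> int \<Rightarrow> 's" where
  "cval h t = (if coal h t then THE j. \<exists>n. \<forall>i. bcomp h t n i = j else undefined)"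

lemma bcomp_add: "bcomp h t (m + n) = bcomp h t m \<circ> bcomp h (t - int m) n"
  by (induction n) (auto simp: fun_eq_iff algebra_simps)

lemma bcomp_Suc_left: "bcomp h (t + 1) (Suc n) = h t \<circ> bcomp h t n"
  using bcomp_add[of h "t + 1" 1 n] by simp

lemma bcomp_shift: "bcomp (\<lambda>s. h (s + k)) t n = bcomp h (t + k) n"
  by (induction n) (auto simp: algebra_simps)

lemma bcomp_cong:
  assumes "\<And>s. t - int n \<le> s \<Longrightarrow> s < t \<Longrightarrow> h s = h' s"
  shows "bcomp h t n = bcomp h' t n"
  using assms
proof (induction n)
  case (Suc n)
  then have "bcomp h t n = bcomp h' t n" "h (t - int n - 1) = h' (t - int n - 1)" by auto
  then show ?case by simp
qed simp

text \<open>The longer composition factors through the shorter one. This makes the value in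
  \<open>cval\<close> well defined.\<close>

lemma bcomp_const_unique:
  assumes "\<And>i. bcomp h t n i = j" "\<And>i. bcomp h t n' i = j'"
  shows "j = j'"
proof (cases "n \<le> n'")
  case True
  then have "bcomp h t n' = bcomp h t n \<circ> bcomp h (t - int n) (n' - n)"
    by (metis bcomp_add le_add_diff_inverse)
  then show ?thesis using assms by (metis comp_apply)
next
  case False
  then have "bcomp h t n = bcomp h t n' \<circ> bcomp h (t - int n') (n - n')"
    by (metis bcomp_add le_add_diff_inverse nat_le_linear)
  then show ?thesis using assms by (metis comp_apply)
qed

lemma cval_eqI:
  assumes "\<And>i. bcomp h t n i = j"
  shows "coal h t" "cval h t = j"
proof -
  show c: "coal h t" using assms by (auto simp: coal_def)
  show "cval h t = j" unfolding cval_def if_P[OF c]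
    by (rule the_equality) (use assms bcomp_const_unique in metis)+
qed

lemma coal_const:
  assumes "coal h t"
  obtains n where "\<And>i. bcomp h t n i = cval h t"
  using assms cval_eqI(2) unfolding coal_def by metis

text \<open>A constant map followed by further maps is constant, so coalescence persists and the
  coalesced value obeys the recursion of the chain.\<close>

lemma coal_bcomp:
  assumes "coal h (t - int m)"
  shows "coal h t" "cval h t = bcomp h t m (cval h (t - int m))"
proof -
  obtain n where n: "\<And>i. bcomp h (t - int m) n i = cval h (t - int m)"
    using coal_const[OF assms] by blast
  have "bcomp h t (m + n) i = bcomp h t m (cval h (t - int m))" for i
    by (simp add: bcomp_add n)
  from cval_eqI[OF this] show "coal h t" "cval h t = bcomp h t m (cval h (t - int m))" by auto
qed

lemma cval_step: "coal h t \<Longrightarrow> cval h (t + 1) = h t (cval h t)"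
  using coal_bcomp(2)[of h "t + 1" 1] by simp

lemma coal_shift: "coal (\<lambda>s. h (s + k)) t = coal h (t + k)"
  by (simp add: coal_def bcomp_shift)

lemma cval_shift: "cval (\<lambda>s. h (s + k)) t = cval h (t + k)"
  by (simp add: cval_def bcomp_shift coal_shift)

text \<open>The map at time \<open>t\<close> itself does not enter, which later makes the state at
  \<open>t\<close> a function of the input and of the seeds before \<open>t\<close>.\<close>

lemma past_cong:
  assumes "\<And>s. s < t \<Longrightarrow> h s = h' s"
  shows "coal h t = coal h' t" "cval h t = cval h' t"
proof -
  have "bcomp h t n = bcomp h' t n" for n using assms by (auto intro: bcomp_cong)
  then have eq: "bcomp h t = bcomp h' t" by (rule ext)
  show "coal h t = coal h' t" "cval h t = cval h' t" unfolding coal_def cval_def eq by simp_all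
qed

text \<open>A state that can still reach \<open>j\<close> in \<open>m - l\<close> steps is sent to
  one that can reach \<open>j\<close> in one step less. The routes of different states need not
  merge before time \<open>m\<close>.\<close>

lemma synchronizing_word:
  fixes A :: "real^'d^'d"
  assumes nonneg: "\<And>i j. 0 \<le> A $ i $ j" and prim: "\<And>i j. 0 < mat_pow A m $ i $ j"
  obtains w j where "\<And>l i. l < m \<Longrightarrow> 0 < A $ i $ w l i"
    "\<And>h s i. (\<And>l. l < m \<Longrightarrow> h (s + int l) = w l) \<Longrightarrow> bcomp h (s + int m) m i = j"
proof -
  \<comment> \<open>Any state can serve as the target, since all entries of the \<open>m\<close>-th
    power are positive.\<close>
  define j :: 'd where "j = undefined"
  have step: "\<exists>k. 0 < A $ i $ k \<and> 0 < mat_pow A n $ k $ j" if "0 < mat_pow A (Suc n) $ i $ j" for n i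
  proof (rule ccontr)
    assume *: "\<not> ?thesis"
    have "A $ i $ k * mat_pow A n $ k $ j \<le> 0" for k
      using * nonneg[of i k] mat_pow_nonneg[of A n k j, OF nonneg]
      by (metis linorder_not_less order_le_less mult_eq_0_iff mult_pos_pos order_refl)
    then have "(\<Sum>k\<in>UNIV. A $ i $ k * mat_pow A n $ k $ j) \<le> 0" by (rule sum_nonpos)
    with that show False by (simp add: mat_pow_Suc matrix_matrix_mult_def)
  qed
  \<comment> \<open>The letters must also be positive at states that cannot reach \<open>j\<close>
    in time, as the probability of a letter is a product over all states.\<close>
  have some: "\<exists>k. 0 < A $ i $ k" if "0 < m" for i
  proof -
    have "m = Suc (m - 1)" using that by simp
    then obtain n where "m = Suc n" by blast
    then show ?thesis using step[of n i] prim[of i j] by auto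
  qed
  have "\<exists>k. 0 < A $ i $ k \<and> (0 < mat_pow A (m - l) $ i $ j \<longrightarrow> 0 < mat_pow A (m - Suc l) $ k $ j)"
    if "l < m" for i l
  proof (cases "0 < mat_pow A (m - l) $ i $ j")
    case True
    moreover have "m - l = Suc (m - Suc l)" using that by simp
    ultimately show ?thesis using step[of "m - Suc l" i] by auto
  next
    case False
    then show ?thesis using some[of i] that by auto
  qed
  then obtain w where w: "\<And>i l. l < m \<Longrightarrow> 0 < A $ i $ w l i"
    "\<And>i l. l < m \<Longrightarrow> 0 < mat_pow A (m - l) $ i $ j \<Longrightarrow> 0 < mat_pow A (m - Suc l) $ w l i $ j"
    by metis
  have "bcomp h (s + int m) m i = j" if h: "\<And>l. l < m \<Longrightarrow> h (s + int l) = w l" for h s i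
  proof -
    have "0 < mat_pow A (m - l) $ bcomp h (s + int l) l i $ j" if "l \<le> m" for l
      using that
    proof (induction l)
      case 0
      then show ?case using prim by simp
    next
      case (Suc l)
      then have "bcomp h (s + int (Suc l)) (Suc l) i = w l (bcomp h (s + int l) l i)"
        using bcomp_Suc_left[of h "s + int l" l] h[of l]
        by (simp add: algebra_simps del: bcomp.simps)
      with Suc w(2) show ?case by (simp del: bcomp.simps)
    qed
    \<comment> \<open>For \<open>l = m\<close> the remaining power is the identity matrix, which is
      positive on the diagonal only.\<close>
    from this[of m] show ?thesis by (auto simp: mat_pow_def mat_def split: if_splits)
  qed
  with w(1) show thesis by (rule that)
qed

section \<open>Rejection sampling\<close>

definition first :: "('a \<Rightarrow> bool) \<Rightarrow> 'a stream \<Rightarrow> 'a" where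
  "first Q s = s !! (LEAST k. Q (s !! k))"

lemma first_Stream:
  assumes "Q x \<or> (\<exists>k. Q (s !! k))"
  shows "first Q (x ## s) = (if Q x then x else first Q s)"
proof (cases "Q x")
  case True
  then have "(LEAST k. Q ((x ## s) !! k)) = 0" by (intro Least_equality) auto
  then show ?thesis using True by (simp add: first_def)
next
  case False
  with assms obtain k where "Q ((x ## s) !! Suc k)" by auto
  then have "(LEAST k. Q ((x ## s) !! k)) = Suc (LEAST k. Q ((x ## s) !! Suc k))"
    by (rule Least_Suc) (use False in simp)
  then show ?thesis using False by (simp add: first_def)
qed

lemma first_accepts: "\<exists>k. Q (s !! k) \<Longrightarrow> Q (first Q s)"
  unfolding first_def by (rule LeastI_ex)

text \<open>Holds even if no entry is accepted: the index is then unspecified, but it is still an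
  index.\<close>

lemma first_in_space: "s \<in> streams A \<Longrightarrow> first Q s \<in> A"
  by (simp add: first_def snth_in)

lemma measurable_first:
  assumes [measurable]: "Measurable.pred (N \<Otimes>\<^sub>M M) (\<lambda>(c, x). Q c x)"
  shows "(\<lambda>(c, s). first (Q c) s) \<in> N \<Otimes>\<^sub>M stream_space M \<rightarrow>\<^sub>M M"
  unfolding first_def split_beta'
  by (rule measurable_compose_countable[where f = "\<lambda>k x. snd x !! k"]) measurable

text \<open>Splitting off the head of the stream gives a linear equation for the probability x of
  accepting at some time with first accepted value in \<open>B\<close>: x = prob(\<open>B\<close>
  and \<open>Q\<close>) + (1 - prob \<open>Q\<close>) x.\<close>

lemma (in prob_space) prob_first_accepted:
  assumes [measurable]: "Measurable.pred M Q" and B[measurable]: "B \<in> sets M"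
    and pos: "0 < prob {x\<in>space M. Q x}"
  shows "measure (stream_space M) {s\<in>streams (space M). first Q s \<in> B}
      = prob {x\<in>B. Q x} / prob {x\<in>space M. Q x}"
    and "AE s in stream_space M. Q (first Q s)"
proof -
  interpret S: prob_space "stream_space M" by (rule prob_space_stream_space)
  have [measurable]: "first Q \<in> stream_space M \<rightarrow>\<^sub>M M"
    unfolding first_def
    by (rule measurable_compose_countable[where f = "\<lambda>k s. s !! k"]) measurable
  \<comment> \<open>Acceptance is part of the event, so the equation holds before acceptance is
    known to be almost sure; the case of the full space then proves that it is.\<close>
  have *: "measure (stream_space M) {s\<in>streams (space M). (\<exists>k. Q (s !! k)) \<and> first Q s \<in> B} * prob {x\<in>space M. Q x}
      = prob {x\<in>B. Q x}" if [measurable]: "B \<in> sets M" for B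
  proof -
    define E where "E = {s\<in>space (stream_space M). (\<exists>k. Q (s !! k)) \<and> first Q s \<in> B}"
    have [measurable]: "E \<in> sets (stream_space M)" unfolding E_def by measurable
    have E_sub: "E \<subseteq> space (stream_space M)" by (auto simp: E_def)
    have QB[measurable]: "{x\<in>B. Q x} \<in> sets M"
    proof -
      have "{x\<in>B. Q x} = {x\<in>space M. x \<in> B \<and> Q x}" using sets.sets_into_space[OF that] by auto
      then show ?thesis by simp
    qed
    have E_iff: "x ## s \<in> E \<longleftrightarrow> (if Q x then x \<in> B else s \<in> E)"
      if "x \<in> space M" "s \<in> streams (space M)" for x s
    proof (cases "Q x \<or> (\<exists>k. Q (s !! k))")
      case True
      moreover have "\<exists>k. Q ((x ## s) !! k)"
        using True by (metis snth.simps(1) snth_Stream stream.sel(1))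
      ultimately show ?thesis using that
        by (auto simp: E_def space_stream_space first_Stream streams_Stream)
    next
      case False
      \<comment> \<open>Neither head nor tail is ever accepted, so neither stream lies in
        \<open>E\<close>.\<close>
      then have "\<not> Q ((x ## s) !! k)" for k by (cases k) auto
      then show ?thesis using that False by (auto simp: E_def space_stream_space)
    qed
    have "ennreal (S.prob E) = (\<integral>\<^sup>+x. ennreal (S.prob {s\<in>space (stream_space M). x ## s \<in> E}) \<partial>M)"
      using emeasure_stream_space[of E] by (simp add: S.emeasure_eq_measure)
    also have "\<dots> = (\<integral>\<^sup>+x. ennreal (indicator {x\<in>B. Q x} x + S.prob E * indicator {x\<in>space M. \<not> Q x} x) \<partial>M)"
    proof (rule nn_integral_cong)
      fix x assume x: "x \<in> space M"
      have "{s\<in>space (stream_space M). x ## s \<in> E} = (if Q x then if x \<in> B then space (stream_space M) else {} else E)"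
      proof -
        have "{s\<in>space (stream_space M). x ## s \<in> E} = {s\<in>space (stream_space M). if Q x then x \<in> B else s \<in> E}"
          using E_iff[OF x] by (intro Collect_cong conj_cong refl) (simp add: space_stream_space)
        also have "\<dots> = (if Q x then if x \<in> B then space (stream_space M) else {} else E)"
          using E_sub by (cases "Q x"; cases "x \<in> B") auto
        finally show ?thesis .
      qed
      then show "ennreal (S.prob {s\<in>space (stream_space M). x ## s \<in> E})
          = ennreal (indicator {x\<in>B. Q x} x + S.prob E * indicator {x\<in>space M. \<not> Q x} x)"
        using x S.prob_space by (auto simp: indicator_def)
    qed
    also have "\<dots> = ennreal (\<integral>x. indicator {x\<in>B. Q x} x + S.prob E * indicator {x\<in>space M. \<not> Q x} x \<partial>M)"
      by (intro nn_integral_eq_integral) (auto simp: integrable_real_indicator emeasure_eq_measure)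
    finally have "S.prob E = (\<integral>x. indicator {x\<in>B. Q x} x + S.prob E * indicator {x\<in>space M. \<not> Q x} x \<partial>M)"
      by (subst (asm) ennreal_inj) (auto intro!: integral_nonneg_AE)
    also have "\<dots> = prob {x\<in>B. Q x} + S.prob E * prob {x\<in>space M. \<not> Q x}"
      by (subst Bochner_Integration.integral_add) (auto simp: integrable_real_indicator emeasure_eq_measure)
    also have "prob {x\<in>space M. \<not> Q x} = 1 - prob {x\<in>space M. Q x}"
      by (rule prob_neg) simp
    finally show ?thesis
      by (simp add: E_def space_stream_space algebra_simps)
  qed
  from *[of "space M"] pos have "S.prob {s\<in>space (stream_space M). \<exists>k. Q (s !! k)} = 1"
    by (simp add: space_stream_space first_in_space cong: conj_cong)
  then have ev: "AE s in stream_space M. \<exists>k. Q (s !! k)"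
    by (subst (asm) S.prob_Collect_eq_1) auto
  show "AE s in stream_space M. Q (first Q s)"
    using ev by eventually_elim (rule first_accepts)
  have "measure (stream_space M) {s\<in>streams (space M). first Q s \<in> B}
      = measure (stream_space M) {s\<in>streams (space M). (\<exists>k. Q (s !! k)) \<and> first Q s \<in> B}"
    unfolding space_stream_space[symmetric]
  proof (rule measure_eq_AE)
    show "AE s in stream_space M. (s \<in> {s\<in>space (stream_space M). first Q s \<in> B})
        = (s \<in> {s\<in>space (stream_space M). (\<exists>k. Q (s !! k)) \<and> first Q s \<in> B})"
      using ev by eventually_elim auto
  qed measurable
  with *[OF B] pos show "measure (stream_space M) {s\<in>streams (space M). first Q s \<in> B}
      = prob {x\<in>B. Q x} / prob {x\<in>space M. Q x}"
    by (simp add: field_simps)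
qed

section \<open>One step of the coupling\<close>

lemma (in prob_space) measure_pair_Times:
  "A \<in> sets N \<Longrightarrow> B \<in> sets M \<Longrightarrow> measure (N \<Otimes>\<^sub>M M) (A \<times> B) = measure N A * prob B"
  by (simp add: measure_def emeasure_pair_measure_Times enn2real_mult)

text \<open>\<open>gm z n\<close> is the self-map of the states encoded by a 0-1 matrix, and
  \<open>Z\<close> is the law of the input. The minorization is demanded at every \<open>z\<close>,
  so exceptional input values are dealt with only when the locale is instantiated.\<close>

locale coupling =
  fixes \<rho> :: "'n measure" and gm :: "real \<Rightarrow> 'n \<Rightarrow> 'd::finite \<Rightarrow> 'd"
    and p :: "'d \<Rightarrow> 'd pmf" and \<delta> :: real and Z :: "(int \<Rightarrow> real) measure"
  assumes prob_rho: "prob_space \<rho>"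
    and gm_measurable: "\<And>i. (\<lambda>(z, n). gm z n i) \<in> borel \<Otimes>\<^sub>M \<rho> \<rightarrow>\<^sub>M count_space UNIV"
    and delta: "0 < \<delta>" "\<delta> < 1"
    and minorization: "\<And>z i j. (1 - \<delta>) * pmf (p i) j \<le> measure \<rho> {n\<in>space \<rho>. gm z n i = j}"
    and prob_Z: "prob_space Z" and sets_Z: "sets Z = sets (PiM UNIV (\<lambda>_. borel))"
    and shift_Z: "\<And>k. distr Z Z (\<lambda>w t. w (t + k)) = Z"
begin

sublocale rho: prob_space \<rho> by (rule prob_rho)

definition q :: "real \<Rightarrow> 'd \<Rightarrow> 'd \<Rightarrow> real" where
  "q z i j = measure \<rho> {n\<in>space \<rho>. gm z n i = j}"

text \<open>
  In a perturbed step a candidate noise leading to \<open>j\<close> is accepted with probability \<open>wt z i j\<close>, so that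
  \<open>j\<close> has the residual law \<open>(q z i j - (1 - \<delta>) * pmf (p i) j) / \<delta>\<close>.
\<close>

definition wt :: "real \<Rightarrow> 'd \<Rightarrow> 'd \<Rightarrow> real" where
  "wt z i j = 1 - (1 - \<delta>) * pmf (p i) j / q z i j"

text \<open>The uniform second coordinate turns acceptance with probability \<open>wt\<close> into a
  deterministic test of a candidate.\<close>

definition cand :: "('n \<times> real) measure" where
  "cand = \<rho> \<Otimes>\<^sub>M uniform_measure lborel {0..1}"

definition acc :: "real \<Rightarrow> 'd \<Rightarrow> ('d \<Rightarrow> 'd) \<times> bool \<Rightarrow> 'n \<times> real \<Rightarrow> bool" where
  "acc z i c x = (if snd c then snd x < wt z i (gm z (fst x) i) else gm z (fst x) i = fst c i)"

text \<open>The images of different states are drawn independently, so every map with only possible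
  transitions has positive probability; the letters of the synchronizing word rely on this.\<close>

definition choice :: "(('d \<Rightarrow> 'd) \<times> bool) pmf" where
  "choice = pair_pmf (Pi_pmf UNIV undefined p) (bernoulli_pmf \<delta>)"

definition \<xi> :: "((('d \<Rightarrow> 'd) \<times> bool) \<times> ('n \<times> real) stream) measure" where
  "\<xi> = measure_pmf choice \<Otimes>\<^sub>M stream_space cand"

definition nu :: "real \<Rightarrow> 'd \<Rightarrow> (('d \<Rightarrow> 'd) \<times> bool) \<times> ('n \<times> real) stream \<Rightarrow> 'n" where
  "nu z i x = fst (first (acc z i (fst x)) (snd x))"

text \<open>With the coin off the state is read from the map and not from the accepted noise: it
  then agrees surely with the step of the second chain, while the agreement with \<open>gm\<close>
  holds only almost surely.\<close>

definition st :: "real \<Rightarrow> 'd \<Rightarrow> (('d \<Rightarrow> 'd) \<times> bool) \<times> ('n \<times> real) stream \<Rightarrow> 'd" where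
  "st z i x = (if snd (fst x) then gm z (nu z i x) i else fst (fst x) i)"

lemma gm_measurable'[measurable (raw)]:
  "f \<in> M \<rightarrow>\<^sub>M borel \<Longrightarrow> g \<in> M \<rightarrow>\<^sub>M \<rho> \<Longrightarrow> (\<lambda>x. gm (f x) (g x) i) \<in> M \<rightarrow>\<^sub>M count_space UNIV"
  using measurable_compose[OF measurable_Pair gm_measurable] by simp

lemma q_measurable[measurable (raw)]:
  assumes "f \<in> borel_measurable M"
  shows "(\<lambda>x. q (f x) i j) \<in> borel_measurable M"
proof -
  have "(\<lambda>z. q z i j) \<in> borel_measurable borel"
    unfolding q_def by (rule rho.measurable_measure) auto
  from measurable_compose[OF assms this] show ?thesis .
qed

lemma wt_measurable[measurable (raw)]: "f \<in> borel_measurable M \<Longrightarrow> (\<lambda>x. wt (f x) i j) \<in> borel_measurable M"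
  unfolding wt_def by measurable

lemma q_ge: "(1 - \<delta>) * pmf (p i) j \<le> q z i j"
  using minorization by (simp add: q_def)

lemma q_pos: "j \<in> set_pmf (p i) \<Longrightarrow> 0 < q z i j"
  by (rule order.strict_trans2[OF _ q_ge]) (use delta in \<open>simp add: pmf_positive\<close>)

lemma wt_bounds: "0 \<le> wt z i j" "wt z i j \<le> 1"
  using q_ge[of i j z] delta by (auto simp: wt_def divide_simps q_def pmf_nonneg not_less)

text \<open>Where \<open>q\<close> vanishes, division by zero gives weight 1, but the minorization
  forces both sides to be 0.\<close>

lemma wt_q: "wt z i j * q z i j = q z i j - (1 - \<delta>) * pmf (p i) j"
proof (cases "q z i j = 0")
  case True
  moreover have "0 \<le> (1 - \<delta>) * pmf (p i) j" using delta by simp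
  ultimately show ?thesis using q_ge[of i j z] by simp
qed (simp add: wt_def field_simps)

lemma prob_cand: "prob_space cand"
proof -
  interpret U: prob_space "uniform_measure lborel {0..1::real}" by (rule prob_space_uniform_measure) auto
  interpret pair_prob_space \<rho> "uniform_measure lborel {0..1::real}" ..
  show ?thesis unfolding cand_def by (rule prob_space_axioms)
qed

sublocale cand: prob_space cand by (rule prob_cand)

sublocale xi: prob_space \<xi>
proof -
  interpret S: prob_space "stream_space cand" by (rule cand.prob_space_stream_space)
  interpret pair_prob_space "measure_pmf choice" "stream_space cand" ..
  show "prob_space \<xi>" unfolding \<xi>_def by (rule prob_space_axioms)
qed

lemma sets_cand[measurable_cong]: "sets cand = sets (\<rho> \<Otimes>\<^sub>M borel)"
  unfolding cand_def by (intro sets_pair_measure_cong) auto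

lemma space_cand: "space cand = space \<rho> \<times> UNIV"
  by (simp add: cand_def space_pair_measure)

lemma sets_xi[measurable_cong]: "sets \<xi> = sets (count_space UNIV \<Otimes>\<^sub>M stream_space cand)"
  unfolding \<xi>_def by (intro sets_pair_measure_cong) auto

lemma fst_xi[measurable]: "fst \<in> \<xi> \<rightarrow>\<^sub>M count_space UNIV"
  unfolding measurable_cong_sets[OF sets_xi refl] by measurable

lemma snd_xi[measurable]: "snd \<in> \<xi> \<rightarrow>\<^sub>M stream_space cand"
  unfolding measurable_cong_sets[OF sets_xi refl] by measurable

lemma acc_measurable[measurable]:
  "Measurable.pred (borel \<Otimes>\<^sub>M cand) (\<lambda>(z, x). acc z i c x)"
proof (cases "snd c")
  case True
  have "(\<lambda>y. snd (snd y) < wt (fst y) i (gm (fst y) (fst (snd y)) i)) \<in> borel \<Otimes>\<^sub>M cand \<rightarrow>\<^sub>M count_space UNIV"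
    by (rule measurable_compose_countable[where f = "\<lambda>j y. snd (snd y) < wt (fst y) i j"]) measurable
  then show ?thesis using True by (simp add: acc_def split_beta')
next
  case False
  have "(\<lambda>y. gm (fst y) (fst (snd y)) i = fst c i) \<in> borel \<Otimes>\<^sub>M cand \<rightarrow>\<^sub>M count_space UNIV"
    by measurable
  then show ?thesis using False by (simp add: acc_def split_beta')
qed

lemma nu_measurable[measurable (raw)]:
  assumes [measurable]: "f \<in> M \<rightarrow>\<^sub>M borel" "g \<in> M \<rightarrow>\<^sub>M count_space UNIV" "h \<in> M \<rightarrow>\<^sub>M \<xi>"
  shows "(\<lambda>x. nu (f x) (g x) (h x)) \<in> M \<rightarrow>\<^sub>M \<rho>"
proof -
  have 1: "(\<lambda>x. first (acc (f x) i c) (snd (h x))) \<in> M \<rightarrow>\<^sub>M cand" for i c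
    using measurable_compose[OF measurable_Pair[OF assms(1) measurable_compose[OF assms(3) snd_xi]]
      measurable_first[OF acc_measurable]] by simp
  have c: "(\<lambda>x. fst (h x)) \<in> M \<rightarrow>\<^sub>M count_space UNIV"
    using measurable_compose[OF assms(3) fst_xi] .
  have "(\<lambda>x. first (acc (f x) i (fst (h x))) (snd (h x))) \<in> M \<rightarrow>\<^sub>M cand" for i
    by (rule measurable_compose_countable[OF 1 c])
  then have 2: "(\<lambda>x. first (acc (f x) (g x) (fst (h x))) (snd (h x))) \<in> M \<rightarrow>\<^sub>M cand"
    by (rule measurable_compose_countable) (rule assms)
  have "fst \<in> cand \<rightarrow>\<^sub>M \<rho>" unfolding cand_def by measurable
  from measurable_compose[OF 2 this] show ?thesis unfolding nu_def .
qed

lemma st_measurable[measurable (raw)]: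
  assumes [measurable]: "f \<in> M \<rightarrow>\<^sub>M borel" "g \<in> M \<rightarrow>\<^sub>M count_space UNIV" "h \<in> M \<rightarrow>\<^sub>M \<xi>"
  shows "(\<lambda>x. st (f x) (g x) (h x)) \<in> M \<rightarrow>\<^sub>M count_space UNIV"
proof -
  have "(\<lambda>x. st (f x) i (h x)) \<in> M \<rightarrow>\<^sub>M count_space UNIV" for i
  proof -
    have c: "(\<lambda>x. fst (h x)) \<in> M \<rightarrow>\<^sub>M count_space UNIV"
      using measurable_compose[OF assms(3) fst_xi] .
    show ?thesis unfolding st_def
      by (rule measurable_compose_countable[OF _ c, where f = "\<lambda>c x. if snd c then gm (f x) (nu (f x) i (h x)) i else fst c i"])
        measurable
  qed
  then show ?thesis by (rule measurable_compose_countable) measurable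
qed

section \<open>Acceptance probabilities and the law of the accepted noise\<close>

lemma prob_less: "0 \<le> w \<Longrightarrow> w \<le> 1 \<Longrightarrow> measure (uniform_measure lborel {0..1::real}) {v. v < w} = w"
proof -
  assume w: "0 \<le> w" "w \<le> 1"
  have "{0..1} \<inter> {v. v < w} = {0..<w}" using w by auto
  then show ?thesis using w by (subst measure_uniform_measure) (auto simp: Int_commute)
qed

text \<open>Accepted candidates split according to the state they lead to; on each piece the test on
  the uniform coordinate is independent of the noise.\<close>

lemma prob_acc_residual:
  assumes [measurable]: "B \<in> sets \<rho>"
  shows "measure cand {x\<in>B \<times> UNIV. acc z i (f, True) x} = (\<Sum>j\<in>UNIV. wt z i j * measure \<rho> {n\<in>B. gm z n i = j})"
proof -
  interpret U: prob_space "uniform_measure lborel {0..1::real}" by (rule prob_space_uniform_measure) auto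
  interpret pair_prob_space \<rho> "uniform_measure lborel {0..1::real}" ..
  have [measurable]: "{n\<in>B. gm z n i = j} \<in> sets \<rho>" for j
  proof -
    have "{n\<in>B. gm z n i = j} = {n\<in>space \<rho>. n \<in> B \<and> gm z n i = j}"
      using sets.sets_into_space[OF assms] by auto
    then show ?thesis by simp
  qed
  have "{x\<in>B \<times> UNIV. acc z i (f, True) x} = (\<Union>j\<in>UNIV. {n\<in>B. gm z n i = j} \<times> {v. v < wt z i j})"
    by (auto simp: acc_def)
  then have "measure cand {x\<in>B \<times> UNIV. acc z i (f, True) x}
      = (\<Sum>j\<in>UNIV. measure cand ({n\<in>B. gm z n i = j} \<times> {v. v < wt z i j}))"
    by (simp, subst cand.finite_measure_finite_Union) (auto simp: disjoint_family_on_def sets_cand)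
  also have "\<dots> = (\<Sum>j\<in>UNIV. wt z i j * measure \<rho> {n\<in>B. gm z n i = j})"
    unfolding cand_def
    by (intro sum.cong refl, subst U.measure_pair_Times) (simp_all only: prob_less wt_bounds, simp_all)
  finally show ?thesis .
qed

lemma prob_acc_keep:
  assumes [measurable]: "B \<in> sets \<rho>"
  shows "measure cand {x\<in>B \<times> UNIV. acc z i (f, False) x} = measure \<rho> {n\<in>B. gm z n i = f i}"
proof -
  interpret U: prob_space "uniform_measure lborel {0..1::real}" by (rule prob_space_uniform_measure) auto
  interpret pair_prob_space \<rho> "uniform_measure lborel {0..1::real}" ..
  have [measurable]: "{n\<in>B. gm z n i = j} \<in> sets \<rho>" for j
  proof -
    have "{n\<in>B. gm z n i = j} = {n\<in>space \<rho>. n \<in> B \<and> gm z n i = j}"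
      using sets.sets_into_space[OF assms] by auto
    then show ?thesis by simp
  qed
  have "{x\<in>B \<times> UNIV. acc z i (f, False) x} = {n\<in>B. gm z n i = f i} \<times> UNIV"
    by (auto simp: acc_def)
  then show ?thesis
    unfolding cand_def using U.prob_space by (simp, subst U.measure_pair_Times) auto
qed

lemma sum_pmf: "(\<Sum>j\<in>UNIV. pmf (p i) j) = 1"
  by (rule sum_pmf_eq_1) auto

lemma sum_q: "(\<Sum>j\<in>UNIV. q z i j) = 1"
proof -
  have "(\<Sum>j\<in>UNIV. q z i j) = measure \<rho> (\<Union>j\<in>UNIV. {n\<in>space \<rho>. gm z n i = j})"
    unfolding q_def by (subst rho.finite_measure_finite_Union) (auto simp: disjoint_family_on_def)
  also have "(\<Union>j\<in>UNIV. {n\<in>space \<rho>. gm z n i = j}) = space \<rho>" by auto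
  finally show ?thesis by (simp add: rho.prob_space)
qed

text \<open>By \<open>wt_q\<close> the accepted mass is 1 - (1 - \<delta>), whatever the input and
  the state. In \<open>nu_law\<close> this normalization cancels against the probability of the
  coin.\<close>

lemma acc_prob_residual: "measure cand {x\<in>space cand. acc z i (f, True) x} = \<delta>"
  using prob_acc_residual[of "space \<rho>" z i f] sum_q[of z i] sum_pmf[of i]
  by (simp add: space_cand q_def[symmetric] wt_q sum_subtractf sum_distrib_left[symmetric])

lemma acc_prob_keep: "measure cand {x\<in>space cand. acc z i (f, False) x} = q z i (f i)"
  using prob_acc_keep[of "space \<rho>" z i f] by (simp add: space_cand q_def[symmetric])

text \<open>For a map in the support the minorization makes the prescribed transition possible under
  \<open>q\<close>, because \<delta> < 1.\<close>

lemma acc_prob_pos: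
  assumes "c \<in> set_pmf choice"
  shows "0 < measure cand {x\<in>space cand. acc z i c x}"
proof -
  obtain f b where c: "c = (f, b)" by (cases c)
  have "f i \<in> set_pmf (p i)" using assms by (auto simp: c choice_def set_Pi_pmf PiE_dflt_def)
  then show ?thesis using delta by (cases b) (auto simp: c acc_prob_keep acc_prob_residual q_pos)
qed

lemma acc_measurable_single[measurable]: "Measurable.pred cand (acc z i c)"
  using measurable_compose[OF measurable_Pair1' acc_measurable, of z i c] by simp

lemma prob_nu_conditional:
  assumes [measurable]: "B \<in> sets \<rho>" and c: "c \<in> set_pmf choice"
  shows "measure (stream_space cand) {s\<in>streams (space cand). nu z i (c, s) \<in> B}
      = measure cand {x\<in>B \<times> UNIV. acc z i c x} / measure cand {x\<in>space cand. acc z i c x}"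
proof -
  have "{s\<in>streams (space cand). nu z i (c, s) \<in> B} = {s\<in>streams (space cand). first (acc z i c) s \<in> B \<times> UNIV}"
    by (auto simp: nu_def mem_Times_iff)
  then show ?thesis
    using cand.prob_first_accepted(1)[OF acc_measurable_single, of "B \<times> UNIV" z i c] acc_prob_pos[OF c, of z i]
    by (simp add: sets_cand)
qed

text \<open>Let \<open>r j\<close> be the mass of noises in \<open>B\<close> leading to
  \<open>j\<close>. Perturbed steps contribute \<open>wt z i j * r j\<close>, the others (1 -
  \<delta>) \<open>pmf (p i) j * r j / q z i j\<close>, and the two weights of \<open>r j\<close>
  add up to 1. Since this holds for each fixed \<open>z\<close> and \<open>i\<close>, the noise will
  be independent of everything determined earlier.\<close>

lemma nu_law:
  assumes B[measurable]: "B \<in> sets \<rho>"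
  shows "measure \<xi> {x\<in>space \<xi>. nu z i x \<in> B} = measure \<rho> B"
proof -
  interpret S: prob_space "stream_space cand" by (rule cand.prob_space_stream_space)
  define r where "r j = measure \<rho> {n\<in>B. gm z n i = j}" for j
  have r_q: "0 \<le> r j" "r j \<le> q z i j" for j
  proof -
    show "r j \<le> q z i j" unfolding r_def q_def
      using sets.sets_into_space[OF B] by (intro rho.finite_measure_mono) auto
  qed (simp add: r_def)
  have "emeasure \<xi> {x\<in>space \<xi>. nu z i x \<in> B}
      = (\<integral>\<^sup>+c. emeasure (stream_space cand) {s\<in>streams (space cand). nu z i (c, s) \<in> B} \<partial>measure_pmf choice)"
  proof -
    have "{x\<in>space \<xi>. nu z i x \<in> B} \<in> sets \<xi>" by measurable
    then have "emeasure \<xi> {x\<in>space \<xi>. nu z i x \<in> B}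
       = (\<integral>\<^sup>+c. emeasure (stream_space cand) (Pair c -` {x\<in>space \<xi>. nu z i x \<in> B}) \<partial>measure_pmf choice)"
      unfolding \<xi>_def by (rule S.emeasure_pair_measure_alt)
    moreover have "Pair c -` {x\<in>space \<xi>. nu z i x \<in> B} = {s\<in>streams (space cand). nu z i (c, s) \<in> B}" for c
      by (auto simp: \<xi>_def space_pair_measure space_stream_space)
    ultimately show ?thesis by simp
  qed
  also have "\<dots> = (\<integral>\<^sup>+c. ennreal (if snd c then (\<Sum>j\<in>UNIV. wt z i j * r j) / \<delta> else r (fst c i) / q z i (fst c i)) \<partial>measure_pmf choice)"
  proof (intro nn_integral_cong_AE AE_pmfI)
    fix c assume c: "c \<in> set_pmf choice"
    obtain f b where [simp]: "c = (f, b)" by (cases c)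
    show "emeasure (stream_space cand) {s\<in>streams (space cand). nu z i (c, s) \<in> B}
        = ennreal (if snd c then (\<Sum>j\<in>UNIV. wt z i j * r j) / \<delta> else r (fst c i) / q z i (fst c i))"
      unfolding S.emeasure_eq_measure prob_nu_conditional[OF B c]
      by (cases b) (simp_all add: acc_prob_residual acc_prob_keep prob_acc_residual prob_acc_keep r_def)
  qed
  also have "\<dots> = (\<integral>\<^sup>+f. ennreal \<delta> * ennreal ((\<Sum>j\<in>UNIV. wt z i j * r j) / \<delta>)
       + ennreal (1 - \<delta>) * ennreal (r (f i) / q z i (f i)) \<partial>measure_pmf (Pi_pmf UNIV undefined p))"
    unfolding choice_def using delta by (simp add: nn_integral_pair_pmf' mult.commute)
  \<comment> \<open>Only the value of the random map at \<open>i\<close> enters, and its law is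
    \<open>p i\<close>.\<close>
  also have "\<dots> = (\<integral>\<^sup>+j. ennreal ((\<Sum>j\<in>UNIV. wt z i j * r j) + (1 - \<delta>) * (r j / q z i j)) \<partial>measure_pmf (p i))"
  proof -
    have "p i = map_pmf (\<lambda>f. f i) (Pi_pmf UNIV undefined p)" by (subst Pi_pmf_component) auto
    moreover have "ennreal \<delta> * ennreal ((\<Sum>j\<in>UNIV. wt z i j * r j) / \<delta>) + ennreal (1 - \<delta>) * ennreal (r j / q z i j)
        = ennreal ((\<Sum>j\<in>UNIV. wt z i j * r j) + (1 - \<delta>) * (r j / q z i j))" for j
      using delta r_q wt_bounds
      by (auto simp: ennreal_mult[symmetric] ennreal_plus[symmetric] q_def sum_nonneg simp del: ennreal_plus)
    ultimately show ?thesis by simp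
  qed
  also have "\<dots> = ennreal (\<integral>j. (\<Sum>j\<in>UNIV. wt z i j * r j) + (1 - \<delta>) * (r j / q z i j) \<partial>measure_pmf (p i))"
    using delta r_q wt_bounds
    by (intro nn_integral_eq_integral integrable_measure_pmf_finite AE_I2)
      (auto intro!: add_nonneg_nonneg sum_nonneg mult_nonneg_nonneg divide_nonneg_nonneg simp: q_def)
  also have "(\<integral>j. (\<Sum>j\<in>UNIV. wt z i j * r j) + (1 - \<delta>) * (r j / q z i j) \<partial>measure_pmf (p i))
      = (\<Sum>j\<in>UNIV. wt z i j * r j) + (\<Sum>j\<in>UNIV. (1 - \<delta>) * pmf (p i) j / q z i j * r j)"
    by (subst integral_measure_pmf_real[of UNIV])
      (simp_all add: distrib_left distrib_right sum.distrib sum_distrib_right[symmetric] sum_pmf mult_ac)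
  also have "\<dots> = (\<Sum>j\<in>UNIV. r j)"
    unfolding sum.distrib[symmetric] by (rule sum.cong) (auto simp: wt_def algebra_simps)
  also have "\<dots> = measure \<rho> (\<Union>j\<in>UNIV. {n\<in>B. gm z n i = j})"
  proof -
    have "{n\<in>B. gm z n i = j} = {n\<in>space \<rho>. n \<in> B \<and> gm z n i = j}" for j
      using sets.sets_into_space[OF B] by auto
    then have "{n\<in>B. gm z n i = j} \<in> sets \<rho>" for j by simp
    then show ?thesis
      unfolding r_def by (subst rho.finite_measure_finite_Union) (auto simp: disjoint_family_on_def)
  qed
  also have "(\<Union>j\<in>UNIV. {n\<in>B. gm z n i = j}) = B" by auto
  finally show ?thesis by (simp add: xi.emeasure_eq_measure)
qed

text \<open>Only the case of the coin off has content: an accepted candidate then produces the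
  prescribed transition, and acceptance is almost sure for a choice in the support.\<close>

lemma st_eq_gm: "AE x in \<xi>. st z i x = gm z (nu z i x) i"
proof -
  interpret S: prob_space "stream_space cand" by (rule cand.prob_space_stream_space)
  have *: "AE c in measure_pmf choice. AE s in stream_space cand. st z i (c, s) = gm z (nu z i (c, s)) i"
  proof (rule AE_pmfI)
    fix c assume c: "c \<in> set_pmf choice"
    have "AE s in stream_space cand. acc z i c (first (acc z i c) s)"
      by (rule cand.prob_first_accepted(2)[OF acc_measurable_single sets.top acc_prob_pos[OF c]])
    then show "AE s in stream_space cand. st z i (c, s) = gm z (nu z i (c, s)) i"
      by eventually_elim (auto simp: acc_def st_def nu_def)
  qed
  interpret pair_prob_space "measure_pmf choice" "stream_space cand" ..
  have "Measurable.pred \<xi> (\<lambda>x. \<exists>j. st z i x = j \<and> gm z (nu z i x) i = j)" by measurable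
  then have "{x\<in>space \<xi>. st z i x = gm z (nu z i x) i} \<in> sets \<xi>" by (simp add: eq_commute pred_def)
  then show ?thesis unfolding \<xi>_def using *
    by (intro AE_pair_measure) (simp_all add: \<xi>_def[symmetric])
qed

end

section \<open>The space of inputs and seeds\<close>

lemma measurable_finiteI:
  fixes f :: "'a \<Rightarrow> 's::finite"
  assumes "\<And>j. Measurable.pred M (\<lambda>x. f x = j)"
  shows "f \<in> M \<rightarrow>\<^sub>M count_space UNIV"
proof (subst measurable_count_space_eq2)
  have "f -` {j} \<inter> space M = {x\<in>space M. f x = j}" for j by auto
  then show "f \<in> space M \<rightarrow> UNIV \<and> (\<forall>a\<in>UNIV. f -` {a} \<inter> space M \<in> sets M)"
    using assms by (simp add: pred_def)
qed simp

section \<open>Measurability of coalesced values\<close>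

context
  fixes h :: "'a \<Rightarrow> int \<Rightarrow> 's::finite \<Rightarrow> 's" and M
  assumes h[measurable]: "\<And>s i. (\<lambda>x. h x s i) \<in> M \<rightarrow>\<^sub>M count_space UNIV"
begin

lemma measurable_bcomp[measurable]: "(\<lambda>x. bcomp (h x) t n i) \<in> M \<rightarrow>\<^sub>M count_space UNIV"
proof (induction n arbitrary: i)
  case (Suc n)
  then show ?case by (simp add: measurable_compose_countable[OF Suc h])
qed simp

lemma measurable_coal[measurable]: "Measurable.pred M (\<lambda>x. coal (h x) t)"
  unfolding coal_def by measurable

text \<open>On coalescence the event is a countable union over the lengths of compositions;
  elsewhere the value is one fixed state.\<close>

lemma measurable_cval: "(\<lambda>x. cval (h x) t) \<in> M \<rightarrow>\<^sub>M count_space UNIV"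
proof (rule measurable_finiteI)
  fix j
  have "cval (h x) t = j \<longleftrightarrow> (if coal (h x) t then \<exists>n. \<forall>i. bcomp (h x) t n i = j else undefined = j)" for x
  proof (cases "coal (h x) t")
    case True
    then obtain n where "\<And>i. bcomp (h x) t n i = cval (h x) t" using coal_const by blast
    with True show ?thesis by (auto intro: cval_eqI(2))
  qed (simp add: cval_def)
  then show "Measurable.pred M (\<lambda>x. cval (h x) t = j)" by simp measurable
qed

end

type_synonym ('n, 'd) seed_paths = "(int \<Rightarrow> real) \<times> (int \<Rightarrow> (('d \<Rightarrow> 'd) \<times> bool) \<times> ('n \<times> real) stream)"

context coupling
begin

definition seeds where "seeds = PiM (UNIV :: int set) (\<lambda>_. \<xi>)"
definition \<Omega> where "\<Omega> = Z \<Otimes>\<^sub>M seeds"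

sublocale Z: prob_space Z by (rule prob_Z)
sublocale seeds: prob_space seeds unfolding seeds_def by (intro prob_space_PiM xi.prob_space_axioms)
sublocale Om: pair_prob_space Z seeds ..

lemma prob_Omega: "prob_space \<Omega>"
  unfolding \<Omega>_def by (rule Om.prob_space_axioms)

sublocale Omega: prob_space \<Omega> by (rule prob_Omega)

lemma measurable_Z[measurable_cong]: "sets Z = sets (PiM UNIV (\<lambda>_. borel))"
  by (rule sets_Z)

lemma input_measurable[measurable]: "(\<lambda>\<omega>. fst \<omega> t) \<in> borel_measurable \<Omega>"
  unfolding \<Omega>_def by measurable

lemma seed_measurable[measurable]: "(\<lambda>\<omega>. snd \<omega> t) \<in> \<Omega> \<rightarrow>\<^sub>M \<xi>"
  unfolding \<Omega>_def seeds_def by measurable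

lemma upd_measurable[measurable]:
  "(\<lambda>(\<omega>, x). (fst \<omega>, (snd \<omega>)(t := x))) \<in> \<Omega> \<Otimes>\<^sub>M \<xi> \<rightarrow>\<^sub>M \<Omega>"
proof -
  have m1: "(\<lambda>y. fst (fst y)) \<in> \<Omega> \<Otimes>\<^sub>M \<xi> \<rightarrow>\<^sub>M Z" and m2: "(\<lambda>y. snd (fst y)) \<in> \<Omega> \<Otimes>\<^sub>M \<xi> \<rightarrow>\<^sub>M seeds"
    unfolding \<Omega>_def by simp_all
  have m3: "(\<lambda>y. (snd (fst y))(t := snd y)) \<in> \<Omega> \<Otimes>\<^sub>M \<xi> \<rightarrow>\<^sub>M seeds"
    using m2 unfolding seeds_def by (rule measurable_fun_upd[where J = UNIV, rotated]) auto
  have "(\<lambda>y. (fst (fst y), (snd (fst y))(t := snd y))) \<in> \<Omega> \<Otimes>\<^sub>M \<xi> \<rightarrow>\<^sub>M Z \<Otimes>\<^sub>M seeds"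
    by (rule measurable_Pair[OF m1 m3])
  then show ?thesis by (simp add: split_beta' \<Omega>_def)
qed

text \<open>The seeds form a product measure, so replacing one of them by a fresh copy preserves the
  law. Independence of a seed from the input and from earlier seeds is always drawn from this
  identity and Fubini.\<close>

lemma resample:
  assumes f[measurable]: "f \<in> borel_measurable \<Omega>"
  shows "(\<integral>\<^sup>+\<omega>. f \<omega> \<partial>\<Omega>) = (\<integral>\<^sup>+\<omega>. \<integral>\<^sup>+x. f (fst \<omega>, (snd \<omega>)(t := x)) \<partial>\<xi> \<partial>\<Omega>)"
proof -
  interpret X: pair_prob_space \<xi> seeds ..
  have Pi_eq: "distr (\<xi> \<Otimes>\<^sub>M seeds) seeds (\<lambda>(x, X). X(t := x)) = seeds"
    using distr_pair_PiM_eq_PiM[of UNIV "\<lambda>_. \<xi>" t] xi.prob_space_axioms by (simp add: seeds_def)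
  have upd: "(\<lambda>y. (snd y)(t := fst y)) \<in> \<xi> \<Otimes>\<^sub>M seeds \<rightarrow>\<^sub>M seeds"
    unfolding seeds_def by (rule measurable_fun_upd[where J = UNIV]) auto
  then have [measurable]: "(\<lambda>(x, X). X(t := x)) \<in> \<xi> \<Otimes>\<^sub>M seeds \<rightarrow>\<^sub>M seeds" by (simp add: split_beta')
  have f'[measurable]: "f \<in> borel_measurable (Z \<Otimes>\<^sub>M seeds)" using f by (simp add: \<Omega>_def)
  have "(\<integral>\<^sup>+\<omega>. f \<omega> \<partial>\<Omega>) = (\<integral>\<^sup>+w. \<integral>\<^sup>+X. f (w, X) \<partial>seeds \<partial>Z)"
    unfolding \<Omega>_def by (rule seeds.nn_integral_fst[symmetric]) measurable
  also have "\<dots> = (\<integral>\<^sup>+w. \<integral>\<^sup>+X. f (w, X) \<partial>distr (\<xi> \<Otimes>\<^sub>M seeds) seeds (\<lambda>(x, X). X(t := x)) \<partial>Z)"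
    unfolding Pi_eq ..
  also have "\<dots> = (\<integral>\<^sup>+w. \<integral>\<^sup>+y. f (w, (snd y)(t := fst y)) \<partial>(\<xi> \<Otimes>\<^sub>M seeds) \<partial>Z)"
    by (intro nn_integral_cong, subst nn_integral_distr) (auto simp: split_beta')
  also have "\<dots> = (\<integral>\<^sup>+w. \<integral>\<^sup>+X. \<integral>\<^sup>+x. f (w, X(t := x)) \<partial>\<xi> \<partial>seeds \<partial>Z)"
  proof (rule nn_integral_cong)
    fix w assume w: "w \<in> space Z"
    have "(\<lambda>y. f (w, (snd y)(t := fst y))) \<in> borel_measurable (\<xi> \<Otimes>\<^sub>M seeds)"
      using measurable_compose[OF measurable_Pair[OF measurable_const[OF w] upd] f'] .
    from X.nn_integral_snd[OF this] show "(\<integral>\<^sup>+y. f (w, (snd y)(t := fst y)) \<partial>(\<xi> \<Otimes>\<^sub>M seeds)) = (\<integral>\<^sup>+X. \<integral>\<^sup>+x. f (w, X(t := x)) \<partial>\<xi> \<partial>seeds)"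
      by simp
  qed
  also have "\<dots> = (\<integral>\<^sup>+\<omega>. \<integral>\<^sup>+x. f (fst \<omega>, (snd \<omega>)(t := x)) \<partial>\<xi> \<partial>\<Omega>)"
  proof -
    have "(\<lambda>\<omega>. \<integral>\<^sup>+x. f (fst \<omega>, (snd \<omega>)(t := x)) \<partial>\<xi>) \<in> borel_measurable \<Omega>"
      by (rule xi.borel_measurable_nn_integral) measurable
    then have "(\<lambda>\<omega>. \<integral>\<^sup>+x. f (fst \<omega>, (snd \<omega>)(t := x)) \<partial>\<xi>) \<in> borel_measurable (Z \<Otimes>\<^sub>M seeds)" by (simp add: \<Omega>_def)
    from seeds.nn_integral_fst[OF this] show ?thesis by (simp add: \<Omega>_def)
  qed
  finally show ?thesis .
qed

section \<open>Quantities determined by the input and earlier seeds\<close>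

text \<open>The input is unrestricted, its future included: being independent of the seeds, it may
  be held fixed. The inequality is strict because the seed at \<open>s\<close> acts in the step from
  \<open>s\<close> to \<open>s + 1\<close>.\<close>

definition past :: "int \<Rightarrow> (('n, 'd) seed_paths \<Rightarrow> 'b) \<Rightarrow> bool" where
  "past t Y \<longleftrightarrow> (\<forall>w X X'. (\<forall>s<t. X s = X' s) \<longrightarrow> Y (w, X) = Y (w, X'))"

lemma pastD: "past t Y \<Longrightarrow> (\<And>s. s < t \<Longrightarrow> X s = X' s) \<Longrightarrow> Y (w, X) = Y (w, X')"
  by (simp add: past_def)

lemma past_upd:
  assumes "past t Y"
  shows "Y (fst \<omega>, (snd \<omega>)(t := x)) = Y \<omega>"
proof -
  have "Y (fst \<omega>, (snd \<omega>)(t := x)) = Y (fst \<omega>, snd \<omega>)"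
    by (rule pastD[OF assms]) auto
  then show ?thesis by simp
qed

lemma upd_in_space: "\<omega> \<in> space \<Omega> \<Longrightarrow> x \<in> space \<xi> \<Longrightarrow> (fst \<omega>, (snd \<omega>)(t := x)) \<in> space \<Omega>"
  using measurable_space[OF upd_measurable, of "(\<omega>, x)"] by (simp add: space_pair_measure)

text \<open>Resampling the seed at \<open>t\<close> changes neither \<open>Q\<close> nor the
  predicate \<open>R \<omega>\<close>, so the inner integral concerns the fresh seed alone.\<close>

lemma emeasure_past:
  assumes Q[measurable]: "Measurable.pred \<Omega> Q" and R[measurable]: "Measurable.pred \<Omega> (\<lambda>\<omega>. R \<omega> (snd \<omega> t))"
    and pQ: "past t Q" and pR: "past t R"
  shows "emeasure \<Omega> {\<omega>\<in>space \<Omega>. Q \<omega> \<and> R \<omega> (snd \<omega> t)}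
      = (\<integral>\<^sup>+\<omega>. indicator {\<omega>. Q \<omega>} \<omega> * emeasure \<xi> {x\<in>space \<xi>. R \<omega> x} \<partial>\<Omega>)"
proof -
  let ?E = "{\<omega>\<in>space \<Omega>. Q \<omega> \<and> R \<omega> (snd \<omega> t)}"
  have "emeasure \<Omega> ?E = (\<integral>\<^sup>+\<omega>. \<integral>\<^sup>+x. indicator ?E (fst \<omega>, (snd \<omega>)(t := x)) \<partial>\<xi> \<partial>\<Omega>)"
    by (subst resample[symmetric]) auto
  also have "\<dots> = (\<integral>\<^sup>+\<omega>. indicator {\<omega>. Q \<omega>} \<omega> * emeasure \<xi> {x\<in>space \<xi>. R \<omega> x} \<partial>\<Omega>)"
  proof (rule nn_integral_cong)
    fix \<omega> assume \<omega>: "\<omega> \<in> space \<Omega>"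
    have "(\<lambda>x. (fst \<omega>, (snd \<omega>)(t := x))) \<in> \<xi> \<rightarrow>\<^sub>M \<Omega>"
      using measurable_compose[OF measurable_Pair1'[OF \<omega>] upd_measurable] by simp
    from measurable_compose[OF this R] have [measurable]: "Measurable.pred \<xi> (\<lambda>x. R \<omega> x)"
      using past_upd[OF pR, of \<omega> ] by simp
    have "(\<integral>\<^sup>+x. indicator ?E (fst \<omega>, (snd \<omega>)(t := x)) \<partial>\<xi>)
       = (\<integral>\<^sup>+x. indicator {\<omega>. Q \<omega>} \<omega> * indicator {x\<in>space \<xi>. R \<omega> x} x \<partial>\<xi>)"
      using upd_in_space[OF \<omega>] past_upd[OF pR, of \<omega>] past_upd[OF pQ, of \<omega>]
      by (intro nn_integral_cong) (auto simp: indicator_def)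
    also have "\<dots> = indicator {\<omega>. Q \<omega>} \<omega> * emeasure \<xi> {x\<in>space \<xi>. R \<omega> x}"
      by (subst nn_integral_cmult) (auto simp: indicator_def)
    finally show "(\<integral>\<^sup>+x. indicator ?E (fst \<omega>, (snd \<omega>)(t := x)) \<partial>\<xi>)
      = indicator {\<omega>. Q \<omega>} \<omega> * emeasure \<xi> {x\<in>space \<xi>. R \<omega> x}" .
  qed
  finally show ?thesis .
qed

text \<open>A conditional probability that is the same for all inputs and pasts factors out.\<close>

lemma prob_past:
  assumes Q[measurable]: "Measurable.pred \<Omega> Q" and R[measurable]: "Measurable.pred \<Omega> (\<lambda>\<omega>. R \<omega> (snd \<omega> t))"
    and "past t Q" "past t R"
    and c: "\<And>\<omega>. \<omega> \<in> space \<Omega> \<Longrightarrow> measure \<xi> {x\<in>space \<xi>. R \<omega> x} = c"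
  shows "measure \<Omega> {\<omega>\<in>space \<Omega>. Q \<omega> \<and> R \<omega> (snd \<omega> t)} = measure \<Omega> {\<omega>\<in>space \<Omega>. Q \<omega>} * c"
proof -
  obtain \<omega> where "\<omega> \<in> space \<Omega>" using Omega.not_empty by auto
  then have c0: "0 \<le> c" using c[of \<omega>] measure_nonneg[of \<xi> "{x\<in>space \<xi>. R \<omega> x}"] by simp
  have "ennreal (measure \<Omega> {\<omega>\<in>space \<Omega>. Q \<omega> \<and> R \<omega> (snd \<omega> t)})
      = (\<integral>\<^sup>+\<omega>. indicator {\<omega>\<in>space \<Omega>. Q \<omega>} \<omega> * ennreal c \<partial>\<Omega>)"
    unfolding Omega.emeasure_eq_measure[symmetric] emeasure_past[OF assms(1-4)]
    using c by (intro nn_integral_cong) (auto simp: xi.emeasure_eq_measure indicator_def)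
  also have "\<dots> = ennreal (measure \<Omega> {\<omega>\<in>space \<Omega>. Q \<omega>} * c)"
    by (subst nn_integral_multc) (auto simp: Omega.emeasure_eq_measure ennreal_mult c0)
  finally show ?thesis using c0 by simp
qed

text \<open>The exceptional set of seeds may vary with the input and the past; it is null in every
  section, so \<open>prob_past\<close> applies with constant 1.\<close>

lemma AE_past:
  assumes R: "Measurable.pred \<Omega> (\<lambda>\<omega>. R \<omega> (snd \<omega> t))" and "past t R"
    and ae: "\<And>\<omega>. \<omega> \<in> space \<Omega> \<Longrightarrow> AE x in \<xi>. R \<omega> x"
  shows "AE \<omega> in \<Omega>. R \<omega> (snd \<omega> t)"
proof -
  have "measure \<xi> {x\<in>space \<xi>. R \<omega> x} = 1" if \<omega>: "\<omega> \<in> space \<Omega>" for \<omega>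
  proof -
    have "(\<lambda>x. (fst \<omega>, (snd \<omega>)(t := x))) \<in> \<xi> \<rightarrow>\<^sub>M \<Omega>"
      using measurable_compose[OF measurable_Pair1'[OF \<omega>] upd_measurable] by simp
    from measurable_compose[OF this R] have [measurable]: "Measurable.pred \<xi> (\<lambda>x. R \<omega> x)"
      using past_upd[OF assms(2), of \<omega> ] by simp
    show ?thesis by (subst xi.prob_Collect_eq_1) (use ae[OF \<omega>] in auto)
  qed
  from prob_past[of "\<lambda>_. True" R t 1, OF _ R _ assms(2) this]
  have "measure \<Omega> {\<omega>\<in>space \<Omega>. R \<omega> (snd \<omega> t)} = 1"
    by (simp add: past_def Omega.prob_space)
  then show ?thesis by (subst (asm) Omega.prob_Collect_eq_1) (use R in auto)
qed

text \<open>The induction appends the latest time, so that all previous conditions belong to its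
  past.\<close>

lemma prob_block:
  assumes Q[measurable]: "Measurable.pred \<Omega> Q" and pQ: "past t Q" and B[measurable]: "\<And>l. B l \<in> sets \<xi>"
  shows "measure \<Omega> {\<omega>\<in>space \<Omega>. Q \<omega> \<and> (\<forall>l<n. snd \<omega> (t + int l) \<in> B l)}
    = measure \<Omega> {\<omega>\<in>space \<Omega>. Q \<omega>} * (\<Prod>l<n. measure \<xi> (B l))"
proof (induction n)
  case (Suc n)
  let ?Q = "\<lambda>\<omega>. Q \<omega> \<and> (\<forall>l<n. snd \<omega> (t + int l) \<in> B l)"
  have past_n: "past (t + int n) ?Q"
    unfolding past_def
  proof (intro allI impI)
    fix w X X' assume eq: "\<forall>s<t + int n. X s = (X' s :: (('d \<Rightarrow> 'd) \<times> bool) \<times> ('n \<times> real) stream)"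
    have "Q (w, X) = Q (w, X')" using pQ eq unfolding past_def by simp
    moreover have "X (t + int l) = X' (t + int l)" if "l < n" for l using eq that by simp
    ultimately show "?Q (w, X) = ?Q (w, X')" by simp
  qed
  have "measure \<Omega> {\<omega>\<in>space \<Omega>. ?Q \<omega> \<and> snd \<omega> (t + int n) \<in> B n} = measure \<Omega> {\<omega>\<in>space \<Omega>. ?Q \<omega>} * measure \<xi> (B n)"
  proof (rule prob_past[OF _ _ past_n])
    have "{x\<in>space \<xi>. x \<in> B n} = B n" using sets.sets_into_space[OF B[of n]] by blast
    then show "measure \<xi> {x\<in>space \<xi>. x \<in> B n} = measure \<xi> (B n)" by simp
    show "past (t + int n) (\<lambda>_ x. x \<in> B n)" by (simp add: past_def)
  qed measurable
  moreover have "measure \<Omega> {\<omega>\<in>space \<Omega>. ?Q \<omega>} = measure \<Omega> {\<omega>\<in>space \<Omega>. Q \<omega>} * (\<Prod>l<n. measure \<xi> (B l))"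
    using Suc by simp
  ultimately show ?case
    by (simp add: All_less_Suc conj_ac mult.assoc)
qed simp

section \<open>Shift invariance of the space of inputs and seeds\<close>

definition shift :: "int \<Rightarrow> ('n, 'd) seed_paths \<Rightarrow> ('n, 'd) seed_paths" where
  "shift k \<omega> = (\<lambda>t. fst \<omega> (t + k), \<lambda>t. snd \<omega> (t + k))"

lemma shift_measurable[measurable]: "shift k \<in> \<Omega> \<rightarrow>\<^sub>M \<Omega>"
proof -
  have "(\<lambda>\<omega> t. fst \<omega> (t + k)) \<in> \<Omega> \<rightarrow>\<^sub>M Z"
    by (subst measurable_cong_sets[OF refl sets_Z], rule measurable_PiM_single') (auto simp: PiE_def)
  moreover have *: "b x \<in> space \<xi>" if "(a, b) \<in> space \<Omega>" for a b x
    using measurable_space[OF seed_measurable that, of x] by simp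
  have "(\<lambda>\<omega> t. snd \<omega> (t + k)) \<in> \<Omega> \<rightarrow>\<^sub>M seeds"
    unfolding seeds_def using * by (intro measurable_PiM_single') (auto simp: PiE_def)
  ultimately show ?thesis unfolding shift_def
    by (subst \<Omega>_def) (rule measurable_Pair)
qed

lemma distr_shift: "distr \<Omega> \<Omega> (shift k) = \<Omega>"
proof -
  have m1: "(\<lambda>w t. w (t + k)) \<in> Z \<rightarrow>\<^sub>M Z"
    by (subst measurable_cong_sets[OF sets_Z sets_Z], rule measurable_PiM_single') (auto simp: PiE_def)
  have m2: "(\<lambda>X t. X (t + k)) \<in> seeds \<rightarrow>\<^sub>M seeds"
    unfolding seeds_def by (rule measurable_PiM_single') (auto simp: PiE_def space_PiM Pi_def)
  have "distr seeds seeds (\<lambda>X t. X (t + k)) = seeds"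
    using distr_PiM_reindex[of UNIV "\<lambda>_. \<xi>" "\<lambda>t. t + k" UNIV] xi.prob_space_axioms
    by (simp add: seeds_def inj_on_def restrict_def)
  then have "\<Omega> = distr Z Z (\<lambda>w t. w (t + k)) \<Otimes>\<^sub>M distr seeds seeds (\<lambda>X t. X (t + k))"
    by (simp add: shift_Z \<Omega>_def)
  also have "\<dots> = distr (Z \<Otimes>\<^sub>M seeds) (Z \<Otimes>\<^sub>M seeds) (\<lambda>(w, X). (\<lambda>t. w (t + k), \<lambda>t. X (t + k)))"
    using m1 m2 by (rule pair_measure_distr) (simp add: \<open>distr seeds seeds (\<lambda>X t. X (t + k)) = seeds\<close> seeds.sigma_finite_measure_axioms)
  finally show ?thesis by (simp add: \<Omega>_def shift_def[abs_def] split_beta')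
qed

lemma prob_shift:
  assumes [measurable]: "Measurable.pred \<Omega> Q"
  shows "measure \<Omega> {\<omega>\<in>space \<Omega>. Q (shift k \<omega>)} = measure \<Omega> {\<omega>\<in>space \<Omega>. Q \<omega>}"
proof -
  have "measure \<Omega> {\<omega>\<in>space \<Omega>. Q \<omega>} = measure (distr \<Omega> \<Omega> (shift k)) {\<omega>\<in>space \<Omega>. Q \<omega>}"
    by (simp add: distr_shift)
  also have "\<dots> = measure \<Omega> (shift k -` {\<omega>\<in>space \<Omega>. Q \<omega>} \<inter> space \<Omega>)"
    by (rule measure_distr) auto
  also have "shift k -` {\<omega>\<in>space \<Omega>. Q \<omega>} \<inter> space \<Omega> = {\<omega>\<in>space \<Omega>. Q (shift k \<omega>)}"
    using measurable_space[OF shift_measurable] by auto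
  finally show ?thesis by simp
qed

end

section \<open>Coalescence\<close>

context coupling
begin

definition phi :: "('n, 'd) seed_paths \<Rightarrow> int \<Rightarrow> 'd \<Rightarrow> 'd" where "phi \<omega> s i = st (fst \<omega> s) i (snd \<omega> s)"
definition psi :: "('n, 'd) seed_paths \<Rightarrow> int \<Rightarrow> 'd \<Rightarrow> 'd" where "psi \<omega> s i = fst (fst (snd \<omega> s)) i"
definition state :: "int \<Rightarrow> ('n, 'd) seed_paths \<Rightarrow> 'd" where "state t \<omega> = cval (phi \<omega>) t"
definition state0 :: "int \<Rightarrow> ('n, 'd) seed_paths \<Rightarrow> 'd" where "state0 t \<omega> = cval (psi \<omega>) t"
text \<open>In \<open>controlled_process\<close> the noise at time \<open>t\<close> drives the step
  from \<open>t - 1\<close> to \<open>t\<close>; it is therefore read from the seed at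
  \<open>t - 1\<close> and belongs to the past of \<open>t\<close>.\<close>

definition noise :: "int \<Rightarrow> ('n, 'd) seed_paths \<Rightarrow> 'n" where "noise t \<omega> = nu (fst \<omega> (t - 1)) (state (t - 1) \<omega>) (snd \<omega> (t - 1))"

lemma phi_measurable[measurable]: "(\<lambda>\<omega>. phi \<omega> s i) \<in> \<Omega> \<rightarrow>\<^sub>M count_space UNIV"
  unfolding phi_def by measurable

lemma psi_measurable[measurable]: "(\<lambda>\<omega>. psi \<omega> s i) \<in> \<Omega> \<rightarrow>\<^sub>M count_space UNIV"
  unfolding psi_def
  by (rule measurable_compose[OF measurable_compose[OF seed_measurable fst_xi]]) simp

lemma state_measurable[measurable]: "state t \<in> \<Omega> \<rightarrow>\<^sub>M count_space UNIV"
  unfolding state_def[abs_def] by (rule measurable_cval) measurable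

lemma state0_measurable[measurable]: "state0 t \<in> \<Omega> \<rightarrow>\<^sub>M count_space UNIV"
  unfolding state0_def[abs_def] by (rule measurable_cval) measurable

lemma noise_measurable[measurable]: "noise t \<in> \<Omega> \<rightarrow>\<^sub>M \<rho>"
  unfolding noise_def[abs_def] by measurable

lemma phi_shift: "phi (shift k \<omega>) = (\<lambda>s. phi \<omega> (s + k))"
  by (simp add: fun_eq_iff phi_def shift_def)

lemma psi_shift: "psi (shift k \<omega>) = (\<lambda>s. psi \<omega> (s + k))"
  by (simp add: fun_eq_iff psi_def shift_def)

lemma state_shift: "state t (shift k \<omega>) = state (t + k) \<omega>"
  by (simp add: state_def phi_shift cval_shift)

lemma state0_shift: "state0 t (shift k \<omega>) = state0 (t + k) \<omega>"
  by (simp add: state0_def psi_shift cval_shift)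

lemma past_phi: "X s = X' s \<Longrightarrow> phi (w, X) s = phi (w, X') s"
  by (simp add: fun_eq_iff phi_def)

lemma past_psi: "X s = X' s \<Longrightarrow> psi (w, X) s = psi (w, X') s"
  by (simp add: fun_eq_iff psi_def)

lemma past_state: "u \<le> t \<Longrightarrow> past t (state u)"
  unfolding past_def state_def by (intro allI impI past_cong(2) past_phi) auto

lemma past_state0: "u \<le> t \<Longrightarrow> past t (state0 u)"
  unfolding past_def state0_def by (intro allI impI past_cong(2) past_psi) auto

lemma past_coal: "past t (\<lambda>\<omega>. coal (phi \<omega>) t)" "past t (\<lambda>\<omega>. coal (psi \<omega>) t)"
  unfolding past_def by (intro allI impI past_cong(1) past_phi past_psi, simp)+

lemma past_comp:
  assumes "past t Y"
  shows "past t (\<lambda>\<omega>. F (fst \<omega>) (Y \<omega>))"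
  unfolding past_def
proof (intro allI impI)
  fix w and X X' :: "int \<Rightarrow> (('d \<Rightarrow> 'd) \<times> bool) \<times> ('n \<times> real) stream"
  assume "\<forall>s<t. X s = X' s"
  then have "Y (w, X) = Y (w, X')" by (intro pastD[OF assms]) simp
  then show "F (fst (w, X)) (Y (w, X)) = F (fst (w, X')) (Y (w, X'))" by simp
qed

lemma past_Pair:
  assumes "past t Y" "past t Y'"
  shows "past t (\<lambda>\<omega>. (Y \<omega>, Y' \<omega>))"
  unfolding past_def
proof (intro allI impI)
  fix w and X X' :: "int \<Rightarrow> (('d \<Rightarrow> 'd) \<times> bool) \<times> ('n \<times> real) stream"
  assume "\<forall>s<t. X s = X' s"
  then have "Y (w, X) = Y (w, X')" "Y' (w, X) = Y' (w, X')"
    by (auto intro: pastD[OF assms(1)] pastD[OF assms(2)])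
  then show "(Y (w, X), Y' (w, X)) = (Y (w, X'), Y' (w, X'))" by simp
qed

lemma past_noise: "u \<le> t \<Longrightarrow> past t (noise u)"
  unfolding past_def noise_def
proof (intro allI impI)
  fix w X X' assume u: "u \<le> t"
    and eq: "\<forall>s<t. X s = (X' s :: (('d \<Rightarrow> 'd) \<times> bool) \<times> ('n \<times> real) stream)"
  have "state (u - 1) (w, X) = state (u - 1) (w, X')"
    by (rule pastD[OF past_state[OF order_refl]]) (use u eq in auto)
  then show "nu (fst (w, X) (u - 1)) (state (u - 1) (w, X)) (snd (w, X) (u - 1))
      = nu (fst (w, X') (u - 1)) (state (u - 1) (w, X')) (snd (w, X') (u - 1))"
    using u eq by simp
qed

lemma prob_perturb: "measure \<Omega> {\<omega>\<in>space \<Omega>. snd (fst (snd \<omega> t))} = \<delta>"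
proof -
  interpret S: prob_space "stream_space cand" by (rule cand.prob_space_stream_space)
  have "{x\<in>space \<xi>. snd (fst x)} = {c. snd c} \<times> space (stream_space cand)"
    by (auto simp: \<xi>_def space_pair_measure)
  then have "measure \<xi> {x\<in>space \<xi>. snd (fst x)} = measure (measure_pmf choice) {c. snd c}"
    by (simp add: \<xi>_def S.measure_pair_Times S.prob_space del: insert_Times_insert)
  also have "\<dots> = measure (measure_pmf (map_pmf snd choice)) {b. b}"
    by (simp add: vimage_def)
  also have "{b. b} = {True}" by auto
  also have "measure (measure_pmf (map_pmf snd choice)) {True} = \<delta>"
    using delta by (simp add: choice_def map_snd_pair_pmf measure_pmf_single)
  finally have c: "measure \<xi> {x\<in>space \<xi>. snd (fst x)} = \<delta>" .
  have [measurable]: "Measurable.pred \<Omega> (\<lambda>\<omega>. snd (fst (snd \<omega> t)))"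
    by (rule measurable_compose[OF measurable_compose[OF seed_measurable fst_xi]]) simp
  show ?thesis
    using prob_past[of "\<lambda>_. True" "\<lambda>_ x. snd (fst x)" t \<delta>] c
    by (simp add: past_def Omega.prob_space)
qed

lemma prob_letter:
  "measure \<xi> {x\<in>space \<xi>. fst x = (v, False)} = (1 - \<delta>) * (\<Prod>i\<in>UNIV. pmf (p i) (v i))"
proof -
  interpret S: prob_space "stream_space cand" by (rule cand.prob_space_stream_space)
  have "{x\<in>space \<xi>. fst x = (v, False)} = {(v, False)} \<times> space (stream_space cand)"
    by (auto simp: \<xi>_def space_pair_measure)
  then have "measure \<xi> {x\<in>space \<xi>. fst x = (v, False)} = measure (measure_pmf choice) {(v, False)}"
    by (simp add: \<xi>_def S.measure_pair_Times S.prob_space del: insert_Times_insert)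
  also have "\<dots> = (1 - \<delta>) * (\<Prod>i\<in>UNIV. pmf (p i) (v i))"
    using delta by (simp add: measure_pmf_single choice_def pmf_pair pmf_Pi)
  finally show ?thesis .
qed

end

section \<open>Synchronizing blocks and almost sure coalescence\<close>

locale sync_coupling = coupling \<rho> gm p \<delta> Z
  for \<rho> :: "'n measure" and gm :: "real \<Rightarrow> 'n \<Rightarrow> 'd::finite \<Rightarrow> 'd" and p \<delta> Z +
  fixes m :: nat and word :: "nat \<Rightarrow> 'd \<Rightarrow> 'd" and target :: 'd
  assumes word_pos: "\<And>l i. l < m \<Longrightarrow> 0 < pmf (p i) (word l i)"
    and word_sync: "\<And>h s i. (\<And>l. l < m \<Longrightarrow> h (s + int l) = word l) \<Longrightarrow> bcomp h (s + int m) m i = target"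
begin

text \<open>With all coins off along the block, \<open>phi\<close> and \<open>psi\<close> both
  follow the word, so one event resets both chains to the same state.\<close>

definition good :: "int \<Rightarrow> ('n, 'd) seed_paths \<Rightarrow> bool" where "good t \<omega> \<longleftrightarrow> (\<forall>l<m. fst (snd \<omega> (t + int l)) = (word l, False))"

definition word_prob :: real where "word_prob = (1 - \<delta>) ^ m * (\<Prod>l<m. \<Prod>i\<in>UNIV. pmf (p i) (word l i))"

lemma word_prob_pos: "0 < word_prob"
  using delta word_pos by (auto simp: word_prob_def intro!: mult_pos_pos prod_pos)

lemma good_const:
  assumes "good t \<omega>"
  shows "bcomp (phi \<omega>) (t + int m) m i = target" "bcomp (psi \<omega>) (t + int m) m i = target"
  using assms
  by (auto intro!: word_sync simp: good_def phi_def[abs_def] psi_def[abs_def] st_def fun_eq_iff)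

lemma good_measurable[measurable]: "Measurable.pred \<Omega> (good t)"
proof -
  have "Measurable.pred \<Omega> (\<lambda>\<omega>. fst (snd \<omega> (t + int l)) = (word l, False))" for l
    by (rule measurable_compose[OF measurable_compose[OF seed_measurable fst_xi]]) simp
  then show ?thesis unfolding good_def[abs_def] by measurable
qed

lemma prob_good:
  assumes Q[measurable]: "Measurable.pred \<Omega> Q" and pQ: "past t Q"
  shows "measure \<Omega> {\<omega>\<in>space \<Omega>. Q \<omega> \<and> good t \<omega>} = measure \<Omega> {\<omega>\<in>space \<Omega>. Q \<omega>} * word_prob"
proof -
  have B: "{x\<in>space \<xi>. fst x = (word l, False)} \<in> sets \<xi>" for l by measurable
  have "{\<omega>\<in>space \<Omega>. Q \<omega> \<and> good t \<omega>}
      = {\<omega>\<in>space \<Omega>. Q \<omega> \<and> (\<forall>l<m. snd \<omega> (t + int l) \<in> {x\<in>space \<xi>. fst x = (word l, False)})}"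
    using measurable_space[OF seed_measurable] by (auto simp: good_def)
  also have "measure \<Omega> \<dots> = measure \<Omega> {\<omega>\<in>space \<Omega>. Q \<omega>} * word_prob"
    by (subst prob_block[OF Q pQ B]) (simp add: prob_letter word_prob_def prod.distrib)
  finally show ?thesis .
qed

lemma prob_not_good:
  assumes Q[measurable]: "Measurable.pred \<Omega> Q" and pQ: "past t Q"
  shows "measure \<Omega> {\<omega>\<in>space \<Omega>. Q \<omega> \<and> \<not> good t \<omega>} = measure \<Omega> {\<omega>\<in>space \<Omega>. Q \<omega>} * (1 - word_prob)"
proof -
  have "{\<omega>\<in>space \<Omega>. Q \<omega> \<and> \<not> good t \<omega>} = {\<omega>\<in>space \<Omega>. Q \<omega>} - {\<omega>\<in>space \<Omega>. Q \<omega> \<and> good t \<omega>}" by auto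
  then show ?thesis
    by (simp, subst Omega.finite_measure_Diff) (auto simp: prob_good[OF assms] algebra_simps)
qed

text \<open>By shift invariance the probability b of failure is the same at all times. Failure at
  \<open>t + m\<close> requires failure at \<open>t\<close> and no word in between, and these are
  independent; thus b \<le> b (1 - \<open>word_prob\<close>) and b = 0.\<close>

lemma AE_coal:
  assumes C[measurable]: "\<And>t. Measurable.pred \<Omega> (\<lambda>\<omega>. C t \<omega>)" and pC: "\<And>t. past t (\<lambda>\<omega>. \<not> C t \<omega>)"
    and sh: "\<And>t k \<omega>. C t (shift k \<omega>) = C (t + k) \<omega>"
    and step: "\<And>t \<omega>. C t \<omega> \<or> good t \<omega> \<Longrightarrow> C (t + int m) \<omega>"
  shows "AE \<omega> in \<Omega>. C t \<omega>"
proof -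
  define b where "b = measure \<Omega> {\<omega>\<in>space \<Omega>. \<not> C t \<omega>}"
  have "b = measure \<Omega> {\<omega>\<in>space \<Omega>. \<not> C (t + int m) \<omega>}"
    using prob_shift[of "\<lambda>\<omega>. \<not> C t \<omega>" "int m"] by (simp add: b_def sh)
  also have "\<dots> \<le> measure \<Omega> {\<omega>\<in>space \<Omega>. \<not> C t \<omega> \<and> \<not> good t \<omega>}"
    using step by (intro Omega.finite_measure_mono) auto
  also have "\<dots> = b * (1 - word_prob)"
    unfolding b_def by (rule prob_not_good) (auto simp: pC)
  finally have "b * word_prob \<le> 0" by (simp add: algebra_simps)
  then have "b = 0" using word_prob_pos by (simp add: mult_le_0_iff b_def measure_le_0_iff)
  then show ?thesis
    unfolding b_def by (subst (asm) Omega.prob_Collect_eq_0) auto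
qed

lemma AE_coal_phi: "AE \<omega> in \<Omega>. coal (phi \<omega>) t"
proof (rule AE_coal)
  show "past t (\<lambda>\<omega>. \<not> coal (phi \<omega>) t)" for t using past_coal(1)[of t] by (simp add: past_def)
  show "coal (phi \<omega>) t \<or> good t \<omega> \<Longrightarrow> coal (phi \<omega>) (t + int m)" for t \<omega>
    using coal_bcomp(1)[of "phi \<omega>" "t + int m" m] by (elim disjE) (simp, rule cval_eqI(1)[OF good_const(1)])
qed (auto simp: phi_shift coal_shift)

lemma AE_coal_psi: "AE \<omega> in \<Omega>. coal (psi \<omega>) t"
proof (rule AE_coal)
  show "past t (\<lambda>\<omega>. \<not> coal (psi \<omega>) t)" for t using past_coal(2)[of t] by (simp add: past_def)
  show "coal (psi \<omega>) t \<or> good t \<omega> \<Longrightarrow> coal (psi \<omega>) (t + int m)" for t \<omega>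
    using coal_bcomp(1)[of "psi \<omega>" "t + int m" m] by (elim disjE) (simp, rule cval_eqI(1)[OF good_const(2)])
qed (auto simp: psi_shift coal_shift)

text \<open>The exceptional set in \<open>st_eq_gm\<close> depends on the input value and the state;
  both are fixed before the seed at \<open>t\<close> is drawn, so \<open>AE_past\<close>
  applies.\<close>

lemma AE_state_step: "AE \<omega> in \<Omega>. state (t + 1) \<omega> = gm (fst \<omega> t) (noise (t + 1) \<omega>) (state t \<omega>)"
proof -
  have "AE \<omega> in \<Omega>. (\<lambda>\<omega> x. st (fst \<omega> t) (state t \<omega>) x = gm (fst \<omega> t) (nu (fst \<omega> t) (state t \<omega>) x) (state t \<omega>)) \<omega> (snd \<omega> t)"
  proof (rule AE_past)
    have "Measurable.pred \<Omega> (\<lambda>\<omega>. \<exists>j i. state t \<omega> = i \<and> st (fst \<omega> t) (state t \<omega>) (snd \<omega> t) = j \<and>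
       gm (fst \<omega> t) (nu (fst \<omega> t) (state t \<omega>) (snd \<omega> t)) i = j)" by measurable
    then show "Measurable.pred \<Omega> (\<lambda>\<omega>. st (fst \<omega> t) (state t \<omega>) (snd \<omega> t)
       = gm (fst \<omega> t) (nu (fst \<omega> t) (state t \<omega>) (snd \<omega> t)) (state t \<omega>))" by (simp add: eq_commute)
    show "past t (\<lambda>\<omega> x. st (fst \<omega> t) (state t \<omega>) x = gm (fst \<omega> t) (nu (fst \<omega> t) (state t \<omega>) x) (state t \<omega>))"
      using past_comp[OF past_state[OF order_refl], of t "\<lambda>w i x. st (w t) i x = gm (w t) (nu (w t) i x) i"] .
    show "\<omega> \<in> space \<Omega> \<Longrightarrow> AE x in \<xi>. st (fst \<omega> t) (state t \<omega>) x = gm (fst \<omega> t) (nu (fst \<omega> t) (state t \<omega>) x) (state t \<omega>)" for \<omega>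
      by (rule st_eq_gm)
  qed
  with AE_coal_phi[of t] show ?thesis
    by eventually_elim (auto simp: state_def noise_def phi_def dest!: cval_step)
qed

lemma AE_state0_step: "AE \<omega> in \<Omega>. state0 (t + 1) \<omega> = fst (fst (snd \<omega> t)) (state0 t \<omega>)"
  using AE_coal_psi[of t] by eventually_elim (auto simp: state0_def psi_def dest!: cval_step)

text \<open>Over one block the two chains can only differ if a perturbed step occurs, or if they differed
  before and the synchronizing word does not occur.\<close>

lemma prob_neq: "measure \<Omega> {\<omega>\<in>space \<Omega>. state t \<omega> \<noteq> state0 t \<omega>} \<le> real m * \<delta> / word_prob"
proof -
  define a where "a = measure \<Omega> {\<omega>\<in>space \<Omega>. state t \<omega> \<noteq> state0 t \<omega>}"
  have neq[measurable]: "Measurable.pred \<Omega> (\<lambda>\<omega>. state t \<omega> \<noteq> state0 t \<omega>)" for t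
  proof -
    have "Measurable.pred \<Omega> (\<lambda>\<omega>. \<not> (\<exists>j. state t \<omega> = j \<and> state0 t \<omega> = j))" by measurable
    then show ?thesis by (simp add: eq_commute)
  qed
  have pert[measurable]: "Measurable.pred \<Omega> (\<lambda>\<omega>. snd (fst (snd \<omega> t)))" for t
    by (rule measurable_compose[OF measurable_compose[OF seed_measurable fst_xi]]) simp
  have "a = measure \<Omega> {\<omega>\<in>space \<Omega>. state (t + int m) \<omega> \<noteq> state0 (t + int m) \<omega>}"
    using prob_shift[OF neq, of t "int m"] by (simp add: a_def state_shift state0_shift)
  also have "\<dots> \<le> measure \<Omega> ((\<Union>l<m. {\<omega>\<in>space \<Omega>. snd (fst (snd \<omega> (t + int l)))})
      \<union> {\<omega>\<in>space \<Omega>. state t \<omega> \<noteq> state0 t \<omega> \<and> \<not> good t \<omega>})"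
  proof (rule Omega.finite_measure_mono_AE)
    show "AE \<omega> in \<Omega>. \<omega> \<in> {\<omega>\<in>space \<Omega>. state (t + int m) \<omega> \<noteq> state0 (t + int m) \<omega>} \<longrightarrow>
      \<omega> \<in> (\<Union>l<m. {\<omega>\<in>space \<Omega>. snd (fst (snd \<omega> (t + int l)))})
        \<union> {\<omega>\<in>space \<Omega>. state t \<omega> \<noteq> state0 t \<omega> \<and> \<not> good t \<omega>}"
      using AE_coal_phi[of t] AE_coal_psi[of t]
    proof eventually_elim
      fix \<omega> assume c: "coal (phi \<omega>) t" "coal (psi \<omega>) t"
      have st: "state (t + int m) \<omega> = bcomp (phi \<omega>) (t + int m) m (state t \<omega>)"
        "state0 (t + int m) \<omega> = bcomp (psi \<omega>) (t + int m) m (state0 t \<omega>)"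
        using coal_bcomp(2)[of _ "t + int m" m] c by (simp_all add: state_def state0_def)
      have "state (t + int m) \<omega> = state0 (t + int m) \<omega>"
        if *: "\<forall>l<m. \<not> snd (fst (snd \<omega> (t + int l)))" "state t \<omega> = state0 t \<omega> \<or> good t \<omega>"
      proof -
        have "phi \<omega> s = psi \<omega> s" if "t \<le> s" "s < t + int m" for s
          using *(1)[rule_format, of "nat (s - t)"] that by (auto simp: fun_eq_iff phi_def psi_def st_def)
        then have "bcomp (phi \<omega>) (t + int m) m = bcomp (psi \<omega>) (t + int m) m"
          by (intro bcomp_cong) auto
        then show ?thesis using *(2) good_const[of t \<omega>] by (auto simp: st)
      qed
      then show "\<omega> \<in> {\<omega>\<in>space \<Omega>. state (t + int m) \<omega> \<noteq> state0 (t + int m) \<omega>} \<longrightarrow>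
        \<omega> \<in> (\<Union>l<m. {\<omega>\<in>space \<Omega>. snd (fst (snd \<omega> (t + int l)))})
          \<union> {\<omega>\<in>space \<Omega>. state t \<omega> \<noteq> state0 t \<omega> \<and> \<not> good t \<omega>}" by auto
    qed
  qed measurable
  also have "\<dots> \<le> measure \<Omega> (\<Union>l<m. {\<omega>\<in>space \<Omega>. snd (fst (snd \<omega> (t + int l)))})
      + measure \<Omega> {\<omega>\<in>space \<Omega>. state t \<omega> \<noteq> state0 t \<omega> \<and> \<not> good t \<omega>}"
    by (rule measure_Un_le) measurable
  also have "measure \<Omega> (\<Union>l<m. {\<omega>\<in>space \<Omega>. snd (fst (snd \<omega> (t + int l)))})
      \<le> (\<Sum>l<m. measure \<Omega> {\<omega>\<in>space \<Omega>. snd (fst (snd \<omega> (t + int l)))})"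
    by (rule Omega.finite_measure_subadditive_finite) auto
  also have "\<dots> = real m * \<delta>" by (simp add: prob_perturb)
  also have "measure \<Omega> {\<omega>\<in>space \<Omega>. state t \<omega> \<noteq> state0 t \<omega> \<and> \<not> good t \<omega>} = a * (1 - word_prob)"
    unfolding a_def
    by (rule prob_not_good[OF neq]) (use past_comp[OF past_Pair[OF past_state past_state0], of t t t "\<lambda>_ y. fst y \<noteq> snd y"] in simp)
  finally have "a * word_prob \<le> real m * \<delta>" by (simp add: algebra_simps)
  then show ?thesis using word_prob_pos by (simp add: a_def field_simps)
qed

end

section \<open>The joint law of input, noise and states\<close>

text \<open>For fixed \<open>A\<close>, the law of \<open>Y\<close> on the event that
  \<open>X\<close> lies in \<open>A\<close> agrees with a multiple of the product measure on
  cylinders, hence everywhere.\<close>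

lemma distr_eq_pair_PiM:
  fixes Y :: "'i \<Rightarrow> 'a \<Rightarrow> 'b"
  assumes "prob_space M" "prob_space \<rho>"
    and X[measurable]: "X \<in> M \<rightarrow>\<^sub>M N" and Y[measurable]: "\<And>t. Y t \<in> M \<rightarrow>\<^sub>M \<rho>"
    and eq: "\<And>A J B. A \<in> sets N \<Longrightarrow> finite J \<Longrightarrow> (\<And>s. B s \<in> sets \<rho>) \<Longrightarrow>
      measure M {\<omega>\<in>space M. X \<omega> \<in> A \<and> (\<forall>s\<in>J. Y s \<omega> \<in> B s)}
        = measure M {\<omega>\<in>space M. X \<omega> \<in> A} * (\<Prod>s\<in>J. measure \<rho> (B s))"
  shows "distr M (N \<Otimes>\<^sub>M PiM UNIV (\<lambda>_. \<rho>)) (\<lambda>\<omega>. (X \<omega>, \<lambda>t. Y t \<omega>)) = distr M N X \<Otimes>\<^sub>M PiM UNIV (\<lambda>_. \<rho>)"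
proof -
  interpret M: prob_space M by fact
  interpret \<rho>: prob_space \<rho> by fact
  interpret D: prob_space "distr M N X" by (rule M.prob_space_distr) measurable
  interpret P: prob_space "PiM (UNIV :: 'i set) (\<lambda>_. \<rho>)" by (intro prob_space_PiM \<rho>.prob_space_axioms)
  have Y'[measurable]: "(\<lambda>\<omega> t. Y t \<omega>) \<in> M \<rightarrow>\<^sub>M PiM UNIV (\<lambda>_. \<rho>)"
    by (rule measurable_PiM_single') (auto simp: PiE_def Pi_def measurable_space[OF Y])
  have "distr M N X \<Otimes>\<^sub>M PiM UNIV (\<lambda>_. \<rho>) = distr M (N \<Otimes>\<^sub>M PiM UNIV (\<lambda>_. \<rho>)) (\<lambda>\<omega>. (X \<omega>, \<lambda>t. Y t \<omega>))"
  proof (rule pair_measure_eqI)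
    show "sigma_finite_measure (distr M N X)" ..
    show "sigma_finite_measure (PiM (UNIV :: 'i set) (\<lambda>_. \<rho>))" ..
    show "sets (distr M N X \<Otimes>\<^sub>M PiM UNIV (\<lambda>_. \<rho>)) = sets (distr M (N \<Otimes>\<^sub>M PiM UNIV (\<lambda>_. \<rho>)) (\<lambda>\<omega>. (X \<omega>, \<lambda>t. Y t \<omega>)))"
      by (simp cong: sets_pair_measure_cong)
    fix A B assume "A \<in> sets (distr M N X)" and B[measurable]: "B \<in> sets (PiM (UNIV :: 'i set) (\<lambda>_. \<rho>))"
    then have A[measurable]: "A \<in> sets N" by simp
    \<comment> \<open>Restricting without normalizing avoids division by the probability of the
      event, which may be 0.\<close>
    let ?D = "distr (density M (indicator (X -` A \<inter> space M))) (PiM UNIV (\<lambda>_. \<rho>)) (\<lambda>\<omega> t. Y t \<omega>)"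
    have D: "emeasure ?D C = emeasure M {\<omega>\<in>space M. X \<omega> \<in> A \<and> (\<lambda>t. Y t \<omega>) \<in> C}"
      if [measurable]: "C \<in> sets (PiM (UNIV :: 'i set) (\<lambda>_. \<rho>))" for C
    proof -
      have "emeasure ?D C = (\<integral>\<^sup>+\<omega>. indicator (X -` A \<inter> space M) \<omega> * indicator ((\<lambda>\<omega> t. Y t \<omega>) -` C \<inter> space M) \<omega> \<partial>M)"
        by (subst emeasure_distr) (auto simp: emeasure_density)
      also have "\<dots> = (\<integral>\<^sup>+\<omega>. indicator {\<omega>\<in>space M. X \<omega> \<in> A \<and> (\<lambda>t. Y t \<omega>) \<in> C} \<omega> \<partial>M)"
        by (intro nn_integral_cong) (auto simp: indicator_def)
      finally show ?thesis by simp
    qed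
    have "?D = scale_measure (emeasure (distr M N X) A) (PiM UNIV (\<lambda>_. \<rho>))"
    proof (rule measure_eqI_PiM_infinite)
      fix B' :: "'i \<Rightarrow> 'b set" and J :: "'i set" assume J: "finite J" and B': "\<And>i. i \<in> J \<Longrightarrow> B' i \<in> sets \<rho>"
      \<comment> \<open>Padding with the full space yields a family measurable at every index, as
        \<open>eq\<close> requires.\<close>
      define C where "C i = (if i \<in> J then B' i else space \<rho>)" for i
      have C: "C i \<in> sets \<rho>" for i using B' by (simp add: C_def)
      have emb: "prod_emb UNIV (\<lambda>_. \<rho>) J (Pi\<^sub>E J B') \<in> sets (PiM UNIV (\<lambda>_. \<rho>))"
        using J B' by (intro sets_PiM_I) auto
      have "{\<omega>\<in>space M. X \<omega> \<in> A \<and> (\<lambda>t. Y t \<omega>) \<in> prod_emb UNIV (\<lambda>_. \<rho>) J (Pi\<^sub>E J B')}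
          = {\<omega>\<in>space M. X \<omega> \<in> A \<and> (\<forall>s\<in>J. Y s \<omega> \<in> C s)}"
        using measurable_space[OF Y] by (auto simp: prod_emb_def C_def PiE_iff)
      then have "emeasure ?D (prod_emb UNIV (\<lambda>_. \<rho>) J (Pi\<^sub>E J B'))
          = ennreal (measure M {\<omega>\<in>space M. X \<omega> \<in> A} * (\<Prod>s\<in>J. measure \<rho> (C s)))"
        unfolding D[OF emb] using eq[OF A J C] by (simp add: M.emeasure_eq_measure)
      also have "\<dots> = emeasure (distr M N X) A * (\<Prod>s\<in>J. emeasure \<rho> (B' s))"
        by (subst emeasure_distr) (auto simp: M.emeasure_eq_measure \<rho>.emeasure_eq_measure ennreal_mult
          prod_nonneg prod_ennreal C_def vimage_def Int_def conj_commute intro!: arg_cong2[where f = "(*)"])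
      also have "(\<Prod>s\<in>J. emeasure \<rho> (B' s)) = emeasure (PiM UNIV (\<lambda>_. \<rho>)) (prod_emb UNIV (\<lambda>_. \<rho>) J (Pi\<^sub>E J B'))"
        using J B' \<rho>.prob_space_axioms by (subst emeasure_PiM_emb) auto
      finally show "emeasure ?D (prod_emb UNIV (\<lambda>_. \<rho>) J (Pi\<^sub>E J B'))
        = emeasure (scale_measure (emeasure (distr M N X) A) (PiM UNIV (\<lambda>_. \<rho>))) (prod_emb UNIV (\<lambda>_. \<rho>) J (Pi\<^sub>E J B'))"
        by simp
    next
      show "finite_measure ?D"
        using D[OF sets.top] by (intro finite_measureI) (simp add: M.emeasure_eq_measure)
    qed simp_all
    then have "emeasure (distr M N X) A * emeasure (PiM UNIV (\<lambda>_. \<rho>)) B = emeasure ?D B" by simp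
    also have "\<dots> = emeasure (distr M (N \<Otimes>\<^sub>M PiM UNIV (\<lambda>_. \<rho>)) (\<lambda>\<omega>. (X \<omega>, \<lambda>t. Y t \<omega>))) (A \<times> B)"
      unfolding D[OF B] by (subst emeasure_distr) (auto intro!: arg_cong[where f = "emeasure M"])
    finally show "emeasure (distr M N X) A * emeasure (PiM UNIV (\<lambda>_. \<rho>)) B
      = emeasure (distr M (N \<Otimes>\<^sub>M PiM UNIV (\<lambda>_. \<rho>)) (\<lambda>\<omega>. (X \<omega>, \<lambda>t. Y t \<omega>))) (A \<times> B)" .
  qed
  then show ?thesis ..
qed

context coupling
begin

text \<open>The law in \<open>nu_law\<close> does not depend on the input value or the state, which
  is what \<open>prob_past\<close> asks for.\<close>

lemma prob_noise:
  assumes Q[measurable]: "Measurable.pred \<Omega> Q" and "past t Q" and B[measurable]: "B \<in> sets \<rho>"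
  shows "measure \<Omega> {\<omega>\<in>space \<Omega>. Q \<omega> \<and> noise (t + 1) \<omega> \<in> B} = measure \<Omega> {\<omega>\<in>space \<Omega>. Q \<omega>} * measure \<rho> B"
  using prob_past[of Q "\<lambda>\<omega> x. nu (fst \<omega> t) (state t \<omega>) x \<in> B" t "measure \<rho> B"]
    past_comp[OF past_state[OF order_refl], of t "\<lambda>w i x. nu (w t) i x \<in> B"] assms nu_law[OF B]
  by (simp add: noise_def)

text \<open>The induction peels off the latest time \<open>t\<close>: the earlier noises are
  functions of the input and of the seeds before \<open>t - 1\<close>.\<close>

lemma prob_input_noise:
  assumes A[measurable]: "A \<in> sets Z" and "finite J" and B[measurable]: "\<And>s. B s \<in> sets \<rho>"
  shows "measure \<Omega> {\<omega>\<in>space \<Omega>. fst \<omega> \<in> A \<and> (\<forall>s\<in>J. noise s \<omega> \<in> B s)}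
      = measure \<Omega> {\<omega>\<in>space \<Omega>. fst \<omega> \<in> A} * (\<Prod>s\<in>J. measure \<rho> (B s))"
  using \<open>finite J\<close>
proof (induction J rule: finite_linorder_max_induct)
  case (insert t J)
  let ?Q = "\<lambda>\<omega>. fst \<omega> \<in> A \<and> (\<forall>s\<in>J. noise s \<omega> \<in> B s)"
  have [measurable]: "(\<lambda>\<omega>. fst \<omega>) \<in> \<Omega> \<rightarrow>\<^sub>M Z" unfolding \<Omega>_def by measurable
  have [simp]: "finite J" by fact
  have Q: "Measurable.pred \<Omega> ?Q" by measurable
  have pQ: "past (t - 1) ?Q"
    unfolding past_def
  proof (intro allI impI)
    fix w and X X' :: "int \<Rightarrow> (('d \<Rightarrow> 'd) \<times> bool) \<times> ('n \<times> real) stream"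
    assume "\<forall>s<t - 1. X s = X' s"
    then have "noise s (w, X) = noise s (w, X')" if "s \<in> J" for s
      using insert(2) that by (intro pastD[OF past_noise[of s "t - 1"]]) auto
    then show "?Q (w, X) = ?Q (w, X')" by simp
  qed
  have "{\<omega>\<in>space \<Omega>. fst \<omega> \<in> A \<and> (\<forall>s\<in>insert t J. noise s \<omega> \<in> B s)}
      = {\<omega>\<in>space \<Omega>. ?Q \<omega> \<and> noise (t - 1 + 1) \<omega> \<in> B t}" by auto
  also have "measure \<Omega> \<dots> = measure \<Omega> {\<omega>\<in>space \<Omega>. ?Q \<omega>} * measure \<rho> (B t)"
    by (rule prob_noise[OF Q pQ B])
  finally show ?case using insert by (auto simp: insert.IH)
qed simp

lemma distr_input: "distr \<Omega> Z fst = Z"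
  unfolding \<Omega>_def by (rule seeds.distr_pair_fst)

text \<open>Contains at once that the noise is i.i.d. with law \<rho> and that it is independent of
  the input.\<close>

lemma distr_input_noise:
  "distr \<Omega> (Z \<Otimes>\<^sub>M PiM UNIV (\<lambda>_. \<rho>)) (\<lambda>\<omega>. (fst \<omega>, \<lambda>t. noise t \<omega>)) = Z \<Otimes>\<^sub>M PiM UNIV (\<lambda>_. \<rho>)"
proof -
  have f: "fst \<in> \<Omega> \<rightarrow>\<^sub>M Z" unfolding \<Omega>_def by measurable
  have "distr \<Omega> (Z \<Otimes>\<^sub>M PiM UNIV (\<lambda>_. \<rho>)) (\<lambda>\<omega>. (fst \<omega>, \<lambda>t. noise t \<omega>))
      = distr \<Omega> Z fst \<Otimes>\<^sub>M PiM UNIV (\<lambda>_. \<rho>)"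
  proof (rule distr_eq_pair_PiM[OF prob_Omega prob_rho f noise_measurable])
    fix A and J :: "int set" and B :: "int \<Rightarrow> 'n set"
    assume "A \<in> sets Z" "finite J" "\<And>s. B s \<in> sets \<rho>"
    then show "measure \<Omega> {\<omega>\<in>space \<Omega>. fst \<omega> \<in> A \<and> (\<forall>s\<in>J. noise s \<omega> \<in> B s)}
        = measure \<Omega> {\<omega>\<in>space \<Omega>. fst \<omega> \<in> A} * (\<Prod>s\<in>J. measure \<rho> (B s))"
      by (rule prob_input_noise)
  qed
  then show ?thesis unfolding distr_input .
qed

lemma prob_seed_map: "measure \<xi> {x\<in>space \<xi>. fst (fst x) i = k} = pmf (p i) k"
proof -
  interpret S: prob_space "stream_space cand" by (rule cand.prob_space_stream_space)
  have "{x\<in>space \<xi>. fst (fst x) i = k} = {c. fst c i = k} \<times> space (stream_space cand)"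
    by (auto simp: \<xi>_def space_pair_measure)
  then have "measure \<xi> {x\<in>space \<xi>. fst (fst x) i = k} = measure (measure_pmf choice) {c. fst c i = k}"
    by (simp add: \<xi>_def S.measure_pair_Times S.prob_space)
  also have "\<dots> = measure (measure_pmf (map_pmf (\<lambda>f. f i) (map_pmf fst choice))) {k}"
    by (simp add: vimage_def)
  also have "map_pmf (\<lambda>f. f i) (map_pmf fst choice) = p i"
    unfolding choice_def map_fst_pair_pmf by (subst Pi_pmf_component) auto
  finally show ?thesis by (simp add: measure_pmf_single)
qed

end

context sync_coupling
begin

text \<open>The Markov property tested against an event of the past: the map at \<open>t\<close> is
  fresh, and its value at the current state has law \<open>p\<close>.\<close>

lemma prob_state0_step:
  assumes Q[measurable]: "Measurable.pred \<Omega> Q" and pQ: "past t Q"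
  shows "measure \<Omega> {\<omega>\<in>space \<Omega>. Q \<omega> \<and> state0 (t + 1) \<omega> = k}
    = (\<integral>\<omega>. indicator {\<omega>. Q \<omega>} \<omega> * pmf (p (state0 t \<omega>)) k \<partial>\<Omega>)"
proof -
  have R: "Measurable.pred \<Omega> (\<lambda>\<omega>. fst (fst (snd \<omega> t)) (state0 t \<omega>) = k)"
  proof (rule measurable_compose_countable[OF _ state0_measurable])
    show "Measurable.pred \<Omega> (\<lambda>\<omega>. fst (fst (snd \<omega> t)) i = k)" for i
      by (rule measurable_compose[OF measurable_compose[OF seed_measurable fst_xi]]) simp
  qed
  have "emeasure \<Omega> {\<omega>\<in>space \<Omega>. Q \<omega> \<and> state0 (t + 1) \<omega> = k}
      = emeasure \<Omega> {\<omega>\<in>space \<Omega>. Q \<omega> \<and> fst (fst (snd \<omega> t)) (state0 t \<omega>) = k}"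
  proof (rule emeasure_eq_AE)
    show "AE \<omega> in \<Omega>. (\<omega> \<in> {\<omega>\<in>space \<Omega>. Q \<omega> \<and> state0 (t + 1) \<omega> = k})
        = (\<omega> \<in> {\<omega>\<in>space \<Omega>. Q \<omega> \<and> fst (fst (snd \<omega> t)) (state0 t \<omega>) = k})"
      using AE_state0_step[of t] by eventually_elim auto
  qed (use R in measurable)
  also have "\<dots> = (\<integral>\<^sup>+\<omega>. indicator {\<omega>. Q \<omega>} \<omega> * emeasure \<xi> {x\<in>space \<xi>. fst (fst x) (state0 t \<omega>) = k} \<partial>\<Omega>)"
    by (rule emeasure_past[OF Q R pQ past_comp[OF past_state0[OF order_refl]]])
  also have "\<dots> = (\<integral>\<^sup>+\<omega>. ennreal (indicator {\<omega>. Q \<omega>} \<omega> * pmf (p (state0 t \<omega>)) k) \<partial>\<Omega>)"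
    by (intro nn_integral_cong) (auto simp: xi.emeasure_eq_measure prob_seed_map indicator_def)
  also have "\<dots> = ennreal (\<integral>\<omega>. indicator {\<omega>. Q \<omega>} \<omega> * pmf (p (state0 t \<omega>)) k \<partial>\<Omega>)"
  proof (rule nn_integral_eq_integral)
    have m: "(\<lambda>\<omega>. indicator {\<omega>. Q \<omega>} \<omega> * pmf (p (state0 t \<omega>)) k) \<in> borel_measurable \<Omega>"
    proof (intro borel_measurable_times)
      show "(\<lambda>\<omega>. pmf (p (state0 t \<omega>)) k) \<in> borel_measurable \<Omega>"
        by (rule measurable_compose[OF state0_measurable]) simp
      have "(\<lambda>\<omega>. if Q \<omega> then 1 else 0 :: real) \<in> borel_measurable \<Omega>" by measurable
      then show "(\<lambda>\<omega>. indicator {\<omega>. Q \<omega>} \<omega> :: real) \<in> borel_measurable \<Omega>" by (simp add: indicator_def of_bool_def)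
    qed
    show "integrable \<Omega> (\<lambda>\<omega>. indicator {\<omega>. Q \<omega>} \<omega> * pmf (p (state0 t \<omega>)) k)"
      by (rule Omega.integrable_const_bound[of _ 1, OF _ m]) (auto simp: indicator_def pmf_le_1)
  qed simp
  finally show ?thesis
    by (simp add: Omega.emeasure_eq_measure integral_nonneg_AE)
qed

end

section \<open>Independence of the second chain and the input\<close>

context coupling
begin

lemma state0_input_irrelevant: "state0 t (w, X) = state0 t (w', X)"
  by (simp add: state0_def psi_def[abs_def])

lemma state0_measurable_seeds[measurable]: "(\<lambda>X. state0 t (w, X)) \<in> seeds \<rightarrow>\<^sub>M count_space UNIV"
  unfolding state0_def
proof (rule measurable_cval)
  have "(\<lambda>X. X s) \<in> seeds \<rightarrow>\<^sub>M \<xi>" for s unfolding seeds_def by measurable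
  from measurable_compose[OF measurable_compose[OF this fst_xi], of "\<lambda>c. fst c i" "count_space UNIV" for i]
  show "(\<lambda>X. psi (w, X) s i) \<in> seeds \<rightarrow>\<^sub>M count_space UNIV" for s i by (simp add: psi_def)
qed

text \<open>The state is a function of the seeds alone, so Fubini splits off the integral of
  \<open>f\<close>, which vanishes.\<close>

lemma integral_input_state0:
  fixes f :: "(int \<Rightarrow> real) \<Rightarrow> real" and h :: "'d \<Rightarrow> 'b::{banach, second_countable_topology}"
  assumes [measurable]: "f \<in> borel_measurable Z" and b: "\<And>w. \<bar>f w\<bar> \<le> c" and f0: "(\<integral>w. f w \<partial>Z) = 0"
  shows "(\<integral>\<omega>. f (fst \<omega>) *\<^sub>R h (state0 t \<omega>) \<partial>\<Omega>) = 0"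
proof -
  let ?F = "\<lambda>\<omega>. f (fst \<omega>) *\<^sub>R h (state0 t \<omega>)"
  have fst[measurable]: "fst \<in> \<Omega> \<rightarrow>\<^sub>M Z" unfolding \<Omega>_def by measurable
  have hs[measurable]: "(\<lambda>\<omega>. h (state0 t \<omega>)) \<in> borel_measurable \<Omega>"
    by (rule measurable_compose[OF state0_measurable]) simp
  have m: "?F \<in> borel_measurable \<Omega>" by measurable
  have "integrable \<Omega> ?F"
  proof (rule Omega.integrable_const_bound[OF _ m])
    show "AE \<omega> in \<Omega>. norm (?F \<omega>) \<le> c * (\<Sum>j\<in>UNIV. norm (h j))"
      using b member_le_sum[of _ UNIV "\<lambda>j. norm (h j)"]
      by (intro AE_I2) (auto intro!: mult_mono order_trans[OF abs_ge_zero b])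
  qed
  then have "integrable (Z \<Otimes>\<^sub>M seeds) ?F" by (simp add: \<Omega>_def)
  from Om.integral_fst'[OF this]
  have "(\<integral>\<omega>. ?F \<omega> \<partial>\<Omega>) = (\<integral>w. \<integral>X. f w *\<^sub>R h (state0 t (w, X)) \<partial>seeds \<partial>Z)" by (simp add: \<Omega>_def)
  \<comment> \<open>Any fixed input will do here; \<open>undefined\<close> exhibits the inner
    integral as a constant.\<close>
  also have "\<dots> = (\<integral>w. f w *\<^sub>R (\<integral>X. h (state0 t (undefined, X)) \<partial>seeds) \<partial>Z)"
  proof (rule Bochner_Integration.integral_cong[OF refl])
    fix w
    have "(\<lambda>X. state0 t (w, X)) = (\<lambda>X. state0 t (undefined, X))"
      by (rule ext, rule state0_input_irrelevant)
    from arg_cong[OF this, of "\<lambda>g. \<integral>X. f w *\<^sub>R h (g X) \<partial>seeds"]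
    show "(\<integral>X. f w *\<^sub>R h (state0 t (w, X)) \<partial>seeds) = f w *\<^sub>R (\<integral>X. h (state0 t (undefined, X)) \<partial>seeds)"
      by simp
  qed
  also have "\<dots> = 0"
  proof -
    have "integrable Z f" by (rule Z.integrable_const_bound[of _ c]) (use b in auto)
    then show ?thesis using f0 by simp
  qed
  finally show ?thesis .
qed

text \<open>As the chain ignores the input, the two conditions together describe a rectangle in the
  product space.\<close>

lemma prob_input_state0:
  assumes A: "{w\<in>space Z. A w} \<in> sets Z" and B: "\<And>w. w \<in> space Z \<Longrightarrow> {X\<in>space seeds. B (\<lambda>t. state0 t (w, X))} \<in> sets seeds"
  shows "measure \<Omega> {\<omega>\<in>space \<Omega>. A (fst \<omega>) \<and> B (\<lambda>t. state0 t \<omega>)}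
    = measure \<Omega> {\<omega>\<in>space \<Omega>. A (fst \<omega>)} * measure \<Omega> {\<omega>\<in>space \<Omega>. B (\<lambda>t. state0 t \<omega>)}"
proof -
  obtain w0 where w0: "w0 \<in> space Z" using Z.not_empty by auto
  define A' where "A' = {w\<in>space Z. A w}"
  define B' where "B' = {X\<in>space seeds. B (\<lambda>t. state0 t (w0, X))}"
  have B: "B' \<in> sets seeds" and A: "A' \<in> sets Z" using A B[OF w0] by (auto simp: A'_def B'_def)
  have B_iff: "B (\<lambda>t. state0 t (w, X)) \<longleftrightarrow> X \<in> B'" if "X \<in> space seeds" for w X
  proof -
    have "(\<lambda>t. state0 t (w, X)) = (\<lambda>t. state0 t (w0, X))"
      by (rule ext, rule state0_input_irrelevant)
    from arg_cong[OF this, of B] show ?thesis using that by (simp add: B'_def)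
  qed
  have "{\<omega>\<in>space \<Omega>. A (fst \<omega>) \<and> B (\<lambda>t. state0 t \<omega>)} = A' \<times> B'"
    "{\<omega>\<in>space \<Omega>. A (fst \<omega>)} = A' \<times> space seeds" "{\<omega>\<in>space \<Omega>. B (\<lambda>t. state0 t \<omega>)} = space Z \<times> B'"
    using sets.sets_into_space[OF B] by (auto simp: A'_def B_iff \<Omega>_def space_pair_measure)
  then show ?thesis using A B
    by (simp add: \<Omega>_def seeds.measure_pair_Times seeds.prob_space Z.prob_space)
qed

end

section \<open>Independence and conditional expectations\<close>

lemma indep_rvI:
  assumes "prob_space M" and X[measurable]: "X \<in> M \<rightarrow>\<^sub>M S" and Y[measurable]: "Y \<in> M \<rightarrow>\<^sub>M T"
    and eq: "\<And>A B. A \<in> sets S \<Longrightarrow> B \<in> sets T \<Longrightarrow>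
      measure M {\<omega>\<in>space M. X \<omega> \<in> A \<and> Y \<omega> \<in> B}
        = measure M {\<omega>\<in>space M. X \<omega> \<in> A} * measure M {\<omega>\<in>space M. Y \<omega> \<in> B}"
  shows "indep_rv M S X T Y"
proof -
  interpret prob_space M by fact
  have [simp]: "X \<in> space M \<rightarrow> space S" "Y \<in> space M \<rightarrow> space T"
    using measurable_space[OF X] measurable_space[OF Y] by auto
  have "indep_set (sets (vimage_algebra (space M) X S)) (sets (vimage_algebra (space M) Y T))"
  proof (rule indep_setI)
    fix a b assume "a \<in> sets (vimage_algebra (space M) X S)" "b \<in> sets (vimage_algebra (space M) Y T)"
    then obtain A B where A: "A \<in> sets S" "a = X -` A \<inter> space M" and B: "B \<in> sets T" "b = Y -` B \<inter> space M"
      by (auto simp: sets_vimage_algebra2)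
    have "a \<inter> b = {\<omega>\<in>space M. X \<omega> \<in> A \<and> Y \<omega> \<in> B}" "a = {\<omega>\<in>space M. X \<omega> \<in> A}" "b = {\<omega>\<in>space M. Y \<omega> \<in> B}"
      by (auto simp: A B)
    then show "prob (a \<inter> b) = prob a * prob b" using eq[OF A(1) B(1)] by simp
  qed (auto simp: sets_vimage_algebra2 intro!: measurable_sets[OF X] measurable_sets[OF Y])
  then show ?thesis by (simp add: indep_rv_def)
qed

lemma indep_rvD:
  assumes "prob_space M" "indep_rv M S X T Y" "A \<in> sets S" "B \<in> sets T"
  shows "measure M {\<omega>\<in>space M. X \<omega> \<in> A \<and> Y \<omega> \<in> B}
        = measure M {\<omega>\<in>space M. X \<omega> \<in> A} * measure M {\<omega>\<in>space M. Y \<omega> \<in> B}"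
proof -
  interpret prob_space M by fact
  have XY: "X \<in> M \<rightarrow>\<^sub>M S" "Y \<in> M \<rightarrow>\<^sub>M T"
    and ind: "indep_set (sets (vimage_algebra (space M) X S)) (sets (vimage_algebra (space M) Y T))"
    using assms(2) by (auto simp: indep_rv_def)
  have "prob ((X -` A \<inter> space M) \<inter> (Y -` B \<inter> space M)) = prob (X -` A \<inter> space M) * prob (Y -` B \<inter> space M)"
    using assms by (intro indep_setD[OF ind] in_vimage_algebra)
  moreover have "(X -` A \<inter> space M) \<inter> (Y -` B \<inter> space M) = {\<omega>\<in>space M. X \<omega> \<in> A \<and> Y \<omega> \<in> B}"
    "X -` A \<inter> space M = {\<omega>\<in>space M. X \<omega> \<in> A}" "Y -` B \<inter> space M = {\<omega>\<in>space M. Y \<omega> \<in> B}" by auto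
  ultimately show ?thesis by simp
qed

lemma indep_rv_compose:
  assumes "prob_space M" "indep_rv M S X T Y" and f: "f \<in> S \<rightarrow>\<^sub>M S'" and g: "g \<in> T \<rightarrow>\<^sub>M T'"
  shows "indep_rv M S' (\<lambda>\<omega>. f (X \<omega>)) T' (\<lambda>\<omega>. g (Y \<omega>))"
proof (rule indep_rvI[OF assms(1)])
  have X: "X \<in> M \<rightarrow>\<^sub>M S" and Y: "Y \<in> M \<rightarrow>\<^sub>M T" using assms(2) by (auto simp: indep_rv_def)
  show "(\<lambda>\<omega>. f (X \<omega>)) \<in> M \<rightarrow>\<^sub>M S'" "(\<lambda>\<omega>. g (Y \<omega>)) \<in> M \<rightarrow>\<^sub>M T'"
    by (rule measurable_compose[OF X f] measurable_compose[OF Y g])+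
  fix A B assume "A \<in> sets S'" "B \<in> sets T'"
  then have "f -` A \<inter> space S \<in> sets S" "g -` B \<inter> space T \<in> sets T"
    using f g by (auto intro: measurable_sets)
  from indep_rvD[OF assms(1,2) this] show "measure M {\<omega>\<in>space M. f (X \<omega>) \<in> A \<and> g (Y \<omega>) \<in> B}
      = measure M {\<omega>\<in>space M. f (X \<omega>) \<in> A} * measure M {\<omega>\<in>space M. g (Y \<omega>) \<in> B}"
    using measurable_space[OF X] measurable_space[OF Y] by (simp cong: conj_cong)
qed

lemma indep_rv_distr:
  assumes "prob_space M" "indep_rv M S X T Y"
  shows "distr M (S \<Otimes>\<^sub>M T) (\<lambda>\<omega>. (X \<omega>, Y \<omega>)) = distr M S X \<Otimes>\<^sub>M distr M T Y"
proof -
  interpret prob_space M by fact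
  have [measurable]: "X \<in> M \<rightarrow>\<^sub>M S" "Y \<in> M \<rightarrow>\<^sub>M T" using assms(2) by (auto simp: indep_rv_def)
  interpret X: prob_space "distr M S X" by (rule prob_space_distr) measurable
  interpret Y: prob_space "distr M T Y" by (rule prob_space_distr) measurable
  have "distr M S X \<Otimes>\<^sub>M distr M T Y = distr M (S \<Otimes>\<^sub>M T) (\<lambda>\<omega>. (X \<omega>, Y \<omega>))"
  proof (rule pair_measure_eqI)
    show "sigma_finite_measure (distr M S X)" "sigma_finite_measure (distr M T Y)" ..
    fix A B assume "A \<in> sets (distr M S X)" "B \<in> sets (distr M T Y)"
    then have [measurable]: "A \<in> sets S" "B \<in> sets T" by auto
    have "X -` A \<inter> space M = {\<omega>\<in>space M. X \<omega> \<in> A}" "Y -` B \<inter> space M = {\<omega>\<in>space M. Y \<omega> \<in> B}"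
      "(\<lambda>\<omega>. (X \<omega>, Y \<omega>)) -` (A \<times> B) \<inter> space M = {\<omega>\<in>space M. X \<omega> \<in> A \<and> Y \<omega> \<in> B}" by auto
    then show "emeasure (distr M S X) A * emeasure (distr M T Y) B
        = emeasure (distr M (S \<Otimes>\<^sub>M T) (\<lambda>\<omega>. (X \<omega>, Y \<omega>))) (A \<times> B)"
      by (simp add: emeasure_distr emeasure_eq_measure ennreal_mult[symmetric]
        indep_rvD[OF assms \<open>A \<in> sets S\<close> \<open>B \<in> sets T\<close>])
  qed (simp cong: sets_pair_measure_cong)
  then show ?thesis ..
qed

lemma measurable_paths:
  assumes "\<And>t. X t \<in> M \<rightarrow>\<^sub>M S"
  shows "(\<lambda>\<omega>. restrict (\<lambda>t. X t \<omega>) I) \<in> M \<rightarrow>\<^sub>M PiM I (\<lambda>_. S)"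
    and "(\<lambda>\<omega> t. X t \<omega>) \<in> M \<rightarrow>\<^sub>M PiM UNIV (\<lambda>_. S)"
proof -
  show 1: "(\<lambda>\<omega>. restrict (\<lambda>t. X t \<omega>) I) \<in> M \<rightarrow>\<^sub>M PiM I (\<lambda>_. S)" for I
    using assms by (rule measurable_restrict)
  from 1[of UNIV] show "(\<lambda>\<omega> t. X t \<omega>) \<in> M \<rightarrow>\<^sub>M PiM UNIV (\<lambda>_. S)" by (simp add: restrict_def)
qed

lemma finite_measure_subalgebra_sigma_of:
  assumes "prob_space M" and X: "\<And>t. X t \<in> M \<rightarrow>\<^sub>M S"
  shows "finite_measure_subalgebra M (sigma_of M S I X)"
proof -
  interpret prob_space M by fact
  have "sets (sigma_of M S I X) \<subseteq> sets M"
    unfolding sigma_of_def using measurable_space[OF measurable_paths(1)[of X M S I, OF X]]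
    by (subst sets_vimage_algebra2) (auto intro!: measurable_sets[OF measurable_paths(1)[of X M S I, OF X]])
  then have "subalgebra M (sigma_of M S I X)" by (simp add: subalgebra_def sigma_of_def)
  then show ?thesis
    unfolding finite_measure_subalgebra_def finite_measure_subalgebra_axioms_def
    using finite_measure_axioms by simp
qed

lemma sets_sigma_ofE:
  assumes X: "\<And>t. X t \<in> M \<rightarrow>\<^sub>M S" and "A \<in> sets (sigma_of M S I X)"
  obtains B where "B \<in> sets (PiM I (\<lambda>_. S))" "A = {\<omega>\<in>space M. restrict (\<lambda>t. X t \<omega>) I \<in> B}"
proof -
  have "(\<lambda>\<omega>. restrict (\<lambda>t. X t \<omega>) I) \<in> space M \<rightarrow> space (PiM I (\<lambda>_. S))"
    using measurable_space[OF measurable_paths(1)[of X M S I, OF X]] by auto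
  with assms(2) show thesis unfolding sigma_of_def
    by (auto simp: sets_vimage_algebra2 vimage_def Int_def conj_commute intro: that)
qed

lemma measurable_sigma_of:
  assumes X: "\<And>t. X t \<in> M \<rightarrow>\<^sub>M S" and f: "f \<in> PiM I (\<lambda>_. S) \<rightarrow>\<^sub>M N"
  shows "(\<lambda>\<omega>. f (restrict (\<lambda>t. X t \<omega>) I)) \<in> sigma_of M S I X \<rightarrow>\<^sub>M N"
proof -
  have "(\<lambda>\<omega>. restrict (\<lambda>t. X t \<omega>) I) \<in> sigma_of M S I X \<rightarrow>\<^sub>M PiM I (\<lambda>_. S)"
    unfolding sigma_of_def using measurable_space[OF measurable_paths(1)[of X M S I, OF X]]
    by (intro measurable_vimage_algebra1) auto
  from measurable_compose[OF this f] show ?thesis .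
qed

text \<open>The freezing lemma: the input is held fixed and the noise integrated out. The defining
  property of the conditional expectation is Fubini for the product law of the noise and the input
  path.\<close>

lemma real_cond_exp_independent_noise:
  fixes X :: "int \<Rightarrow> 'a \<Rightarrow> real" and F :: "real \<Rightarrow> 'n \<Rightarrow> real"
  assumes M: "prob_space M" and X[measurable]: "\<And>t. X t \<in> borel_measurable M"
    and ind: "indep_processes M S N borel X" and F: "(\<lambda>(z, n). F z n) \<in> borel_measurable (borel \<Otimes>\<^sub>M S)"
    and bound: "\<And>z n. n \<in> space S \<Longrightarrow> \<bar>F z n\<bar> \<le> c"
  shows "AE \<omega> in M. real_cond_exp M (sigma_of M borel UNIV X) (\<lambda>\<omega>. F (X t \<omega>) (N u \<omega>)) \<omega>
      = (\<integral>n. F (X t \<omega>) n \<partial>distr M S (N u))"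
proof -
  interpret prob_space M by fact
  interpret A: finite_measure_subalgebra M "sigma_of M borel UNIV X"
    by (rule finite_measure_subalgebra_sigma_of[OF M X])
  let ?P = "PiM UNIV (\<lambda>_. borel) :: (int \<Rightarrow> real) measure"
  have Np: "(\<lambda>\<omega> t. N t \<omega>) \<in> M \<rightarrow>\<^sub>M PiM UNIV (\<lambda>_. S)" using ind by (simp add: indep_processes_def indep_rv_def)
  have N[measurable]: "N u \<in> M \<rightarrow>\<^sub>M S" using measurable_compose[OF Np measurable_component_singleton[of u]] by simp
  interpret D: prob_space "distr M S (N u)" by (rule prob_space_distr) measurable
  have [measurable]: "(\<lambda>\<omega> t. X t \<omega>) \<in> M \<rightarrow>\<^sub>M ?P" by (rule measurable_paths(2)) measurable
  interpret P: prob_space "distr M ?P (\<lambda>\<omega> t. X t \<omega>)" by (rule prob_space_distr) measurable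
  interpret DP: pair_prob_space "distr M S (N u)" "distr M ?P (\<lambda>\<omega> t. X t \<omega>)" ..
  have "indep_rv M S (N u) ?P (\<lambda>\<omega> t. X t \<omega>)"
    using indep_rv_compose[OF M ind[unfolded indep_processes_def], of "\<lambda>n. n u" S "\<lambda>x. x" ?P] by simp
  from indep_rv_distr[OF M this] have law: "distr M (S \<Otimes>\<^sub>M ?P) (\<lambda>\<omega>. (N u \<omega>, \<lambda>t. X t \<omega>)) = distr M S (N u) \<Otimes>\<^sub>M distr M ?P (\<lambda>\<omega> t. X t \<omega>)" .
  have F'[measurable (raw)]: "(\<lambda>x. F (f x) (g x)) \<in> borel_measurable K"
    if "f \<in> borel_measurable K" "g \<in> K \<rightarrow>\<^sub>M S" for f g and K :: "'x measure"
    using measurable_compose[OF measurable_Pair[OF that] F] by simp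
  have int: "(\<lambda>z. \<integral>n. F z n \<partial>distr M S (N u)) \<in> borel_measurable borel"
    by (rule D.borel_measurable_lebesgue_integral) (use F in simp)
  have ib: "\<bar>\<integral>n. F z n \<partial>distr M S (N u)\<bar> \<le> c" for z
  proof -
    have "(\<lambda>n. F z n) \<in> borel_measurable S" by measurable
    then have "integrable (distr M S (N u)) (\<lambda>n. F z n)"
      using bound by (intro D.integrable_const_bound[of _ c]) (auto simp: space_distr)
    then have "-c \<le> (\<integral>n. F z n \<partial>distr M S (N u))" "(\<integral>n. F z n \<partial>distr M S (N u)) \<le> c"
      using bound[of _ z] by (auto intro!: D.integral_ge_const D.integral_le_const AE_I2 simp: abs_le_iff minus_le_iff)
    then show ?thesis by simp
  qed
  show ?thesis
  proof (rule A.real_cond_exp_charact)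
    show "integrable M (\<lambda>\<omega>. F (X t \<omega>) (N u \<omega>))"
      using bound measurable_space[OF N] by (intro integrable_const_bound[of _ c]) auto
    show "integrable M (\<lambda>\<omega>. \<integral>n. F (X t \<omega>) n \<partial>distr M S (N u))"
      using ib measurable_compose[OF X int] by (intro integrable_const_bound[of _ c]) auto
    have "(\<lambda>x. \<integral>n. F (x t) n \<partial>distr M S (N u)) \<in> borel_measurable ?P"
      by (rule measurable_compose[OF _ int]) measurable
    from measurable_sigma_of[of X M borel, OF X this]
    show "(\<lambda>\<omega>. \<integral>n. F (X t \<omega>) n \<partial>distr M S (N u)) \<in> borel_measurable (sigma_of M borel UNIV X)" by simp
    fix A assume "A \<in> sets (sigma_of M borel UNIV X)"
    then obtain B where B[measurable]: "B \<in> sets ?P" and A: "A = {\<omega>\<in>space M. restrict (\<lambda>t. X t \<omega>) UNIV \<in> B}"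
      by (rule sets_sigma_ofE[of X M borel, OF X])
    have "(\<integral>\<omega>\<in>A. F (X t \<omega>) (N u \<omega>) \<partial>M) = (\<integral>\<omega>. indicator B (\<lambda>t. X t \<omega>) * F (X t \<omega>) (N u \<omega>) \<partial>M)"
      unfolding set_lebesgue_integral_def
      by (intro Bochner_Integration.integral_cong) (auto simp: A indicator_def restrict_def)
    also have "\<dots> = (\<integral>y. indicator B (snd y) * F (snd y t) (fst y) \<partial>distr M (S \<Otimes>\<^sub>M ?P) (\<lambda>\<omega>. (N u \<omega>, \<lambda>t. X t \<omega>)))"
      by (subst integral_distr) auto
    also have "\<dots> = (\<integral>x. \<integral>n. indicator B x * F (x t) n \<partial>distr M S (N u) \<partial>distr M ?P (\<lambda>\<omega> t. X t \<omega>))"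
      unfolding law
    proof (subst DP.integral_snd)
      have "(\<lambda>y. indicator B (snd y) * F (snd y t) (fst y)) \<in> borel_measurable (distr M S (N u) \<Otimes>\<^sub>M distr M ?P (\<lambda>\<omega> t. X t \<omega>))"
        by measurable
      then show "integrable (distr M S (N u) \<Otimes>\<^sub>M distr M ?P (\<lambda>\<omega> t. X t \<omega>)) (\<lambda>(n, x). indicator B x * F (x t) n)"
        using order_trans[OF bound abs_ge_self[of c]]
        by (intro DP.integrable_const_bound[of _ "\<bar>c\<bar>"]) (auto simp: split_beta' space_pair_measure indicator_def intro!: AE_I2)
    qed (simp add: split_beta')
    also have "\<dots> = (\<integral>x. indicator B x * (\<integral>n. F (x t) n \<partial>distr M S (N u)) \<partial>distr M ?P (\<lambda>\<omega> t. X t \<omega>))"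
      by simp
    also have "\<dots> = (\<integral>\<omega>. indicator B (\<lambda>t. X t \<omega>) * (\<integral>n. F (X t \<omega>) n \<partial>distr M S (N u)) \<partial>M)"
      using int by (subst integral_distr) (auto intro!: borel_measurable_times measurable_compose[OF _ int])
    also have "\<dots> = (\<integral>\<omega>\<in>A. (\<integral>n. F (X t \<omega>) n \<partial>distr M S (N u)) \<partial>M)"
      unfolding set_lebesgue_integral_def
      by (intro Bochner_Integration.integral_cong) (auto simp: A indicator_def restrict_def)
    finally show "(\<integral>\<omega>\<in>A. F (X t \<omega>) (N u \<omega>) \<partial>M) = (\<integral>\<omega>\<in>A. (\<integral>n. F (X t \<omega>) n \<partial>distr M S (N u)) \<partial>M)" .
  qed
qed

section \<open>Row vectors, Markov chains and product laws\<close>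

lemma vector_matrix_mult_rows:
  fixes x :: "real^'m" and A :: "real^'n^'m"
  shows "x v* A = (\<Sum>i\<in>UNIV. x $ i *\<^sub>R A $ i)"
  by (simp add: vec_eq_iff vector_matrix_mult_def mult.commute)

lemma vec_nth_measurable[measurable (raw)]:
  fixes f :: "'a \<Rightarrow> ('b::{real_normed_vector, second_countable_topology})^'d"
  shows "f \<in> borel_measurable M \<Longrightarrow> (\<lambda>x. f x $ i) \<in> borel_measurable M"
  by (erule measurable_compose) (intro borel_measurable_continuous_onI continuous_intros)

lemma vector_matrix_mult_measurable[measurable (raw)]:
  fixes f :: "'a \<Rightarrow> real^'d"
  shows "f \<in> borel_measurable M \<Longrightarrow> A \<in> borel_measurable M \<Longrightarrow> (\<lambda>x. f x v* A x) \<in> borel_measurable M"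
  unfolding vector_matrix_mult_rows
  by (intro borel_measurable_sum borel_measurable_scaleR vec_nth_measurable)

lemma axis_vector_matrix: "axis i 1 v* (A :: real^'d^'d) = A $ i"
  by (simp add: vector_matrix_mult_rows axis_def if_distrib[of "\<lambda>c. c *\<^sub>R _"] cong: if_cong)

text \<open>Every event generated by the past is a preimage under the path up to \<open>t\<close>,
  so the identity defining the conditional expectation has to be checked for these
  preimages.\<close>

lemma markov_chainI:
  fixes X :: "int \<Rightarrow> 'a \<Rightarrow> real^'d"
  assumes M: "prob_space M" and basis: "basis_process M X"
    and eq: "\<And>t k B. B \<in> sets (PiM {..t} (\<lambda>_. borel)) \<Longrightarrow>
      measure M {\<omega>\<in>space M. restrict (\<lambda>s. X s \<omega>) {..t} \<in> B \<and> X (t + 1) \<omega> = axis k 1}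
        = (\<integral>\<omega>. indicator B (restrict (\<lambda>s. X s \<omega>) {..t}) * (X t \<omega> v* A) $ k \<partial>M)"
  shows "markov_chain M A X"
  unfolding markov_chain_def
proof (intro conjI basis allI)
  fix t k
  interpret prob_space M by fact
  have X[measurable]: "\<And>t. X t \<in> borel_measurable M" and ax: "\<And>t \<omega>. \<omega> \<in> space M \<Longrightarrow> \<exists>j. X t \<omega> = axis j 1"
    using basis by (auto simp: basis_process_def)
  interpret A: finite_measure_subalgebra M "sigma_of M borel {..t} X"
    by (rule finite_measure_subalgebra_sigma_of[OF M X])
  show "AE \<omega> in M. real_cond_exp M (sigma_of M borel {..t} X) (\<lambda>\<omega>. of_bool (X (t + 1) \<omega> = axis k 1)) \<omega>
      = (X t \<omega> v* A) $ k"
  proof (rule A.real_cond_exp_charact)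
    have [measurable]: "{\<omega>\<in>space M. X (t + 1) \<omega> = axis k 1} \<in> sets M" by measurable
    then have "(\<lambda>\<omega>. indicator {\<omega>\<in>space M. X (t + 1) \<omega> = axis k 1} \<omega> :: real) \<in> borel_measurable M" by measurable
    then have "(\<lambda>\<omega>. of_bool (X (t + 1) \<omega> = axis k 1) :: real) \<in> borel_measurable M"
      by (rule measurable_cong[THEN iffD1, rotated]) (simp add: indicator_def)
    then show "integrable M (\<lambda>\<omega>. of_bool (X (t + 1) \<omega> = axis k 1) :: real)"
      by (intro integrable_const_bound[of _ 1]) auto
    have "\<bar>(X t \<omega> v* A) $ k\<bar> \<le> (\<Sum>i\<in>UNIV. \<bar>A $ i $ k\<bar>)" if "\<omega> \<in> space M" for \<omega>
    proof -
      obtain j where "X t \<omega> = axis j 1" using ax[OF \<open>\<omega> \<in> space M\<close>] by blast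
      then show ?thesis using member_le_sum[of j UNIV "\<lambda>i. \<bar>A $ i $ k\<bar>"] by (simp add: axis_vector_matrix)
    qed
    then show "integrable M (\<lambda>\<omega>. (X t \<omega> v* A) $ k)"
      by (intro integrable_const_bound[of _ "\<Sum>i\<in>UNIV. \<bar>A $ i $ k\<bar>"]) auto
    have "(\<lambda>x. (x t v* A) $ k) \<in> borel_measurable (PiM {..t} (\<lambda>_. borel :: (real^'d) measure))"
      by measurable
    from measurable_sigma_of[of X M borel, OF X this]
    show "(\<lambda>\<omega>. (X t \<omega> v* A) $ k) \<in> borel_measurable (sigma_of M borel {..t} X)" by simp
    fix C assume "C \<in> sets (sigma_of M borel {..t} X)"
    then obtain B where B[measurable]: "B \<in> sets (PiM {..t} (\<lambda>_. borel))" and C: "C = {\<omega>\<in>space M. restrict (\<lambda>t. X t \<omega>) {..t} \<in> B}"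
      by (rule sets_sigma_ofE[of X M borel, OF X])
    have [measurable]: "(\<lambda>\<omega>. restrict (\<lambda>t. X t \<omega>) {..t}) \<in> M \<rightarrow>\<^sub>M PiM {..t} (\<lambda>_. borel)"
      by (rule measurable_paths(1)) measurable
    have "(\<integral>\<omega>\<in>C. of_bool (X (t + 1) \<omega> = axis k 1) \<partial>M)
        = (\<integral>\<omega>. indicator {\<omega>\<in>space M. restrict (\<lambda>s. X s \<omega>) {..t} \<in> B \<and> X (t + 1) \<omega> = axis k 1} \<omega> \<partial>M)"
      unfolding set_lebesgue_integral_def
      by (intro Bochner_Integration.integral_cong) (auto simp: C indicator_def)
    also have "\<dots> = (\<integral>\<omega>. indicator B (restrict (\<lambda>s. X s \<omega>) {..t}) * (X t \<omega> v* A) $ k \<partial>M)"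
      using eq[OF B, of k] by simp
    also have "\<dots> = (\<integral>\<omega>\<in>C. (X t \<omega> v* A) $ k \<partial>M)"
      unfolding set_lebesgue_integral_def
      by (intro Bochner_Integration.integral_cong) (auto simp: C indicator_def)
    finally show "(\<integral>\<omega>\<in>C. of_bool (X (t + 1) \<omega> = axis k 1) \<partial>M) = (\<integral>\<omega>\<in>C. (X t \<omega> v* A) $ k \<partial>M)" .
  qed
qed

text \<open>\<open>A\<close> and \<open>B\<close> are not given as laws of \<open>X\<close> and
  \<open>Y\<close>; taking the full space for one of the two events identifies them.\<close>

lemma indep_rv_of_distr:
  assumes "prob_space M" and X[measurable]: "X \<in> M \<rightarrow>\<^sub>M S" and Y[measurable]: "Y \<in> M \<rightarrow>\<^sub>M T"
    and A: "prob_space A" "sets A = sets S" and B: "prob_space B" "sets B = sets T"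
    and eq: "distr M (S \<Otimes>\<^sub>M T) (\<lambda>\<omega>. (X \<omega>, Y \<omega>)) = A \<Otimes>\<^sub>M B"
  shows "indep_rv M S X T Y"
proof (rule indep_rvI[OF assms(1) X Y])
  interpret A: prob_space A by fact
  interpret B: prob_space B by fact
  have *: "measure M {\<omega>\<in>space M. X \<omega> \<in> a \<and> Y \<omega> \<in> b} = measure A a * measure B b"
    if [measurable]: "a \<in> sets S" "b \<in> sets T" for a b
  proof -
    have "measure M {\<omega>\<in>space M. X \<omega> \<in> a \<and> Y \<omega> \<in> b} = measure (distr M (S \<Otimes>\<^sub>M T) (\<lambda>\<omega>. (X \<omega>, Y \<omega>))) (a \<times> b)"
      by (subst measure_distr) (auto intro!: arg_cong[where f = "measure M"])
    then show ?thesis using that A(2) B(2) by (simp add: eq B.measure_pair_Times)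
  qed
  fix a b assume a: "a \<in> sets S" and b: "b \<in> sets T"
  have "space A = space S" "space B = space T" using A(2) B(2) by (auto dest: sets_eq_imp_space_eq)
  then have "measure M {\<omega>\<in>space M. X \<omega> \<in> a} = measure A a" "measure M {\<omega>\<in>space M. Y \<omega> \<in> b} = measure B b"
    using *[OF a sets.top] *[OF sets.top b] A.prob_space B.prob_space measurable_space[OF X] measurable_space[OF Y]
    by (simp_all cong: conj_cong)
  with *[OF a b] show "measure M {\<omega>\<in>space M. X \<omega> \<in> a \<and> Y \<omega> \<in> b}
      = measure M {\<omega>\<in>space M. X \<omega> \<in> a} * measure M {\<omega>\<in>space M. Y \<omega> \<in> b}" by simp
qed

lemma indep_rv_swap:
  assumes "prob_space M" "indep_rv M S X T Y"
  shows "indep_rv M T Y S X"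
proof (rule indep_rvI[OF assms(1)])
  fix A B assume "A \<in> sets T" "B \<in> sets S"
  with indep_rvD[OF assms, of B A]
  show "measure M {\<omega>\<in>space M. Y \<omega> \<in> A \<and> X \<omega> \<in> B}
      = measure M {\<omega>\<in>space M. Y \<omega> \<in> A} * measure M {\<omega>\<in>space M. X \<omega> \<in> B}"
    by (simp add: conj_commute mult.commute)
qed (use assms(2) in \<open>auto simp: indep_rv_def\<close>)

text \<open>The counterpart of \<open>distr_input_noise\<close> for the given data; the two together
  show that the construction keeps the joint law of input and noise.\<close>

lemma iid_input_law:
  fixes X :: "int \<Rightarrow> 'a \<Rightarrow> real"
  assumes M: "prob_space M" and iid: "iid M S N" and ind: "indep_processes M S N borel X"
    and X[measurable]: "\<And>t. X t \<in> borel_measurable M" and \<rho>: "\<rho> = distr M S (N s)"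
  shows "distr M (PiM UNIV (\<lambda>_. borel) \<Otimes>\<^sub>M PiM UNIV (\<lambda>_. \<rho>)) (\<lambda>\<omega>. (\<lambda>t. X t \<omega>, \<lambda>t. N t \<omega>))
    = path_law M borel X \<Otimes>\<^sub>M PiM UNIV (\<lambda>_. \<rho>)"
  unfolding path_law_def
proof (rule distr_eq_pair_PiM[OF M])
  interpret prob_space M by fact
  have iv: "indep_vars (\<lambda>_. S) N UNIV" and d: "\<And>t. distr M S (N t) = \<rho>"
    using iid by (auto simp: iid_def \<rho>)
  have N[measurable]: "N t \<in> M \<rightarrow>\<^sub>M S" for t using iv by (auto simp: indep_vars_def)
  show "prob_space \<rho>" unfolding \<rho> by (rule prob_space_distr) measurable
  show Xp: "(\<lambda>\<omega> t. X t \<omega>) \<in> M \<rightarrow>\<^sub>M PiM UNIV (\<lambda>_. borel)" by (rule measurable_paths(2)) measurable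
  show "N t \<in> M \<rightarrow>\<^sub>M \<rho>" for t unfolding \<rho> by simp
  fix A :: "(int \<Rightarrow> real) set" and J :: "int set" and B
  assume A[measurable]: "A \<in> sets (PiM UNIV (\<lambda>_. borel))" and J: "finite J" and "\<And>s :: int. B s \<in> sets \<rho>"
  then have B[measurable]: "\<And>s. B s \<in> sets S" by (simp add: \<rho>)
  have pN: "measure M {\<omega>\<in>space M. \<forall>s\<in>J. N s \<omega> \<in> B s} = (\<Prod>s\<in>J. measure \<rho> (B s))"
  proof (cases "J = {}")
    case True
    then show ?thesis by (simp add: prob_space)
  next
    case False
    then have "{\<omega>\<in>space M. \<forall>s\<in>J. N s \<omega> \<in> B s} = (\<Inter>s\<in>J. N s -` B s \<inter> space M)" by auto
    also have "prob \<dots> = (\<Prod>s\<in>J. prob (N s -` B s \<inter> space M))"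
      by (rule indep_varsD[OF iv False J]) auto
    also have "\<dots> = (\<Prod>s\<in>J. measure \<rho> (B s))"
      using measure_distr[OF N B] by (simp add: d)
    finally show ?thesis .
  qed
  define C where "C = {n\<in>space (PiM UNIV (\<lambda>_. S)). \<forall>s\<in>J. n s \<in> B s}"
  have C: "C \<in> sets (PiM UNIV (\<lambda>_. S))" unfolding C_def using J by measurable
  have in_C: "(\<lambda>t. N t \<omega>) \<in> C \<longleftrightarrow> (\<forall>s\<in>J. N s \<omega> \<in> B s)" if "\<omega> \<in> space M" for \<omega>
    using measurable_space[OF N that] by (simp add: C_def space_PiM PiE_iff extensional_def)
  from indep_rvD[OF M ind[unfolded indep_processes_def] C A]
  show "prob {\<omega>\<in>space M. (\<lambda>t. X t \<omega>) \<in> A \<and> (\<forall>s\<in>J. N s \<omega> \<in> B s)}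
      = prob {\<omega>\<in>space M. (\<lambda>t. X t \<omega>) \<in> A} * (\<Prod>s\<in>J. measure \<rho> (B s))"
    by (simp add: in_C pN conj_commute mult.commute cong: conj_cong)
qed

section \<open>Input and noise of the theorem\<close>

lemma AE_distr_of_pred:
  "f \<in> M \<rightarrow>\<^sub>M N \<Longrightarrow> Measurable.pred N Q \<Longrightarrow> AE x in M. Q (f x) \<Longrightarrow> AE y in distr M N f. Q y"
  by (subst AE_distr_iff) (simp_all add: pred_def)

lemma row_of_zero_one:
  fixes a :: "'d::finite \<Rightarrow> real"
  assumes "\<And>j. a j \<in> {0, 1}" "(\<Sum>j\<in>UNIV. a j) = 1"
  shows "a j = of_bool ((THE j. a j = 1) = j)"
proof -
  have "(\<Sum>j\<in>UNIV. a j) = (\<Sum>j\<in>{j. a j = 1}. 1)"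
    using assms(1) by (intro sum.mono_neutral_cong_right) auto
  then have "card {j. a j = 1} = 1" using assms(2) by simp
  then obtain k where k: "{j. a j = 1} = {k}" by (auto simp: card_1_singleton_iff)
  then have "(THE j. a j = 1) = k" by (intro the_equality) auto
  then show ?thesis using k assms(1)[of j] by (auto simp: set_eq_iff)
qed

text \<open>A simple upper bound for the operator norm of \<open>A\<close> acting on row
  vectors.\<close>

definition row_norm_sum :: "real^'n^'m \<Rightarrow> real" where
  "row_norm_sum A = (\<Sum>i\<in>UNIV. norm (A $ i))"

lemma norm_vector_matrix: "norm (x v* A) \<le> row_norm_sum A * norm (x :: real^'m)"
proof -
  have "norm (x v* A) \<le> (\<Sum>i\<in>UNIV. norm (x $ i *\<^sub>R A $ i))"
    unfolding vector_matrix_mult_rows by (rule norm_sum)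
  also have "\<dots> \<le> (\<Sum>i\<in>UNIV. norm x * norm (A $ i))"
    by (intro sum_mono) (auto intro!: mult_right_mono simp: component_le_norm_cart)
  finally show ?thesis by (simp add: row_norm_sum_def sum_distrib_left mult.commute)
qed

lemma vector_matrix_diff: "(x - y) v* A = x v* A - y v* (A :: real^'n^'m)"
  by (simp add: vector_matrix_mult_rows scaleR_diff_left sum_subtractf)

text \<open>Describes one value of \<epsilon>: \<open>\<zeta>\<close> is the scaled input,
  \<open>e\<close> its bound, and \<open>L\<close> and \<delta> become multiples of \<epsilon> in
  the end.\<close>

locale construction =
  fixes P :: "real \<Rightarrow> real^'d^'d"
    and M0 :: "'a measure"
    and S :: "'n measure"
    and \<G> :: "real \<Rightarrow> 'n \<Rightarrow> real^'d^'d"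
    and \<zeta> :: "int \<Rightarrow> 'a \<Rightarrow> real"
    and N0 :: "int \<Rightarrow> 'a \<Rightarrow> 'n"
    and e L \<delta> :: real and m :: nat and word :: "nat \<Rightarrow> 'd \<Rightarrow> 'd" and target :: 'd
  assumes stoch: "\<And>z. row_stochastic (P z)"
    and M0: "prob_space M0"
    and stat: "stationary M0 borel \<zeta>"
    and mean: "\<And>t. (LINT \<omega>|M0. \<zeta> t \<omega>) = 0"
    and bnd: "AE \<omega> in M0. \<forall>t. \<bar>\<zeta> t \<omega>\<bar> \<le> e"
    and sel: "selection_map S \<G>"
    and ian: "input_and_noise M0 S P \<G> \<zeta> N0"
    and e: "0 \<le> e"
    and cont: "continuous_on {-e..e} P"
    and lip: "\<And>z. \<bar>z\<bar> \<le> e \<Longrightarrow> norm (P z - P 0) \<le> L"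
    and minor: "\<And>z i j. \<bar>z\<bar> \<le> e \<Longrightarrow> (1 - \<delta>) * P 0 $ i $ j \<le> P z $ i $ j"
    and delta01: "0 < \<delta>" "\<delta> < 1"
    and wpos: "\<And>l i. l < m \<Longrightarrow> 0 < P 0 $ i $ word l i"
    and wsync: "\<And>h s i. (\<And>l. l < m \<Longrightarrow> h (s + int l) = word l) \<Longrightarrow> bcomp h (s + int m) m i = target"
begin

definition rho :: "'n measure" where "rho = distr M0 S (N0 0)"

text \<open>The transition probabilities actually produced by the selection map and the noise; the
  hypotheses tie them to \<open>P\<close> only along the input and almost surely.\<close>

definition trans_prob :: "real \<Rightarrow> 'd \<Rightarrow> 'd \<Rightarrow> real" where
  "trans_prob z i j = (\<integral>n. \<G> z n $ i $ j \<partial>rho)"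

text \<open>
  The hypotheses on the input hold almost surely only. Retracting to the admissible values changes
  the input on a null set and makes them hold everywhere, so that \<open>P\<close> is only evaluated where it is
  continuous. The clipping keeps \<open>admissible\<close> measurable, as \<open>P\<close> may not be measurable far from 0.
\<close>

definition admissible :: "real set" where
  "admissible = {z. \<bar>z\<bar> \<le> e \<and> (\<forall>i j. trans_prob z i j = P (max (-e) (min e z)) $ i $ j)}"

definition retract :: "real \<Rightarrow> real" where
  "retract z = (if z \<in> admissible then z else (SOME z. z \<in> admissible))"

text \<open>The retraction is built in, so that the minorization holds at every real number.\<close>

definition gmap :: "real \<Rightarrow> 'n \<Rightarrow> 'd \<Rightarrow> 'd" where
  "gmap z n i = (THE j. \<G> (retract z) n $ i $ j = 1)"

lemma zeta_measurable[measurable]: "\<zeta> t \<in> borel_measurable M0"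
  using stat by (simp add: stationary_def)

lemma iid_N0: "iid M0 S N0" and ind_N0: "indep_processes M0 S N0 borel \<zeta>"
  using ian by (auto simp: input_and_noise_def)

lemma N0_measurable[measurable]: "N0 t \<in> M0 \<rightarrow>\<^sub>M S"
proof -
  have "(\<lambda>\<omega> t. N0 t \<omega>) \<in> M0 \<rightarrow>\<^sub>M PiM UNIV (\<lambda>_. S)"
    using ind_N0 by (simp add: indep_processes_def indep_rv_def)
  from measurable_compose[OF this measurable_component_singleton[of t]] show ?thesis by simp
qed

lemma distr_N0: "distr M0 S (N0 t) = rho"
  using iid_N0 by (auto simp: iid_def rho_def)

lemma prob_space_rho: "prob_space rho"
  unfolding rho_def by (rule prob_space.prob_space_distr[OF M0]) measurable

lemma sets_rho[measurable_cong, simp]: "sets rho = sets S"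
  by (simp add: rho_def)

lemma space_rho[simp]: "space rho = space S"
  by (simp add: rho_def)

lemma G_entry_measurable[measurable (raw)]:
  assumes "f \<in> K \<rightarrow>\<^sub>M borel" "g \<in> K \<rightarrow>\<^sub>M S"
  shows "(\<lambda>x. \<G> (f x) (g x)) \<in> borel_measurable K"
  using measurable_compose[OF measurable_Pair[OF assms], of "\<lambda>(z, n). \<G> z n" borel] sel
  by (simp add: selection_map_def)

lemma G_row: "n \<in> space S \<Longrightarrow> \<G> z n $ i $ j \<in> {0, 1}" "n \<in> space S \<Longrightarrow> (\<Sum>j\<in>UNIV. \<G> z n $ i $ j) = 1"
  using sel by (auto simp: selection_map_def)

lemma G_eq: "n \<in> space S \<Longrightarrow> \<G> (retract z) n $ i $ j = of_bool (gmap z n i = j)"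
  unfolding gmap_def by (rule row_of_zero_one) (rule G_row, assumption)+

lemma G_row_eq: "n \<in> space S \<Longrightarrow> \<G> (retract z) n $ i = axis (gmap z n i) 1"
  by (simp add: vec_eq_iff G_eq axis_def)

text \<open>Two versions of one conditional expectation are compared: the hypothesis gives
  \<open>P\<close>, freezing the input gives \<open>trans_prob\<close>.\<close>

lemma AE_admissible: "AE \<omega> in M0. \<forall>t. \<zeta> t \<omega> \<in> admissible"
proof -
  have "AE \<omega> in M0. trans_prob (\<zeta> t \<omega>) i j = P (\<zeta> t \<omega>) $ i $ j" for t i j
  proof -
    have "AE \<omega> in M0. real_cond_exp M0 (sigma_of M0 borel UNIV \<zeta>) (\<lambda>\<omega>. \<G> (\<zeta> t \<omega>) (N0 (t + 1) \<omega>) $ i $ j) \<omega>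
        = (\<integral>n. \<G> (\<zeta> t \<omega>) n $ i $ j \<partial>distr M0 S (N0 (t + 1)))"
    proof (rule real_cond_exp_independent_noise[OF M0 zeta_measurable ind_N0])
      show "(\<lambda>(z, n). \<G> z n $ i $ j) \<in> borel_measurable (borel \<Otimes>\<^sub>M S)"
        unfolding split_beta' by measurable
      show "n \<in> space S \<Longrightarrow> \<bar>\<G> z n $ i $ j\<bar> \<le> 1" for z n using G_row(1)[of n z i j] by auto
    qed
    moreover have "AE \<omega> in M0. real_cond_exp M0 (sigma_of M0 borel UNIV \<zeta>) (\<lambda>\<omega>. \<G> (\<zeta> t \<omega>) (N0 (t + 1) \<omega>) $ i $ j) \<omega>
        = P (\<zeta> t \<omega>) $ i $ j"
      using ian by (auto simp: input_and_noise_def)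
    ultimately show ?thesis by eventually_elim (simp add: trans_prob_def distr_N0)
  qed
  then have "AE \<omega> in M0. \<forall>t i j. trans_prob (\<zeta> t \<omega>) i j = P (\<zeta> t \<omega>) $ i $ j"
    by (simp add: AE_all_countable)
  with bnd show ?thesis
  proof eventually_elim
    fix \<omega> assume b: "\<forall>t. \<bar>\<zeta> t \<omega>\<bar> \<le> e" and eq: "\<forall>t i j. trans_prob (\<zeta> t \<omega>) i j = P (\<zeta> t \<omega>) $ i $ j"
    have "max (-e) (min e (\<zeta> t \<omega>)) = \<zeta> t \<omega>" for t using b[rule_format, of t] by auto
    then show "\<forall>t. \<zeta> t \<omega> \<in> admissible" using b eq by (simp add: admissible_def)
  qed
qed

text \<open>Some admissible value exists because the input takes such values almost surely on a
  probability space.\<close>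

lemma retract_admissible: "retract z \<in> admissible"
proof -
  interpret prob_space M0 by (rule M0)
  have "\<exists>z. z \<in> admissible"
  proof (rule ccontr)
    assume "\<nexists>z. z \<in> admissible"
    then have "AE \<omega> in M0. False" using AE_admissible by simp
    then show False by simp
  qed
  then show ?thesis by (auto simp: retract_def intro: someI_ex)
qed

lemma retract_eq: "z \<in> admissible \<Longrightarrow> retract z = z"
  by (simp add: retract_def)

lemma retract_idem[simp]: "retract (retract z) = retract z"
  by (rule retract_eq) (rule retract_admissible)

lemma retract_bound: "\<bar>retract z\<bar> \<le> e"
  using retract_admissible[of z] by (simp add: admissible_def)

lemma clip_retract: "max (-e) (min e (retract z)) = retract z"
  using retract_bound[of z] by auto

lemma trans_prob_retract: "trans_prob (retract z) i j = P (retract z) $ i $ j"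
  using retract_admissible[of z] clip_retract[of z] by (simp add: admissible_def)

lemma P_clip_measurable[measurable]: "(\<lambda>z. P (max (-e) (min e z))) \<in> borel_measurable borel"
  using e by (intro borel_measurable_continuous_onI continuous_on_compose2[OF cont] continuous_intros) auto

lemma trans_prob_measurable[measurable]: "(\<lambda>z. trans_prob z i j) \<in> borel_measurable borel"
proof -
  interpret rho: prob_space rho by (rule prob_space_rho)
  show ?thesis unfolding trans_prob_def by (rule rho.borel_measurable_lebesgue_integral) measurable
qed

lemma admissible_measurable[measurable]: "admissible \<in> sets borel"
  unfolding admissible_def by measurable

lemma retract_measurable[measurable]: "retract \<in> borel_measurable borel"
  unfolding retract_def[abs_def] by measurable

lemma P_retract_measurable[measurable (raw)]:
  assumes "f \<in> borel_measurable K" shows "(\<lambda>x. P (retract (f x))) \<in> borel_measurable K"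
proof -
  have "(\<lambda>x. P (max (-e) (min e (retract (f x))))) \<in> borel_measurable K"
    by (rule measurable_compose[OF _ P_clip_measurable]) (use assms in measurable)
  then show ?thesis by (simp only: clip_retract)
qed

lemma gmap_measurable: "(\<lambda>(z, n). gmap z n i) \<in> borel \<Otimes>\<^sub>M rho \<rightarrow>\<^sub>M count_space UNIV"
proof (rule measurable_finiteI)
  fix j
  have "Measurable.pred (borel \<Otimes>\<^sub>M rho) (\<lambda>x. \<G> (retract (fst x)) (snd x) $ i $ j = 1)"
    by measurable
  then show "Measurable.pred (borel \<Otimes>\<^sub>M rho) (\<lambda>x. (case x of (z, n) \<Rightarrow> gmap z n i) = j)"
    by (rule measurable_cong[THEN iffD1, rotated]) (auto simp: space_pair_measure G_eq)
qed

definition row_pmf :: "'d \<Rightarrow> 'd pmf" where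
  "row_pmf i = embed_pmf (\<lambda>j. P 0 $ i $ j)"

lemma pmf_row: "pmf (row_pmf i) j = P 0 $ i $ j"
  unfolding row_pmf_def
proof (rule pmf_embed_pmf)
  show "0 \<le> P 0 $ i $ j" for j using stoch[of 0] by (simp add: row_stochastic_def)
  have "(\<integral>\<^sup>+j. ennreal (P 0 $ i $ j) \<partial>count_space UNIV) = ennreal (\<Sum>j\<in>UNIV. P 0 $ i $ j)"
    using stoch[of 0] by (subst nn_integral_count_space_finite) (auto simp: row_stochastic_def sum_ennreal)
  then show "(\<integral>\<^sup>+j. ennreal (P 0 $ i $ j) \<partial>count_space UNIV) = 1"
    using stoch[of 0] by (simp add: row_stochastic_def)
qed

definition input_law :: "(int \<Rightarrow> real) measure" where "input_law = path_law M0 borel \<zeta>"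

lemma measure_gmap: "measure rho {n\<in>space rho. gmap z n i = j} = P (retract z) $ i $ j"
proof -
  interpret rho: prob_space rho by (rule prob_space_rho)
  have "trans_prob (retract z) i j = (\<integral>n. indicator {n\<in>space rho. gmap z n i = j} n \<partial>rho)"
    unfolding trans_prob_def
    by (rule Bochner_Integration.integral_cong) (auto simp: G_eq indicator_def)
  moreover have "{n\<in>space S. gmap z n i = j} \<inter> space S = {n\<in>space S. gmap z n i = j}" by auto
  ultimately show ?thesis by (simp add: trans_prob_retract)
qed

text \<open>The law of the input is taken unmodified, so its shift invariance is the assumed
  stationarity; the retraction enters through \<open>gmap\<close>.\<close>

sublocale sync_coupling rho gmap row_pmf \<delta> input_law m word target
proof (intro sync_coupling.intro coupling.intro sync_coupling_axioms.intro)
  interpret prob_space M0 by (rule M0)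
  interpret rho: prob_space rho by (rule prob_space_rho)
  have zp[measurable]: "(\<lambda>\<omega> t. \<zeta> t \<omega>) \<in> M0 \<rightarrow>\<^sub>M PiM UNIV (\<lambda>_. borel)"
    by (rule measurable_paths(2)) measurable
  show "prob_space rho" by (rule prob_space_rho)
  show "(\<lambda>(z, n). gmap z n i) \<in> borel \<Otimes>\<^sub>M rho \<rightarrow>\<^sub>M count_space UNIV" for i by (rule gmap_measurable)
  show "(1 - \<delta>) * pmf (row_pmf i) j \<le> measure rho {n \<in> space rho. gmap z n i = j}" for z i j
    unfolding pmf_row measure_gmap by (rule minor[OF retract_bound])
  show "prob_space input_law" unfolding input_law_def path_law_def by (rule prob_space_distr[OF zp])
  show "sets input_law = sets (PiM UNIV (\<lambda>_. borel))" by (simp add: input_law_def path_law_def)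
  show "distr input_law input_law (\<lambda>w t. w (t + k)) = input_law" for k
  proof -
    have sh: "(\<lambda>w t. w (t + k)) \<in> PiM UNIV (\<lambda>_. borel) \<rightarrow>\<^sub>M PiM UNIV (\<lambda>_. borel :: real measure)"
      by (rule measurable_paths(2)) measurable
    have "distr input_law input_law (\<lambda>w t. w (t + k)) = distr input_law (PiM UNIV (\<lambda>_. borel)) (\<lambda>w t. w (t + k))"
      by (rule distr_cong) (auto simp: input_law_def path_law_def)
    also have "\<dots> = path_law M0 borel (\<lambda>t. \<zeta> (t + k))"
      unfolding input_law_def path_law_def by (subst distr_distr[OF sh zp]) (simp add: comp_def)
    finally show ?thesis using stat by (simp add: stationary_def input_law_def)
  qed
qed (use delta01 wpos wsync in \<open>auto simp: pmf_row\<close>)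

end

section \<open>Transfer to the path space\<close>

lemma distr_pair_snd:
  assumes "prob_space A" "prob_space B"
  shows "distr (A \<Otimes>\<^sub>M B) B snd = B"
proof (rule measure_eqI)
  interpret A: prob_space A by fact
  interpret B: prob_space B by fact
  fix X assume "X \<in> sets (distr (A \<Otimes>\<^sub>M B) B snd)"
  then have X: "X \<in> sets B" by simp
  have "snd -` X \<inter> space (A \<Otimes>\<^sub>M B) = space A \<times> X"
    using sets.sets_into_space[OF X] by (auto simp: space_pair_measure)
  then show "emeasure (distr (A \<Otimes>\<^sub>M B) B snd) X = emeasure B X"
    using X by (simp add: emeasure_distr B.emeasure_pair_measure_Times A.emeasure_space_1)
qed simp

context construction
begin

definition pathsM :: "('n, 'd) paths measure" where
  "pathsM = PiM UNIV (\<lambda>_. borel \<Otimes>\<^sub>M S \<Otimes>\<^sub>M borel \<Otimes>\<^sub>M borel)"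

definition to_path :: "('n, 'd) seed_paths \<Rightarrow> ('n, 'd) paths" where
  "to_path \<omega> = (\<lambda>t. (retract (fst \<omega> t), noise t \<omega>, axis (state t \<omega>) 1, axis (state0 t \<omega>) 1))"

text \<open>The theorem prescribes the type of the path space, while \<open>\<Omega>\<close> carries
  maps, coins and candidates; hence the image measure.\<close>

definition M :: "('n, 'd) paths measure" where
  "M = distr \<Omega> pathsM to_path"

text \<open>The path space also contains paths whose last two components are not basis vectors.\<close>

definition to_basis :: "real^'d \<Rightarrow> real^'d" where
  "to_basis v = (if v \<in> range (\<lambda>j. axis j 1) then v else axis undefined 1)"

text \<open>Retracting again makes the bound on the input and the measurability of \<open>P\<close>
  along it hold on all paths; on the image of \<open>to_path\<close> it changes nothing.\<close>

definition zM :: "int \<Rightarrow> ('n, 'd) paths \<Rightarrow> real" where "zM t x = retract (fst (x t))"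
definition nM :: "int \<Rightarrow> ('n, 'd) paths \<Rightarrow> 'n" where "nM t x = fst (snd (x t))"
definition gM :: "int \<Rightarrow> ('n, 'd) paths \<Rightarrow> real^'d" where "gM t x = to_basis (fst (snd (snd (x t))))"
definition g0M :: "int \<Rightarrow> ('n, 'd) paths \<Rightarrow> real^'d" where "g0M t x = to_basis (snd (snd (snd (x t))))"

lemma to_path_coordinates[simp]:
  "zM t (to_path \<omega>) = retract (fst \<omega> t)" "nM t (to_path \<omega>) = noise t \<omega>"
  "gM t (to_path \<omega>) = axis (state t \<omega>) 1" "g0M t (to_path \<omega>) = axis (state0 t \<omega>) 1"
  by (simp_all add: zM_def nM_def gM_def g0M_def to_path_def to_basis_def)

lemma to_basis_measurable[measurable]: "to_basis \<in> borel_measurable borel"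
proof -
  have "finite (range (\<lambda>j :: 'd. axis j (1 :: real)))" by simp
  then have "range (\<lambda>j :: 'd. axis j (1 :: real)) \<in> sets borel"
    by (intro borel_closed finite_imp_closed)
  then show ?thesis unfolding to_basis_def[abs_def] by measurable
qed

lemma to_basis_axis: "\<exists>j. to_basis v = axis j 1"
  by (auto simp: to_basis_def)

lemma noise_measurable_S[measurable]: "noise t \<in> \<Omega> \<rightarrow>\<^sub>M S"
  using noise_measurable[of t] by (simp only: measurable_cong_sets[OF refl sets_rho])

lemma axis_measurable[measurable (raw)]:
  "f \<in> K \<rightarrow>\<^sub>M count_space UNIV \<Longrightarrow> (\<lambda>x. axis (f x) 1 :: real^'d) \<in> borel_measurable K"
  by (erule measurable_compose) simp

lemma to_path_measurable[measurable]: "to_path \<in> \<Omega> \<rightarrow>\<^sub>M pathsM"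
  unfolding to_path_def[abs_def] pathsM_def by (rule measurable_paths(2)) measurable

lemma sets_M[measurable_cong]: "sets M = sets pathsM"
  by (simp add: M_def)

lemma coordinate_measurable[measurable]:
  "zM t \<in> borel_measurable M" "nM t \<in> M \<rightarrow>\<^sub>M S" "gM t \<in> borel_measurable M" "g0M t \<in> borel_measurable M"
proof -
  have "(\<lambda>x. x t) \<in> M \<rightarrow>\<^sub>M borel \<Otimes>\<^sub>M S \<Otimes>\<^sub>M borel \<Otimes>\<^sub>M (borel :: (real^'d) measure)"
    unfolding measurable_cong_sets[OF sets_M refl] pathsM_def by measurable
  note [measurable] = this
  show "zM t \<in> borel_measurable M" "nM t \<in> M \<rightarrow>\<^sub>M S" "gM t \<in> borel_measurable M" "g0M t \<in> borel_measurable M"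
    unfolding zM_def[abs_def] nM_def[abs_def] gM_def[abs_def] g0M_def[abs_def] by measurable
qed

sublocale M: prob_space M
  unfolding M_def by (rule Omega.prob_space_distr) measurable

lemma prob_M:
  assumes "Measurable.pred M Q"
  shows "measure M {x\<in>space M. Q x} = measure \<Omega> {\<omega>\<in>space \<Omega>. Q (to_path \<omega>)}"
proof -
  have "{x\<in>space pathsM. Q x} \<in> sets pathsM"
    using assms sets_M by (simp add: pred_def M_def)
  then show ?thesis unfolding M_def
    using measurable_space[OF to_path_measurable]
    by (subst measure_distr) (auto intro!: arg_cong[where f = "measure \<Omega>"])
qed

lemma AE_M:
  assumes "Measurable.pred M Q" "AE \<omega> in \<Omega>. Q (to_path \<omega>)"
  shows "AE x in M. Q x"
proof -
  have "Measurable.pred pathsM Q" using assms(1) by (simp cong: measurable_cong_sets add: measurable_cong_sets[OF sets_M refl])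
  with assms(2) show ?thesis unfolding M_def by (intro AE_distr_of_pred) auto
qed

lemma integral_M:
  fixes f :: "_ \<Rightarrow> 'b::{banach, second_countable_topology}"
  assumes "f \<in> borel_measurable M"
  shows "(\<integral>x. f x \<partial>M) = (\<integral>\<omega>. f (to_path \<omega>) \<partial>\<Omega>)"
  unfolding M_def using assms by (intro integral_distr) (auto simp: measurable_cong_sets[OF sets_M refl])

lemma indep_rv_M:
  assumes X: "X \<in> M \<rightarrow>\<^sub>M A" and Y: "Y \<in> M \<rightarrow>\<^sub>M B"
    and ind: "indep_rv \<Omega> A (\<lambda>\<omega>. X (to_path \<omega>)) B (\<lambda>\<omega>. Y (to_path \<omega>))"
  shows "indep_rv M A X B Y"
proof (rule indep_rvI[OF M.prob_space_axioms X Y])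
  fix a b assume [measurable]: "a \<in> sets A" "b \<in> sets B"
  note [measurable] = X Y
  show "measure M {x\<in>space M. X x \<in> a \<and> Y x \<in> b} = measure M {x\<in>space M. X x \<in> a} * measure M {x\<in>space M. Y x \<in> b}"
    by (subst (1 2 3) prob_M) (auto intro: indep_rvD[OF prob_Omega ind])
qed

lemma distr_M:
  assumes "X \<in> M \<rightarrow>\<^sub>M A"
  shows "distr M A X = distr \<Omega> A (\<lambda>\<omega>. X (to_path \<omega>))"
  unfolding M_def using assms
  by (subst distr_distr) (auto simp: measurable_cong_sets[OF sets_M refl] comp_def)

lemma input_paths_measurable[measurable]: "(\<lambda>w t. retract (w t)) \<in> PiM UNIV (\<lambda>_. borel) \<rightarrow>\<^sub>M PiM UNIV (\<lambda>_. borel)"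
  by (rule measurable_paths(2)) measurable

lemma PiM_rho: "sets (PiM UNIV (\<lambda>_. rho)) = sets (PiM UNIV (\<lambda>_. S))"
  by (rule sets_PiM_cong) auto

lemma fst_Omega[measurable]: "fst \<in> \<Omega> \<rightarrow>\<^sub>M PiM UNIV (\<lambda>_. borel)"
proof -
  have "fst \<in> \<Omega> \<rightarrow>\<^sub>M input_law" unfolding \<Omega>_def by measurable
  then show ?thesis by (simp add: measurable_cong_sets[OF refl sets_Z])
qed

text \<open>Both sides are images of the product of the input law and the noise law, up to a
  retraction that acts trivially almost surely.\<close>

lemma path_law_M:
  "path_law M (borel \<Otimes>\<^sub>M S) (\<lambda>t x. (zM t x, nM t x)) = path_law M0 (borel \<Otimes>\<^sub>M S) (\<lambda>t \<omega>. (\<zeta> t \<omega>, N0 t \<omega>))"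
proof -
  let ?Pr = "PiM UNIV (\<lambda>_. borel) \<Otimes>\<^sub>M PiM UNIV (\<lambda>_. rho) :: ((int \<Rightarrow> real) \<times> (int \<Rightarrow> 'n)) measure"
  let ?PS = "PiM UNIV (\<lambda>_. borel \<Otimes>\<^sub>M S) :: (int \<Rightarrow> real \<times> 'n) measure"
  let ?f = "\<lambda>(w, n) t. (retract (w t), n t)"
  have f: "?f \<in> ?Pr \<rightarrow>\<^sub>M ?PS"
    unfolding split_beta' by (rule measurable_paths(2)) measurable
  have m0: "(\<lambda>\<omega>. (\<lambda>t. \<zeta> t \<omega>, \<lambda>t. N0 t \<omega>)) \<in> M0 \<rightarrow>\<^sub>M ?Pr"
    by (intro measurable_Pair measurable_paths(2)) (auto simp: measurable_cong_sets[OF refl sets_rho])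
  have m1: "(\<lambda>\<omega>. (fst \<omega>, \<lambda>t. noise t \<omega>)) \<in> \<Omega> \<rightarrow>\<^sub>M ?Pr"
    by (intro measurable_Pair measurable_paths(2) fst_Omega noise_measurable)
  have law: "distr \<Omega> ?Pr (\<lambda>\<omega>. (fst \<omega>, \<lambda>t. noise t \<omega>)) = distr M0 ?Pr (\<lambda>\<omega>. (\<lambda>t. \<zeta> t \<omega>, \<lambda>t. N0 t \<omega>))"
  proof -
    have "distr \<Omega> ?Pr (\<lambda>\<omega>. (fst \<omega>, \<lambda>t. noise t \<omega>)) = distr \<Omega> (input_law \<Otimes>\<^sub>M PiM UNIV (\<lambda>_. rho)) (\<lambda>\<omega>. (fst \<omega>, \<lambda>t. noise t \<omega>))"
      by (intro distr_cong sets_pair_measure_cong) (simp_all add: sets_Z)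
    also have "\<dots> = input_law \<Otimes>\<^sub>M PiM UNIV (\<lambda>_. rho)" by (rule distr_input_noise)
    also have "\<dots> = distr M0 ?Pr (\<lambda>\<omega>. (\<lambda>t. \<zeta> t \<omega>, \<lambda>t. N0 t \<omega>))"
      unfolding input_law_def by (rule iid_input_law[OF M0 iid_N0 ind_N0 zeta_measurable rho_def, symmetric])
    finally show ?thesis .
  qed
  have "path_law M (borel \<Otimes>\<^sub>M S) (\<lambda>t x. (zM t x, nM t x)) = distr \<Omega> ?PS (\<lambda>\<omega> t. (retract (fst \<omega> t), noise t \<omega>))"
    unfolding path_law_def by (subst distr_M) (auto intro!: measurable_paths(2))
  also have "\<dots> = distr (distr \<Omega> ?Pr (\<lambda>\<omega>. (fst \<omega>, \<lambda>t. noise t \<omega>))) ?PS ?f"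
    by (subst distr_distr[OF f m1]) (simp add: comp_def)
  also have "\<dots> = distr M0 ?PS (\<lambda>\<omega> t. (retract (\<zeta> t \<omega>), N0 t \<omega>))"
    unfolding law by (subst distr_distr[OF f m0]) (simp add: comp_def)
  also have "\<dots> = distr M0 ?PS (\<lambda>\<omega> t. (\<zeta> t \<omega>, N0 t \<omega>))"
  proof (rule distr_cong_AE)
    show "AE \<omega> in M0. (\<lambda>t. (retract (\<zeta> t \<omega>), N0 t \<omega>)) = (\<lambda>t. (\<zeta> t \<omega>, N0 t \<omega>))"
      using AE_admissible by eventually_elim (simp add: retract_eq)
  qed (auto intro!: measurable_paths(2))
  finally show ?thesis by (simp add: path_law_def)
qed

lemma noise_paths[measurable]: "(\<lambda>\<omega> t. noise t \<omega>) \<in> \<Omega> \<rightarrow>\<^sub>M PiM UNIV (\<lambda>_. S)"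
  by (rule measurable_paths(2)) measurable

lemma indep_noise_input: "indep_rv \<Omega> (PiM UNIV (\<lambda>_. S)) (\<lambda>\<omega> t. noise t \<omega>) (PiM UNIV (\<lambda>_. borel)) fst"
proof (rule indep_rv_swap[OF prob_Omega], rule indep_rv_of_distr[OF prob_Omega fst_Omega noise_paths])
  show "prob_space input_law" by (rule prob_Z)
  show "sets input_law = sets (PiM UNIV (\<lambda>_. borel))" by (rule sets_Z)
  show "prob_space (PiM (UNIV :: int set) (\<lambda>_. rho))" by (intro prob_space_PiM prob_space_rho)
  show "sets (PiM (UNIV :: int set) (\<lambda>_. rho)) = sets (PiM UNIV (\<lambda>_. S))" by (rule PiM_rho)
  have "distr \<Omega> (PiM UNIV (\<lambda>_. borel) \<Otimes>\<^sub>M PiM UNIV (\<lambda>_. S)) (\<lambda>\<omega>. (fst \<omega>, \<lambda>t. noise t \<omega>))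
      = distr \<Omega> (input_law \<Otimes>\<^sub>M PiM UNIV (\<lambda>_. rho)) (\<lambda>\<omega>. (fst \<omega>, \<lambda>t. noise t \<omega>))"
    by (intro distr_cong sets_pair_measure_cong) (simp_all add: sets_Z PiM_rho)
  then show "distr \<Omega> (PiM UNIV (\<lambda>_. borel) \<Otimes>\<^sub>M PiM UNIV (\<lambda>_. S)) (\<lambda>\<omega>. (fst \<omega>, \<lambda>t. noise t \<omega>))
      = input_law \<Otimes>\<^sub>M PiM UNIV (\<lambda>_. rho)"
    by (simp add: distr_input_noise)
qed

lemma distr_noise: "distr \<Omega> (PiM UNIV (\<lambda>_. rho)) (\<lambda>\<omega> t. noise t \<omega>) = PiM UNIV (\<lambda>_. rho)"
  "distr \<Omega> rho (noise t) = rho"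
proof -
  interpret R: prob_space "PiM (UNIV :: int set) (\<lambda>_. rho)" by (intro prob_space_PiM prob_space_rho)
  interpret PR: product_prob_space "\<lambda>_ :: int. rho" UNIV ..
  have m1: "(\<lambda>\<omega>. (fst \<omega>, \<lambda>t. noise t \<omega>)) \<in> \<Omega> \<rightarrow>\<^sub>M input_law \<Otimes>\<^sub>M PiM UNIV (\<lambda>_. rho)"
    by (intro measurable_Pair measurable_paths(2) noise_measurable) (simp add: measurable_cong_sets[OF refl sets_Z])
  show *: "distr \<Omega> (PiM UNIV (\<lambda>_. rho)) (\<lambda>\<omega> t. noise t \<omega>) = PiM UNIV (\<lambda>_. rho)"
  proof -
    have "PiM (UNIV :: int set) (\<lambda>_. rho) = distr (input_law \<Otimes>\<^sub>M PiM UNIV (\<lambda>_. rho)) (PiM UNIV (\<lambda>_. rho)) snd"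
      by (rule distr_pair_snd[OF prob_Z R.prob_space_axioms, symmetric])
    also have "\<dots> = distr (distr \<Omega> (input_law \<Otimes>\<^sub>M PiM UNIV (\<lambda>_. rho)) (\<lambda>\<omega>. (fst \<omega>, \<lambda>t. noise t \<omega>))) (PiM UNIV (\<lambda>_. rho)) snd"
      by (simp only: distr_input_noise)
    also have "\<dots> = distr \<Omega> (PiM UNIV (\<lambda>_. rho)) (\<lambda>\<omega> t. noise t \<omega>)"
      by (subst distr_distr[OF _ m1]) (simp_all add: comp_def)
    finally show ?thesis ..
  qed
  have "distr \<Omega> rho (noise t) = distr (distr \<Omega> (PiM UNIV (\<lambda>_. rho)) (\<lambda>\<omega> t. noise t \<omega>)) rho (\<lambda>n. n t)"
    by (subst distr_distr) (auto simp: comp_def intro!: measurable_paths(2) noise_measurable)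
  also have "\<dots> = rho" unfolding * by (rule PR.PiM_component) simp
  finally show "distr \<Omega> rho (noise t) = rho" .
qed

lemma distr_nM: "distr M S (nM t) = rho"
proof -
  have "distr M S (nM t) = distr \<Omega> S (noise t)" by (subst distr_M) simp_all
  also have "\<dots> = distr \<Omega> rho (noise t)" by (rule distr_cong) simp_all
  finally show ?thesis by (simp add: distr_noise)
qed

section \<open>Verification of the required properties on the path space\<close>

lemma input_and_noise_M: "input_and_noise M S P \<G> zM nM"
  unfolding input_and_noise_def
proof (intro conjI allI)
  show "zM t \<in> borel_measurable M" for t by measurable
  show "iid M S nM"
    unfolding iid_def
  proof (intro conjI allI)
    have "distr M (PiM UNIV (\<lambda>_. S)) (\<lambda>x t. nM t x) = distr \<Omega> (PiM UNIV (\<lambda>_. S)) (\<lambda>\<omega> t. noise t \<omega>)"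
      by (subst distr_M) (auto intro!: measurable_paths(2))
    also have "\<dots> = distr \<Omega> (PiM UNIV (\<lambda>_. rho)) (\<lambda>\<omega> t. noise t \<omega>)"
      by (rule distr_cong) (simp_all add: PiM_rho)
    finally have "distr M (PiM UNIV (\<lambda>_. S)) (\<lambda>x t. nM t x) = PiM UNIV (\<lambda>t. distr M S (nM t))"
      by (simp add: distr_noise distr_nM)
    then show "M.indep_vars (\<lambda>_. S) nM UNIV"
      by (subst M.indep_vars_iff_distr_eq_PiM') (simp_all add: restrict_def)
    show "distr M S (nM s) = distr M S (nM t)" for s t by (simp add: distr_nM)
  qed
  show ind: "indep_processes M S nM borel zM"
    unfolding indep_processes_def
  proof (rule indep_rv_M)
    have "indep_rv \<Omega> (PiM UNIV (\<lambda>_. S)) (\<lambda>\<omega> t. noise t \<omega>) (PiM UNIV (\<lambda>_. borel)) (\<lambda>\<omega> t. retract (fst \<omega> t))"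
      using indep_rv_compose[OF prob_Omega indep_noise_input measurable_ident input_paths_measurable] by simp
    then show "indep_rv \<Omega> (PiM UNIV (\<lambda>_. S)) (\<lambda>\<omega> t. nM t (to_path \<omega>)) (PiM UNIV (\<lambda>_. borel)) (\<lambda>\<omega> t. zM t (to_path \<omega>))"
      by simp
  qed (rule measurable_paths(2), measurable)+
  fix t i j
  have "AE x in M. real_cond_exp M (sigma_of M borel UNIV zM) (\<lambda>x. \<G> (zM t x) (nM (t + 1) x) $ i $ j) x
      = (\<integral>n. \<G> (zM t x) n $ i $ j \<partial>distr M S (nM (t + 1)))"
  proof (rule real_cond_exp_independent_noise[OF M.prob_space_axioms _ ind])
    show "(\<lambda>(z, n). \<G> z n $ i $ j) \<in> borel_measurable (borel \<Otimes>\<^sub>M S)"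
      unfolding split_beta' by measurable
    show "n \<in> space S \<Longrightarrow> \<bar>\<G> z n $ i $ j\<bar> \<le> 1" for z n using G_row(1)[of n z i j] by auto
  qed measurable
  \<comment> \<open>This holds everywhere, because \<open>zM\<close> takes admissible values
    only.\<close>
  moreover have "(\<integral>n. \<G> (zM t x) n $ i $ j \<partial>distr M S (nM (t + 1))) = P (zM t x) $ i $ j" for x
    using trans_prob_retract[of "fst (x t)" i j] by (simp add: distr_nM trans_prob_def zM_def)
  ultimately show "AE x in M. real_cond_exp M (sigma_of M borel UNIV zM) (\<lambda>x. \<G> (zM t x) (nM (t + 1) x) $ i $ j) x
      = P (zM t x) $ i $ j" by simp
qed

lemma basis_process_M: "basis_process M gM" "basis_process M g0M"
  using to_basis_axis by (auto simp: basis_process_def gM_def g0M_def)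

lemma controlled_process_M: "controlled_process M S P \<G> zM nM gM"
  unfolding controlled_process_def
proof (intro conjI allI input_and_noise_M basis_process_M)
  fix t
  have G[measurable]: "(\<lambda>x. \<G> (zM t x) (nM (t + 1) x)) \<in> borel_measurable M" by (rule G_entry_measurable) measurable
  have "Measurable.pred M (\<lambda>x. gM (t + 1) x - gM t x v* \<G> (zM t x) (nM (t + 1) x) = 0)"
    by measurable
  then have pr: "Measurable.pred M (\<lambda>x. gM (t + 1) x = gM t x v* \<G> (zM t x) (nM (t + 1) x))" by simp
  show "AE x in M. gM (t + 1) x = gM t x v* \<G> (zM t x) (nM (t + 1) x)"
  proof (rule AE_M[OF pr])
    show "AE \<omega> in \<Omega>. gM (t + 1) (to_path \<omega>) = gM t (to_path \<omega>) v* \<G> (zM t (to_path \<omega>)) (nM (t + 1) (to_path \<omega>))"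
      using AE_state_step[of t] AE_space
    proof eventually_elim
      fix \<omega> assume "state (t + 1) \<omega> = gmap (fst \<omega> t) (noise (t + 1) \<omega>) (state t \<omega>)" and "\<omega> \<in> space \<Omega>"
      moreover from this(2) have "noise (t + 1) \<omega> \<in> space S" by (rule measurable_space[OF noise_measurable_S])
      ultimately show "gM (t + 1) (to_path \<omega>) = gM t (to_path \<omega>) v* \<G> (zM t (to_path \<omega>)) (nM (t + 1) (to_path \<omega>))"
        by (simp add: axis_vector_matrix G_row_eq)
    qed
  qed
  let ?T = "PiM UNIV (\<lambda>_. borel) \<Otimes>\<^sub>M PiM {..t} (\<lambda>_. S \<Otimes>\<^sub>M borel)
    :: ((int \<Rightarrow> real) \<times> (int \<Rightarrow> 'n \<times> (real^'d))) measure"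
  let ?Y = "\<lambda>x. (\<lambda>s. zM s x, restrict (\<lambda>s. (nM s x, gM s x)) {..t})"
  have Y: "?Y \<in> M \<rightarrow>\<^sub>M ?T"
    by (intro measurable_Pair measurable_paths) measurable
  show "indep_rv M S (nM (t + 1)) ?T ?Y"
  proof (rule indep_rv_M[OF _ Y])
    show "nM (t + 1) \<in> M \<rightarrow>\<^sub>M S" by measurable
    show "indep_rv \<Omega> S (\<lambda>\<omega>. nM (t + 1) (to_path \<omega>)) ?T (\<lambda>\<omega>. ?Y (to_path \<omega>))"
    proof (rule indep_rv_swap[OF prob_Omega], rule indep_rvI[OF prob_Omega])
      show YT[measurable]: "(\<lambda>\<omega>. ?Y (to_path \<omega>)) \<in> \<Omega> \<rightarrow>\<^sub>M ?T"
        by (rule measurable_compose[OF to_path_measurable Y[unfolded measurable_cong_sets[OF sets_M refl]]])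
      show "(\<lambda>\<omega>. nM (t + 1) (to_path \<omega>)) \<in> \<Omega> \<rightarrow>\<^sub>M S" by simp
      fix A B assume [measurable]: "A \<in> sets ?T" and B: "B \<in> sets S"
      \<comment> \<open>The whole input path is allowed here, as \<open>past\<close> restricts only
        the dependence on the seeds.\<close>
      have p: "past t (\<lambda>\<omega>. ?Y (to_path \<omega>))"
        unfolding past_def
      proof (intro allI impI)
        fix w and X X' :: "int \<Rightarrow> (('d \<Rightarrow> 'd) \<times> bool) \<times> ('n \<times> real) stream"
        assume eq: "\<forall>s<t. X s = X' s"
        have "noise s (w, X) = noise s (w, X')" "state s (w, X) = state s (w, X')" if "s \<le> t" for s
          using eq that by (auto intro!: pastD[OF past_noise[of s t]] pastD[OF past_state[of s t]])
        then show "?Y (to_path (w, X)) = ?Y (to_path (w, X'))" by (auto simp: fun_eq_iff)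
      qed
      have Q: "Measurable.pred \<Omega> (\<lambda>\<omega>. ?Y (to_path \<omega>) \<in> A)" by measurable
      have "measure \<Omega> {\<omega>\<in>space \<Omega>. ?Y (to_path \<omega>) \<in> A \<and> noise (t + 1) \<omega> \<in> B}
          = measure \<Omega> {\<omega>\<in>space \<Omega>. ?Y (to_path \<omega>) \<in> A} * measure rho B"
        using past_comp[OF p, of "\<lambda>_ y. y \<in> A"] B by (intro prob_noise[OF Q]) simp_all
      moreover have "measure \<Omega> {\<omega>\<in>space \<Omega>. True \<and> noise (t + 1) \<omega> \<in> B} = measure \<Omega> {\<omega>\<in>space \<Omega>. True} * measure rho B"
        using B by (intro prob_noise) (simp_all add: past_def)
      ultimately show "measure \<Omega> {\<omega>\<in>space \<Omega>. ?Y (to_path \<omega>) \<in> A \<and> nM (t + 1) (to_path \<omega>) \<in> B}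
          = measure \<Omega> {\<omega>\<in>space \<Omega>. ?Y (to_path \<omega>) \<in> A} * measure \<Omega> {\<omega>\<in>space \<Omega>. nM (t + 1) (to_path \<omega>) \<in> B}"
        by (simp add: Omega.prob_space)
    qed
  qed
qed

lemma markov_chain_M: "markov_chain M (P 0) g0M"
proof (rule markov_chainI[OF M.prob_space_axioms basis_process_M(2)])
  fix t k and B :: "(int \<Rightarrow> real^'d) set"
  assume B[measurable]: "B \<in> sets (PiM {..t} (\<lambda>_. borel))"
  have rm[measurable]: "(\<lambda>x. restrict (\<lambda>s. g0M s x) {..t}) \<in> M \<rightarrow>\<^sub>M PiM {..t} (\<lambda>_. borel)"
    by (rule measurable_paths(1)) measurable
  have rO[measurable]: "(\<lambda>\<omega>. restrict (\<lambda>s. axis (state0 s \<omega>) 1 :: real^'d) {..t}) \<in> \<Omega> \<rightarrow>\<^sub>M PiM {..t} (\<lambda>_. borel)"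
    by (rule measurable_paths(1)) measurable
  let ?Q = "\<lambda>\<omega>. restrict (\<lambda>s. axis (state0 s \<omega>) 1) {..t} \<in> B"
  have Q: "Measurable.pred \<Omega> ?Q" by measurable
  have pQ: "past t ?Q"
    unfolding past_def
  proof (intro allI impI)
    fix w and X X' :: "int \<Rightarrow> (('d \<Rightarrow> 'd) \<times> bool) \<times> ('n \<times> real) stream"
    assume eq: "\<forall>s<t. X s = X' s"
    have "state0 s (w, X) = state0 s (w, X')" if "s \<le> t" for s
      using eq that by (auto intro!: pastD[OF past_state0[of s t]])
    then have "restrict (\<lambda>s. axis (state0 s (w, X)) (1::real)) {..t} = restrict (\<lambda>s. axis (state0 s (w, X')) 1) {..t}"
      by (auto simp: fun_eq_iff)
    then show "?Q (w, X) = ?Q (w, X')" by simp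
  qed
  have "measure M {x\<in>space M. restrict (\<lambda>s. g0M s x) {..t} \<in> B \<and> g0M (t + 1) x = axis k 1}
      = measure \<Omega> {\<omega>\<in>space \<Omega>. ?Q \<omega> \<and> state0 (t + 1) \<omega> = k}"
    by (subst prob_M) (auto simp: axis_eq_axis)
  also have "\<dots> = (\<integral>\<omega>. indicator {\<omega>. ?Q \<omega>} \<omega> * pmf (row_pmf (state0 t \<omega>)) k \<partial>\<Omega>)"
    by (rule prob_state0_step[OF Q pQ])
  also have "\<dots> = (\<integral>x. indicator B (restrict (\<lambda>s. g0M s x) {..t}) * (g0M t x v* P 0) $ k \<partial>M)"
    by (subst integral_M) (auto simp: axis_vector_matrix pmf_row indicator_def intro!: Bochner_Integration.integral_cong)
  finally show "measure M {x\<in>space M. restrict (\<lambda>s. g0M s x) {..t} \<in> B \<and> g0M (t + 1) x = axis k 1}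
      = (\<integral>x. indicator B (restrict (\<lambda>s. g0M s x) {..t}) * (g0M t x v* P 0) $ k \<partial>M)" .
qed

lemma stationary_M: "stationary M (borel \<Otimes>\<^sub>M borel \<Otimes>\<^sub>M borel) (\<lambda>t x. (gM t x, g0M t x, zM t x))"
  unfolding stationary_def
proof (intro conjI allI)
  show "(\<lambda>x. (gM t x, g0M t x, zM t x)) \<in> M \<rightarrow>\<^sub>M borel \<Otimes>\<^sub>M borel \<Otimes>\<^sub>M borel" for t by measurable
  fix k
  let ?B = "PiM UNIV (\<lambda>_. borel \<Otimes>\<^sub>M borel \<Otimes>\<^sub>M borel) :: (int \<Rightarrow> (real^'d) \<times> (real^'d) \<times> real) measure"
  let ?Y = "\<lambda>t \<omega>. (axis (state t \<omega>) 1, axis (state0 t \<omega>) 1, retract (fst \<omega> t)) :: (real^'d) \<times> (real^'d) \<times> real"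
  have Y: "(\<lambda>\<omega> t. ?Y (t + k) \<omega>) \<in> \<Omega> \<rightarrow>\<^sub>M ?B" for k by (rule measurable_paths(2)) measurable
  have pl: "path_law M (borel \<Otimes>\<^sub>M borel \<Otimes>\<^sub>M borel) (\<lambda>t x. (gM (t + k) x, g0M (t + k) x, zM (t + k) x))
      = distr \<Omega> ?B (\<lambda>\<omega> t. ?Y (t + k) \<omega>)" for k
    unfolding path_law_def by (subst distr_M) (auto intro!: measurable_paths(2))
  have "distr \<Omega> ?B (\<lambda>\<omega> t. ?Y (t + k) \<omega>) = distr \<Omega> ?B (\<lambda>\<omega>. (\<lambda>t. ?Y t (shift k \<omega>)))"
    unfolding state_shift state0_shift by (simp add: shift_def)
  also have "\<dots> = distr (distr \<Omega> \<Omega> (shift k)) ?B (\<lambda>\<omega> t. ?Y t \<omega>)"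
    using Y[of 0] by (subst distr_distr) (auto simp: comp_def)
  finally show "path_law M (borel \<Otimes>\<^sub>M borel \<Otimes>\<^sub>M borel) (\<lambda>t x. (gM (t + k) x, g0M (t + k) x, zM (t + k) x))
      = path_law M (borel \<Otimes>\<^sub>M borel \<Otimes>\<^sub>M borel) (\<lambda>t x. (gM t x, g0M t x, zM t x))"
    using pl[of k] pl[of 0] by (simp add: distr_shift)
qed

lemma indep_processes_M: "indep_processes M borel g0M borel zM"
  unfolding indep_processes_def
proof (rule indep_rv_M)
  show "indep_rv \<Omega> (PiM UNIV (\<lambda>_. borel)) (\<lambda>\<omega> t. g0M t (to_path \<omega>)) (PiM UNIV (\<lambda>_. borel)) (\<lambda>\<omega> t. zM t (to_path \<omega>))"
  proof (rule indep_rv_swap[OF prob_Omega], rule indep_rvI[OF prob_Omega], simp_all only: to_path_coordinates)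
    show "(\<lambda>\<omega> t. retract (fst \<omega> t)) \<in> \<Omega> \<rightarrow>\<^sub>M PiM UNIV (\<lambda>_. borel)" by (rule measurable_paths(2)) measurable
    show "(\<lambda>\<omega> t. axis (state0 t \<omega>) 1 :: real^'d) \<in> \<Omega> \<rightarrow>\<^sub>M PiM UNIV (\<lambda>_. borel)" by (rule measurable_paths(2)) measurable
    fix A :: "(int \<Rightarrow> real) set" and B :: "(int \<Rightarrow> real^'d) set"
    assume [measurable]: "A \<in> sets (PiM UNIV (\<lambda>_. borel))" "B \<in> sets (PiM UNIV (\<lambda>_. borel))"
    have [measurable]: "(\<lambda>w t. retract (w t)) \<in> input_law \<rightarrow>\<^sub>M PiM UNIV (\<lambda>_. borel)"
      unfolding measurable_cong_sets[OF sets_Z refl] by measurable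
    have [measurable]: "(\<lambda>X t. axis (state0 t (w, X)) 1 :: real^'d) \<in> seeds \<rightarrow>\<^sub>M PiM UNIV (\<lambda>_. borel)" for w
      by (rule measurable_paths(2)) measurable
    show "measure \<Omega> {\<omega>\<in>space \<Omega>. (\<lambda>t. retract (fst \<omega> t)) \<in> A \<and> (\<lambda>t. axis (state0 t \<omega>) 1) \<in> B}
        = measure \<Omega> {\<omega>\<in>space \<Omega>. (\<lambda>t. retract (fst \<omega> t)) \<in> A} * measure \<Omega> {\<omega>\<in>space \<Omega>. (\<lambda>t. axis (state0 t \<omega>) 1) \<in> B}"
      by (rule prob_input_state0[of "\<lambda>w. (\<lambda>t. retract (w t)) \<in> A" "\<lambda>g. (\<lambda>t. axis (g t) 1) \<in> B"]) measurable
  qed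
qed (rule measurable_paths(2), measurable)+

end

section \<open>Estimates\<close>

lemma L1_close_mono: "L1_close M Y Z b \<Longrightarrow> b \<le> b' \<Longrightarrow> L1_close M Y Z b'"
  by (auto simp: L1_close_def)

context construction
begin

definition gap :: "int \<Rightarrow> ('n, 'd) paths \<Rightarrow> real" where
  "gap t x = norm (gM t x - g0M t x)"

text \<open>The factor 2 bounds the distance of two unit vectors; the other factor is the bound of
  \<open>prob_neq\<close>.\<close>

definition \<kappa> :: real where "\<kappa> = 2 * (real m * \<delta> / word_prob)"

lemma norm_gM: "norm (gM t x) = 1" "norm (g0M t x) = 1"
  using to_basis_axis by (metis gM_def norm_axis_1) (use to_basis_axis in \<open>metis g0M_def norm_axis_1\<close>)

lemma gap_le_2: "gap t x \<le> 2"
  unfolding gap_def using norm_triangle_ineq4[of "gM t x" "g0M t x"] by (simp add: norm_gM)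

lemma gap_nonneg: "0 \<le> gap t x"
  by (simp add: gap_def)

lemma gap_measurable[measurable]: "gap t \<in> borel_measurable M"
  unfolding gap_def[abs_def] by measurable

lemma integrable_gap: "integrable M (gap t)"
  using gap_le_2 by (intro M.integrable_const_bound[of _ 2]) (auto simp: gap_def)

lemma integral_gap: "(\<integral>x. gap t x \<partial>M) \<le> \<kappa>"
proof -
  have neq: "{\<omega>\<in>space \<Omega>. state t \<omega> \<noteq> state0 t \<omega>} \<in> sets \<Omega>"
  proof -
    have "{\<omega>\<in>space \<Omega>. \<not> (\<exists>j. state t \<omega> = j \<and> state0 t \<omega> = j)} \<in> sets \<Omega>" by measurable
    then show ?thesis by (simp add: eq_commute)
  qed
  have "(\<integral>x. gap t x \<partial>M) = (\<integral>\<omega>. gap t (to_path \<omega>) \<partial>\<Omega>)" by (rule integral_M) measurable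
  also have "\<dots> \<le> (\<integral>\<omega>. 2 * indicator {\<omega>\<in>space \<Omega>. state t \<omega> \<noteq> state0 t \<omega>} \<omega> \<partial>\<Omega>)"
  proof (rule integral_mono)
    have "(\<lambda>\<omega>. gap t (to_path \<omega>)) \<in> borel_measurable \<Omega>"
      using gap_measurable[of t] by (intro measurable_compose[OF to_path_measurable]) (simp add: measurable_cong_sets[OF sets_M refl])
    then show "integrable \<Omega> (\<lambda>\<omega>. gap t (to_path \<omega>))"
      by (intro Omega.integrable_const_bound[of _ 2] AE_I2) (simp_all add: gap_le_2 gap_nonneg)
    show "integrable \<Omega> (\<lambda>\<omega>. 2 * indicator {\<omega>\<in>space \<Omega>. state t \<omega> \<noteq> state0 t \<omega>} \<omega> :: real)"
      using neq by (simp add: Omega.emeasure_eq_measure)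
    show "gap t (to_path \<omega>) \<le> 2 * indicator {\<omega>\<in>space \<Omega>. state t \<omega> \<noteq> state0 t \<omega>} \<omega>" if "\<omega> \<in> space \<Omega>" for \<omega>
      using that gap_le_2[of t "to_path \<omega>"] by (auto simp: indicator_def gap_def)
  qed
  also have "\<dots> = 2 * measure \<Omega> {\<omega>\<in>space \<Omega>. state t \<omega> \<noteq> state0 t \<omega>}" using neq by simp
  also have "\<dots> \<le> \<kappa>" using prob_neq[of t] by (simp add: \<kappa>_def)
  finally show ?thesis .
qed

lemma L1_closeI_gap:
  assumes "Y \<in> borel_measurable M" "Y' \<in> borel_measurable M" and c: "0 \<le> c" "0 \<le> c'"
    and le: "\<And>x. norm (Y x - Y' x) \<le> c * gap t x + c' * gap s x + c''"
  shows "L1_close M Y Y' (c * \<kappa> + c' * \<kappa> + c'')"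
proof -
  have int: "integrable M (\<lambda>x. c * gap t x + c' * gap s x + c'')"
    using integrable_gap by (intro Bochner_Integration.integrable_add) auto
  have m: "(\<lambda>x. Y x - Y' x) \<in> borel_measurable M" using assms by measurable
  have iY: "integrable M (\<lambda>x. Y x - Y' x)"
    by (rule Bochner_Integration.integrable_bound[OF int m])
       (use le in \<open>auto intro: order_trans[OF le abs_ge_self]\<close>)
  have "(\<integral>x. norm (Y x - Y' x) \<partial>M) \<le> (\<integral>x. c * gap t x + c' * gap s x + c'' \<partial>M)"
    using iY int le by (intro integral_mono) auto
  also have "\<dots> = c * (\<integral>x. gap t x \<partial>M) + c' * (\<integral>x. gap s x \<partial>M) + c''"
    using integrable_gap by (simp add: M.prob_space)
  also have "\<dots> \<le> c * \<kappa> + c' * \<kappa> + c''"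
    using integral_gap c by (intro add_mono mult_left_mono) auto
  finally show ?thesis using iY by (simp add: L1_close_def)
qed

lemma row_norm_sum_nonneg: "0 \<le> row_norm_sum A"
  by (simp add: row_norm_sum_def sum_nonneg)

lemma close_state: "L1_close M (gM t) (g0M t) \<kappa>"
  using L1_closeI_gap[of "gM t" "g0M t" 1 0 t 0 0] by (simp add: gap_def)

lemma close_B: "L1_close M (B_process P gM t) (B_process P g0M t) (row_norm_sum (deriv1 P 0) * \<kappa>)"
proof -
  have "L1_close M (B_process P gM t) (B_process P g0M t) (row_norm_sum (deriv1 P 0) * \<kappa> + 0 * \<kappa> + 0)"
  proof (rule L1_closeI_gap)
    show "norm (B_process P gM t x - B_process P g0M t x) \<le> row_norm_sum (deriv1 P 0) * gap t x + 0 * gap t x + 0" for x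
      using norm_vector_matrix[of "gM t x - g0M t x" "deriv1 P 0"]
      by (simp add: B_process_def vector_matrix_diff gap_def)
  qed (auto simp: B_process_def[abs_def] row_norm_sum_nonneg)
  then show ?thesis by simp
qed

lemma close_V: "L1_close M (V_process P gM t) (V_process P g0M t) (row_norm_sum (deriv2 P 0) * \<kappa>)"
proof -
  have "L1_close M (V_process P gM t) (V_process P g0M t) (row_norm_sum (deriv2 P 0) * \<kappa> + 0 * \<kappa> + 0)"
  proof (rule L1_closeI_gap)
    fix x
    have "norm (V_process P gM t x - V_process P g0M t x) = norm ((gM t x - g0M t x) v* deriv2 P 0) / 2"
      by (simp add: V_process_def vector_matrix_diff scaleR_diff_right[symmetric])
    also have "\<dots> \<le> norm ((gM t x - g0M t x) v* deriv2 P 0)" by simp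
    also have "\<dots> \<le> row_norm_sum (deriv2 P 0) * gap t x"
      unfolding gap_def by (rule norm_vector_matrix)
    finally show "norm (V_process P gM t x - V_process P g0M t x) \<le> row_norm_sum (deriv2 P 0) * gap t x + 0 * gap t x + 0"
      by simp
  qed (auto simp: V_process_def[abs_def] row_norm_sum_nonneg)
  then show ?thesis by simp
qed

text \<open>The difference splits into the gap at \<open>t\<close>, the gap at \<open>t - 1\<close>
  multiplied by \<open>P 0\<close>, and a row of \<open>P (zM (t - 1) x) - P 0\<close>, whose norm
  is at most \<open>L\<close>.\<close>

lemma close_Delta:
  "L1_close M (Delta_process P zM gM t) (Delta_process P (\<lambda>_ _. 0) g0M t) (\<kappa> + row_norm_sum (P 0) * \<kappa> + L)"
proof -
  \<comment> \<open>\<open>P\<close> is known to be measurable only after the retraction, so the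
    input is exhibited as retracted.\<close>
  have zeq: "zM s x = retract (zM s x)" for s x by (simp add: zM_def)
  have Pm: "(\<lambda>x. P (zM s x)) \<in> borel_measurable M" for s
    by (subst zeq) measurable
  have "L1_close M (Delta_process P zM gM t) (Delta_process P (\<lambda>_ _. 0) g0M t) (1 * \<kappa> + row_norm_sum (P 0) * \<kappa> + L)"
  proof (rule L1_closeI_gap)
    fix x
    let ?s = "t - 1"
    obtain j where j: "gM ?s x = axis j 1" using to_basis_axis by (auto simp: gM_def)
    have "Delta_process P zM gM t x - Delta_process P (\<lambda>_ _. 0) g0M t x
       = (gM t x - g0M t x) - (gM ?s x - g0M ?s x) v* P 0 - (P (zM ?s x) - P 0) $ j"
      by (simp add: Delta_process_def vector_matrix_diff j axis_vector_matrix)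
    also have "norm \<dots> \<le> norm (gM t x - g0M t x) + norm ((gM ?s x - g0M ?s x) v* P 0) + norm ((P (zM ?s x) - P 0) $ j)"
      by (intro order_trans[OF norm_triangle_ineq4] add_right_mono norm_triangle_ineq4)
    also have "\<dots> \<le> gap t x + row_norm_sum (P 0) * gap ?s x + norm (P (zM ?s x) - P 0)"
      unfolding gap_def by (intro add_mono norm_vector_matrix order_refl Finite_Cartesian_Product.norm_nth_le)
    also have "norm (P (zM ?s x) - P 0) \<le> L"
      by (rule lip) (simp add: zM_def retract_bound)
    finally show "norm (Delta_process P zM gM t x - Delta_process P (\<lambda>_ _. 0) g0M t x)
        \<le> 1 * gap t x + row_norm_sum (P 0) * gap ?s x + L" by simp
  next
    note [measurable] = Pm
    show "Delta_process P zM gM t \<in> borel_measurable M" "Delta_process P (\<lambda>_ _. 0) g0M t \<in> borel_measurable M"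
      unfolding Delta_process_def[abs_def] by measurable
  qed (auto simp: row_norm_sum_nonneg)
  then show ?thesis by simp
qed

lemma integral_retract_input: "(\<integral>w. retract (w t) \<partial>input_law) = 0"
proof -
  have "(\<integral>w. retract (w t) \<partial>input_law) = (\<integral>\<omega>. retract (\<zeta> t \<omega>) \<partial>M0)"
    unfolding input_law_def path_law_def
    by (rule integral_distr[OF measurable_paths(2)]) measurable
  also have "\<dots> = (\<integral>\<omega>. \<zeta> t \<omega> \<partial>M0)"
    by (rule integral_cong_AE) (use AE_admissible in \<open>auto simp: retract_eq\<close>)
  finally show ?thesis by (simp add: mean)
qed

lemma integral_input_state: "norm (\<integral>x. zM t x *\<^sub>R gM t x \<partial>M) \<le> e * \<kappa>"
proof -
  have zb: "\<bar>zM t x\<bar> \<le> e" for x by (simp add: zM_def retract_bound)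
  have int: "integrable M (\<lambda>x. zM t x *\<^sub>R gM t x)" "integrable M (\<lambda>x. zM t x *\<^sub>R g0M t x)"
    using zb by (auto intro!: M.integrable_const_bound[of _ e] simp: norm_gM)
  \<comment> \<open>The second chain is independent of the centred input, so this term vanishes and
    may be subtracted; the rest is at most \<open>e * gap t x\<close>.\<close>
  have "(\<integral>x. zM t x *\<^sub>R g0M t x \<partial>M) = (\<integral>\<omega>. retract (fst \<omega> t) *\<^sub>R axis (state0 t \<omega>) 1 \<partial>\<Omega>)"
    by (subst integral_M) auto
  also have "\<dots> = 0"
    by (rule integral_input_state0[of "\<lambda>w. retract (w t)" e]) (auto simp: retract_bound integral_retract_input)
  finally have "(\<integral>x. zM t x *\<^sub>R gM t x \<partial>M) = (\<integral>x. zM t x *\<^sub>R gM t x - zM t x *\<^sub>R g0M t x \<partial>M)"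
    using int by simp
  also have "norm \<dots> \<le> (\<integral>x. norm (zM t x *\<^sub>R gM t x - zM t x *\<^sub>R g0M t x) \<partial>M)"
    by (rule integral_norm_bound)
  also have "\<dots> \<le> (\<integral>x. e * gap t x \<partial>M)"
  proof (rule integral_mono)
    show "integrable M (\<lambda>x. e * gap t x)" using integrable_gap by simp
    show "norm (zM t x *\<^sub>R gM t x - zM t x *\<^sub>R g0M t x) \<le> e * gap t x" for x
      using mult_right_mono[OF zb, of "gap t x" x] by (simp add: gap_def scaleR_diff_right[symmetric])
  qed (use int in auto)
  also have "\<dots> \<le> e * \<kappa>" using integral_gap[of t] e by (simp add: mult_left_mono)
  finally show ?thesis .
qed

end

section \<open>Bounds on the transition matrix near 0 and the choice of constants\<close>

text \<open>\<open>K\<close> bounds the derivative at 0 and the additional 1 the remainder;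
  continuity on the closed interval comes from differentiability near 0.\<close>

lemma A1_local_bounds:
  fixes P :: "real \<Rightarrow> real^'d^'d"
  assumes "assumption_A1 P"
  obtains L r where "0 < L" "0 < r" "continuous_on {-r..r} P" "\<And>z. \<bar>z\<bar> \<le> r \<Longrightarrow> norm (P z - P 0) \<le> L * \<bar>z\<bar>"
proof -
  obtain \<delta> where \<delta>: "0 < \<delta>" and diff: "\<And>z. z \<in> ball 0 \<delta> \<Longrightarrow> P differentiable (at z)"
    using assms by (auto simp: assumption_A1_def)
  have "P differentiable (at 0)" using \<delta> by (intro diff) simp
  then obtain P' where P': "(P has_derivative P') (at 0)" by (auto simp: differentiable_def)
  then obtain K where K: "0 < K" "\<And>z. norm (P' z) \<le> norm z * K"
    using bounded_linear.pos_bounded[OF has_derivative_bounded_linear] by blast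
  have *: "\<forall>e>0. \<exists>d>0. \<forall>y. norm (y - 0) < d \<longrightarrow> norm (P y - P 0 - P' (y - 0)) \<le> e * norm (y - 0)"
    using P' unfolding has_derivative_at_alt by blast
  then obtain d where d: "0 < d" "\<And>y. \<bar>y\<bar> < d \<Longrightarrow> norm (P y - P 0 - P' y) \<le> \<bar>y\<bar>"
    using *[rule_format, of 1] by auto
  \<comment> \<open>Halving keeps the closed interval inside both open neighborhoods.\<close>
  define r where "r = min (d / 2) (\<delta> / 2)"
  show thesis
  proof (rule that[of "K + 1" r])
    show "0 < K + 1" "0 < r" using K d \<delta> by (auto simp: r_def)
    show "continuous_on {-r..r} P"
    proof (rule continuous_at_imp_continuous_on, rule ballI)
      fix z assume "z \<in> {-r..r}"
      then have "z \<in> ball 0 \<delta>" using \<delta> by (auto simp: r_def)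
      then show "isCont P z" by (intro differentiable_imp_continuous_within diff)
    qed
    fix z :: real assume "\<bar>z\<bar> \<le> r"
    then have "\<bar>z\<bar> < d" using d by (auto simp: r_def)
    then have "norm (P z - P 0) \<le> \<bar>z\<bar> + norm (P' z)"
      using d(2)[of z] norm_triangle_sub[of "P z - P 0" "P' z"] by linarith
    also have "\<dots> \<le> (K + 1) * \<bar>z\<bar>" using K(2)[of z] by (simp add: algebra_simps)
    finally show "norm (P z - P 0) \<le> (K + 1) * \<bar>z\<bar>" .
  qed
qed

lemma stationary_scale:
  assumes "stationary M borel X"
  shows "stationary M borel (\<lambda>t \<omega>. c * X t \<omega> :: real)"
  unfolding stationary_def
proof (intro conjI allI)
  have X[measurable]: "X t \<in> borel_measurable M" for t using assms by (simp add: stationary_def)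
  show "(\<lambda>\<omega>. c * X t \<omega>) \<in> borel_measurable M" for t by measurable
  fix k
  have sc: "(\<lambda>x t. c * x t) \<in> PiM UNIV (\<lambda>_. borel) \<rightarrow>\<^sub>M (PiM UNIV (\<lambda>_. borel) :: (int \<Rightarrow> real) measure)"
    by (rule measurable_paths(2)) measurable
  have "path_law M borel (\<lambda>t \<omega>. c * X (t + k) \<omega>)
      = distr (path_law M borel (\<lambda>t. X (t + k))) (PiM UNIV (\<lambda>_. borel)) (\<lambda>x t. c * x t)" for k
    unfolding path_law_def by (subst distr_distr[OF sc measurable_paths(2)]) (auto simp: comp_def)
  from this[of k] this[of 0] show "path_law M borel (\<lambda>t \<omega>. c * X (t + k) \<omega>) = path_law M borel (\<lambda>t \<omega>. c * X t \<omega>)"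
    using assms by (simp add: stationary_def)
qed

theorem proposition2p3:
  fixes P :: "real \<Rightarrow> real^'d^'d"
    and M0 :: "'a measure"
    and S :: "'n measure"
    and \<G> :: "real \<Rightarrow> 'n \<Rightarrow> real^'d^'d"
    and \<zeta>1 :: "int \<Rightarrow> 'a \<Rightarrow> real"
    and N0 :: "int \<Rightarrow> 'a \<Rightarrow> 'n"
  assumes "\<And>z. row_stochastic (P z)"
    and "assumption_A1 P"
    and "prob_space M0"
    and "assumption_A2 M0 \<zeta>1"
    and "selection_map S \<G>"
    and "\<forall>\<^sub>F \<epsilon> in at_right 0. input_and_noise M0 S P \<G> (\<lambda>t \<omega>. \<epsilon> * \<zeta>1 t \<omega>) N0"
  shows "\<exists>\<epsilon>0>0. \<exists>C. \<forall>\<epsilon>\<in>{0<..\<epsilon>0}.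
    \<exists>(M :: ('n, 'd) paths measure) \<zeta> N \<Gamma> \<Gamma>'.
      prob_space M \<and>
      path_law M (borel \<Otimes>\<^sub>M S) (\<lambda>t \<omega>. (\<zeta> t \<omega>, N t \<omega>))
        = path_law M0 (borel \<Otimes>\<^sub>M S) (\<lambda>t \<omega>. (\<epsilon> * \<zeta>1 t \<omega>, N0 t \<omega>)) \<and>
      controlled_process M S P \<G> \<zeta> N \<Gamma> \<and>
      markov_chain M (P 0) \<Gamma>' \<and>
      stationary M (borel \<Otimes>\<^sub>M borel \<Otimes>\<^sub>M borel) (\<lambda>t \<omega>. (\<Gamma> t \<omega>, \<Gamma>' t \<omega>, \<zeta> t \<omega>)) \<and>
      indep_processes M borel \<Gamma>' borel \<zeta> \<and>
      (\<forall>t. L1_close M (\<Gamma> t) (\<Gamma>' t) (C * \<epsilon>)) \<and>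
      (\<forall>t. norm (LINT \<omega>|M. \<zeta> t \<omega> *\<^sub>R \<Gamma> t \<omega>) \<le> C * \<epsilon>\<^sup>2) \<and>
      (\<forall>t. L1_close M (B_process P \<Gamma> t) (B_process P \<Gamma>' t) (C * \<epsilon>)) \<and>
      (\<forall>t. L1_close M (V_process P \<Gamma> t) (V_process P \<Gamma>' t) (C * \<epsilon>)) \<and>
      (\<forall>t. L1_close M (Delta_process P \<zeta> \<Gamma> t) (Delta_process P (\<lambda>_ _. 0) \<Gamma>' t) (C * \<epsilon>))"
proof -
  have nonneg: "0 \<le> P 0 $ i $ j" for i j using assms(1)[of 0] by (simp add: row_stochastic_def)
  \<comment> \<open>\<open>m\<close>, the word and the local bounds depend on \<open>P\<close> alone
    and are fixed before \<epsilon>, as the uniform constant requires.\<close>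
  obtain m where prim: "\<And>i j. 0 < mat_pow (P 0) m $ i $ j"
    using primitive_matrix[of "P 0"] nonneg assms(2) by (auto simp: assumption_A1_def)
  obtain word target where word: "\<And>l i. l < m \<Longrightarrow> 0 < P 0 $ i $ word l i"
    and sync: "\<And>h s i. (\<And>l. l < m \<Longrightarrow> h (s + int l) = word l) \<Longrightarrow> bcomp h (s + int m) m i = target"
    using synchronizing_word[of "P 0" m] nonneg prim by blast
  obtain L r where L: "0 < L" and r: "0 < r" and contP: "continuous_on {-r..r} P"
    and lipP: "\<And>z. \<bar>z\<bar> \<le> r \<Longrightarrow> norm (P z - P 0) \<le> L * \<bar>z\<bar>"
    using A1_local_bounds[OF assms(2)] by blast
  \<comment> \<open>The least positive entry of \<open>P 0\<close> turns the absolute bound on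
    \<open>P z - P 0\<close> into a relative one; the element 1 makes the set visibly
    nonempty.\<close>
  define pos where "pos = insert 1 {x \<in> range (\<lambda>(i, j). P 0 $ i $ j). 0 < x}"
  define pm where "pm = Min pos"
  have fin: "finite pos" by (simp add: pos_def)
  have "pm \<in> pos" unfolding pm_def by (rule Min_in) (auto simp: fin, simp add: pos_def)
  then have pm: "0 < pm" by (auto simp: pos_def)
  have pm_le: "pm \<le> P 0 $ i $ j" if "0 < P 0 $ i $ j" for i j
    unfolding pm_def using that by (intro Min_le fin) (auto simp: pos_def intro: image_eqI[of _ _ "(i, j)"])
  obtain \<epsilon>1 where \<epsilon>1: "0 < \<epsilon>1" "\<And>\<epsilon>. 0 < \<epsilon> \<Longrightarrow> \<epsilon> < \<epsilon>1 \<Longrightarrow> input_and_noise M0 S P \<G> (\<lambda>t \<omega>. \<epsilon> * \<zeta>1 t \<omega>) N0"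
    using assms(6) by (auto simp: eventually_at_right_field)
  define W where "W = (\<Prod>l<m. \<Prod>i\<in>UNIV. P 0 $ i $ word l i)"
  have W: "0 < W" using word by (auto simp: W_def intro!: prod_pos)
  \<comment> \<open>The bound for \<kappa> divided by \<epsilon>: \<delta> = L \<epsilon> /
    \<open>pm\<close> is inserted and \<open>word_prob\<close> is replaced by its lower bound for
    \<delta> \<le> 1/2.\<close>
  define K where "K = 2 * (real m * (L / pm) / ((1/2) ^ m * W))"
  \<comment> \<open>The sum of the individual constants serves all five estimates at once.\<close>
  define C where "C = K + row_norm_sum (deriv1 P 0) * K + row_norm_sum (deriv2 P 0) * K + row_norm_sum (P 0) * K + L"
  \<comment> \<open>\<open>\<epsilon>1\<close> is halved since the hypothesis holds strictly below
    it, \<open>r\<close> is the range of the local bounds, and the last term ensures \<delta> \<le>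
    1/2.\<close>
  define \<epsilon>0 where "\<epsilon>0 = min (\<epsilon>1 / 2) (min r (pm / (2 * L)))"
  have K: "0 \<le> K" using L pm W by (simp add: K_def)
  have rns: "0 \<le> row_norm_sum A" for A :: "real^'d^'d" by (simp add: row_norm_sum_def sum_nonneg)
  show ?thesis
  proof (rule exI[of _ \<epsilon>0], intro conjI exI[of _ C] ballI)
    show "0 < \<epsilon>0" using \<epsilon>1 r L pm by (simp add: \<epsilon>0_def)
    fix \<epsilon> assume "\<epsilon> \<in> {0<..\<epsilon>0}"
    then have \<epsilon>: "0 < \<epsilon>" "\<epsilon> < \<epsilon>1" "\<epsilon> \<le> r" "\<epsilon> \<le> pm / (2 * L)" using \<epsilon>1 by (auto simp: \<epsilon>0_def)
    \<comment> \<open>Chosen so that \<open>L * \<epsilon> = \<delta> * pm\<close>: a deviation of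
      this size is at most \<delta> times any positive entry of \<open>P 0\<close>.\<close>
    define \<delta> where "\<delta> = L * \<epsilon> / pm"
    have \<delta>: "0 < \<delta>" "\<delta> \<le> 1 / 2" using \<epsilon> L pm by (auto simp: \<delta>_def field_simps)
    have near: "norm (P z - P 0) \<le> L * \<epsilon>" if "\<bar>z\<bar> \<le> \<epsilon>" for z
    proof -
      have "norm (P z - P 0) \<le> L * \<bar>z\<bar>" using that \<epsilon> by (intro lipP) simp
      also have "\<dots> \<le> L * \<epsilon>" using that L by simp
      finally show ?thesis .
    qed
    interpret construction P M0 S \<G> "\<lambda>t \<omega>. \<epsilon> * \<zeta>1 t \<omega>" N0 \<epsilon> "L * \<epsilon>" \<delta> m word target
    proof (intro construction.intro)
      show "row_stochastic (P z)" for z by (rule assms(1))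
      show "prob_space M0" by (rule assms(3))
      show "stationary M0 borel (\<lambda>t \<omega>. \<epsilon> * \<zeta>1 t \<omega>)"
        using assms(4) by (intro stationary_scale) (simp add: assumption_A2_def)
      show "(LINT \<omega>|M0. \<epsilon> * \<zeta>1 t \<omega>) = 0" for t using assms(4) by (simp add: assumption_A2_def)
      have "AE \<omega> in M0. \<forall>t. \<bar>\<zeta>1 t \<omega>\<bar> \<le> 1" using assms(4) by (simp add: assumption_A2_def)
      then show "AE \<omega> in M0. \<forall>t. \<bar>\<epsilon> * \<zeta>1 t \<omega>\<bar> \<le> \<epsilon>"
        by eventually_elim (use \<epsilon> in \<open>simp add: abs_mult mult_left_le\<close>)
      show "selection_map S \<G>" by (rule assms(5))
      show "input_and_noise M0 S P \<G> (\<lambda>t \<omega>. \<epsilon> * \<zeta>1 t \<omega>) N0" by (rule \<epsilon>1) (use \<epsilon> in auto)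
      show "continuous_on {-\<epsilon>..\<epsilon>} P" using \<epsilon> by (intro continuous_on_subset[OF contP]) auto
      show "(1 - \<delta>) * P 0 $ i $ j \<le> P z $ i $ j" if z: "\<bar>z\<bar> \<le> \<epsilon>" for z i j
      proof (cases "0 < P 0 $ i $ j")
        case True
        have "\<bar>(P z - P 0) $ i $ j\<bar> \<le> norm ((P z - P 0) $ i)" by (rule component_le_norm_cart)
        also have "\<dots> \<le> norm (P z - P 0)" by (rule Finite_Cartesian_Product.norm_nth_le)
        also have "\<dots> \<le> L * \<epsilon>" by (rule near[OF z])
        also have "L * \<epsilon> = \<delta> * pm" using pm by (simp add: \<delta>_def)
        also have "\<dots> \<le> \<delta> * P 0 $ i $ j" using \<delta> pm_le[OF True] by simp
        finally show ?thesis by (simp add: algebra_simps abs_le_iff)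
      next
        case False
        then have "P 0 $ i $ j = 0" using nonneg[of i j] by simp
        then show ?thesis using assms(1)[of z] by (simp add: row_stochastic_def)
      qed
    qed (use \<epsilon> \<delta> near word sync in auto)
    \<comment> \<open>This lower bound is free of \<epsilon>, so \<kappa> is at most a fixed
      multiple of \<delta>.\<close>
    have word_prob: "(1/2) ^ m * W \<le> word_prob"
      unfolding word_prob_def pmf_row W_def[symmetric] using \<delta> W by (intro mult_right_mono power_mono) auto
    have "\<kappa> \<le> 2 * (real m * \<delta> / ((1/2) ^ m * W))"
      unfolding \<kappa>_def using word_prob W \<delta> by (intro mult_left_mono divide_left_mono mult_pos_pos word_prob_pos) auto
    also have "\<dots> = K * \<epsilon>" by (simp add: K_def \<delta>_def)
    finally have \<kappa>: "\<kappa> \<le> K * \<epsilon>" .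
    have rk: "row_norm_sum A * \<kappa> \<le> row_norm_sum A * K * \<epsilon>" for A :: "real^'d^'d"
      using mult_left_mono[OF \<kappa> rns[of A]] by (simp add: mult.assoc)
    have nn: "0 \<le> row_norm_sum A * K * \<epsilon>" "0 \<le> K * \<epsilon>" "0 \<le> L * \<epsilon>" for A :: "real^'d^'d"
      using rns[of A] K \<epsilon> L by auto
    have C: "C * \<epsilon> = K * \<epsilon> + row_norm_sum (deriv1 P 0) * K * \<epsilon> + row_norm_sum (deriv2 P 0) * K * \<epsilon> + row_norm_sum (P 0) * K * \<epsilon> + L * \<epsilon>"
      by (simp add: C_def algebra_simps)
    have le: "\<kappa> \<le> C * \<epsilon>" "row_norm_sum (deriv1 P 0) * \<kappa> \<le> C * \<epsilon>" "row_norm_sum (deriv2 P 0) * \<kappa> \<le> C * \<epsilon>"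
      "\<kappa> + row_norm_sum (P 0) * \<kappa> + L * \<epsilon> \<le> C * \<epsilon>"
      unfolding C using \<kappa> rk[of "deriv1 P 0"] rk[of "deriv2 P 0"] rk[of "P 0"]
        nn(1)[of "deriv1 P 0"] nn(1)[of "deriv2 P 0"] nn(1)[of "P 0"] nn(2,3) by linarith+
    have sq: "\<epsilon> * \<kappa> \<le> C * \<epsilon>\<^sup>2"
      using mult_left_mono[OF le(1), of \<epsilon>] \<epsilon> by (simp add: power2_eq_square mult_ac)
    show "\<exists>(M :: ('n, 'd) paths measure) \<zeta> N \<Gamma> \<Gamma>'.
      prob_space M \<and>
      path_law M (borel \<Otimes>\<^sub>M S) (\<lambda>t \<omega>. (\<zeta> t \<omega>, N t \<omega>))
        = path_law M0 (borel \<Otimes>\<^sub>M S) (\<lambda>t \<omega>. (\<epsilon> * \<zeta>1 t \<omega>, N0 t \<omega>)) \<and>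
      controlled_process M S P \<G> \<zeta> N \<Gamma> \<and>
      markov_chain M (P 0) \<Gamma>' \<and>
      stationary M (borel \<Otimes>\<^sub>M borel \<Otimes>\<^sub>M borel) (\<lambda>t \<omega>. (\<Gamma> t \<omega>, \<Gamma>' t \<omega>, \<zeta> t \<omega>)) \<and>
      indep_processes M borel \<Gamma>' borel \<zeta> \<and>
      (\<forall>t. L1_close M (\<Gamma> t) (\<Gamma>' t) (C * \<epsilon>)) \<and>
      (\<forall>t. norm (LINT \<omega>|M. \<zeta> t \<omega> *\<^sub>R \<Gamma> t \<omega>) \<le> C * \<epsilon>\<^sup>2) \<and>
      (\<forall>t. L1_close M (B_process P \<Gamma> t) (B_process P \<Gamma>' t) (C * \<epsilon>)) \<and>
      (\<forall>t. L1_close M (V_process P \<Gamma> t) (V_process P \<Gamma>' t) (C * \<epsilon>)) \<and>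
      (\<forall>t. L1_close M (Delta_process P \<zeta> \<Gamma> t) (Delta_process P (\<lambda>_ _. 0) \<Gamma>' t) (C * \<epsilon>))"
      by (intro exI[of _ M] exI[of _ zM] exI[of _ nM] exI[of _ gM] exI[of _ g0M] conjI allI
          M.prob_space_axioms path_law_M controlled_process_M markov_chain_M stationary_M indep_processes_M
          L1_close_mono[OF close_state le(1)] L1_close_mono[OF close_B le(2)] L1_close_mono[OF close_V le(3)]
          L1_close_mono[OF close_Delta le(4)] order_trans[OF integral_input_state sq])
  qed
qed

end
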